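(* Let $T>0$ and, for $n\in\mathbb{N}$, let $\mathcal{G}_n=\sigma(V_{kT/n},W_{kT/n},Y_{kT/n},\ k=0,\ldots,n)$. Then $$\liminf_{n\to\infty}\, n^{2H}\,\mathbf{E}\big|X_T-\mathbf{E}(X_T\,|\,\mathcal{G}_n)\big|^2\;\geq\;(1-\rho^2)\,\frac{2}{(2H+1)(2H+2)}\,T^{2H+1}e^{2\mu}\,c_1,$$ where $c_1=\frac{\theta^2}{2}\exp\big(2R_Y(0)\big)$ and $R_Y(0)=\theta^2\frac{\Gamma(2H+1)}{2\lambda^{2H}}$.
   Context: Let $(\Omega,\mathcal{F},\mathbf{P})$ be a probability space and $H\in(0,1/2)$. Let $B=\{B_t,t\in\mathbb{R}\}$ be a fractional Brownian motion with Hurst parameter $H$: a centered Gaussian process with continuous paths, $B_0=0$, and $\mathbf{E}|B_t-B_s|^2=|t-s|^{2H}$. Let $V=\{V_t,t\ge0\}$ and $W=\{W_t,t\ge0\}$ be two independent standard Brownian motions; $(B,V,W)$ is jointly Gaussian, $B$ and $W$ are independent, and $\mathbf{E}B_tV_s=\gamma(t,s)$ for some (positive definite) function $\gamma$. There is a filtration $(\mathcal{F}_t)_{t\ge0}$ satisfying the usual conditions such that $(B_t,V_t,W_t)_{t\ge0}$ is $(\mathcal{F}_t)$-adapted, $V,W$ are $(\mathcal{F}_t)$-Brownian motions, and $(B_t)_{t<0}$ is $\mathcal{F}_0$-measurable. Fix $\mu\in\mathbb{R}$, $\lambda,\theta>0$, $\rho\in(-1,1)$. The log-volatility is the stationary fractional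 Ornstein–Uhlenbeck process $Y_t=\mu+\theta e^{-\lambda t}\int_{-\infty}^t e^{\lambda s}\,\mathsf{d}B_s$, $t\in\mathbb{R}$ (pathwise improper Riemann–Stieltjes integral), and $$X_t=-\frac12\int_0^t e^{2Y_s}\,\mathsf{d}s+\rho\int_0^t e^{Y_s}\,\mathsf{d}V_s+\sqrt{1-\rho^2}\int_0^t e^{Y_s}\,\mathsf{d}W_s,$$ with Itô integrals. *)

theory Defs
  imports "HOL-Probability.Probability"
begin

definition gaussian_rv :: "'a measure \<Rightarrow> ('a \<Rightarrow> real) \<Rightarrow> bool" where
  "gaussian_rv M X \<longleftrightarrow> X \<in> borel_measurable M \<and>
     ((\<exists>m s. s > 0 \<and> distributed M lborel X (normal_density m s)) \<or> (\<exists>c. AE \<omega> in M. X \<omega> = c))"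

definition jointly_gaussian3 ::
  "'a measure \<Rightarrow> (real \<Rightarrow> 'a \<Rightarrow> real) \<Rightarrow> (real \<Rightarrow> 'a \<Rightarrow> real) \<Rightarrow> (real \<Rightarrow> 'a \<Rightarrow> real) \<Rightarrow> bool" where
  "jointly_gaussian3 M B V W \<longleftrightarrow>
     (\<forall>J1 J2 J3 (a::real\<Rightarrow>real) (b::real\<Rightarrow>real) (c::real\<Rightarrow>real).
        finite J1 \<and> finite J2 \<and> finite J3 \<and> J2 \<subseteq> {0..} \<and> J3 \<subseteq> {0..} \<longrightarrow>
        gaussian_rv M (\<lambda>\<omega>. (\<Sum>t\<in>J1. a t * B t \<omega>) + (\<Sum>t\<in>J2. b t * V t \<omega>) + (\<Sum>t\<in>J3. c t * W t \<omega>)))"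

definition gen_sigma :: "'a measure \<Rightarrow> ('a \<Rightarrow> real) set \<Rightarrow> 'a measure" where
  "gen_sigma M Fs = sigma (space M) {f -` A \<inter> space M | f A. f \<in> Fs \<and> A \<in> sets borel}"

definition has_RS_integral :: "(real \<Rightarrow> real) \<Rightarrow> (real \<Rightarrow> real) \<Rightarrow> real \<Rightarrow> real \<Rightarrow> real \<Rightarrow> bool" where
  "has_RS_integral f g a b I \<longleftrightarrow>
     (\<forall>\<epsilon>>0. \<exists>\<delta>>0. \<forall>(n::nat) (t::nat\<Rightarrow>real) (\<xi>::nat\<Rightarrow>real).
        t 0 = a \<and> t n = b \<and> (\<forall>i<n. t i \<le> \<xi> i \<and> \<xi> i \<le> t (Suc i) \<and> t (Suc i) - t i < \<delta>) \<longrightarrow>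
        \<bar>(\<Sum>i<n. f (\<xi> i) * (g (t (Suc i)) - g (t i))) - I\<bar> < \<epsilon>)"

definition RS_integral :: "(real \<Rightarrow> real) \<Rightarrow> (real \<Rightarrow> real) \<Rightarrow> real \<Rightarrow> real \<Rightarrow> real" where
  "RS_integral f g a b = (THE I. has_RS_integral f g a b I)"

definition improper_RS_exp :: "real \<Rightarrow> (real \<Rightarrow> real) \<Rightarrow> real \<Rightarrow> real" where
  "improper_RS_exp lam g t = Lim at_bot (\<lambda>a. RS_integral (\<lambda>s. exp (lam * s)) g a t)"

definition fOU :: "real \<Rightarrow> real \<Rightarrow> real \<Rightarrow> (real \<Rightarrow> 'a \<Rightarrow> real) \<Rightarrow> real \<Rightarrow> 'a \<Rightarrow> real" where
  "fOU mu theta lam B t \<omega> = mu + theta * exp (- lam * t) * improper_RS_exp lam (\<lambda>s. B s \<omega>) t"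

definition has_ito_integral ::
  "'a measure \<Rightarrow> (real \<Rightarrow> 'a \<Rightarrow> real) \<Rightarrow> (real \<Rightarrow> 'a \<Rightarrow> real) \<Rightarrow> real \<Rightarrow> ('a \<Rightarrow> real) \<Rightarrow> bool" where
  "has_ito_integral M H Z T I \<longleftrightarrow> I \<in> borel_measurable M \<and>
     (\<forall>(p::nat \<Rightarrow> nat \<Rightarrow> real) (N::nat \<Rightarrow> nat).
        (\<forall>m. p m 0 = 0 \<and> p m (N m) = T \<and> (\<forall>i<N m. p m i \<le> p m (Suc i))) \<and>
        (\<forall>\<epsilon>>0. \<forall>\<^sub>F m in sequentially. \<forall>i<N m. p m (Suc i) - p m i < \<epsilon>) \<longrightarrow>
        (\<forall>m. integrable M (\<lambda>\<omega>. ((\<Sum>i<N m. H (p m i) \<omega> * (Z (p m (Suc i)) \<omega> - Z (p m i) \<omega>)) - I \<omega>)\<^sup>2)) \<and>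
        (\<lambda>m. integral\<^sup>L M (\<lambda>\<omega>. ((\<Sum>i<N m. H (p m i) \<omega> * (Z (p m (Suc i)) \<omega> - Z (p m i) \<omega>)) - I \<omega>)\<^sup>2))
          \<longlonglongrightarrow> 0)"

text \<open>Standard Brownian motion (given joint Gaussianity): starts at 0, continuous
  paths on [0,inf), centred, covariance min.\<close>
definition std_BM :: "'a measure \<Rightarrow> (real \<Rightarrow> 'a \<Rightarrow> real) \<Rightarrow> bool" where
  "std_BM M V \<longleftrightarrow> (\<forall>\<omega>\<in>space M. V 0 \<omega> = 0 \<and> continuous_on {0..} (\<lambda>t. V t \<omega>)) \<and>
     (\<forall>t\<ge>0. V t \<in> borel_measurable M \<and> integral\<^sup>L M (V t) = 0) \<and>
     (\<forall>s\<ge>0. \<forall>t\<ge>0. integrable M (\<lambda>\<omega>. V s \<omega> * V t \<omega>) \<and> integral\<^sup>L M (\<lambda>\<omega>. V s \<omega> * V t \<omega>) = min s t)"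

definition fBm :: "'a measure \<Rightarrow> real \<Rightarrow> (real \<Rightarrow> 'a \<Rightarrow> real) \<Rightarrow> bool" where
  "fBm M H B \<longleftrightarrow> (\<forall>\<omega>\<in>space M. B 0 \<omega> = 0 \<and> continuous_on UNIV (\<lambda>t. B t \<omega>)) \<and>
     (\<forall>t. B t \<in> borel_measurable M \<and> integral\<^sup>L M (B t) = 0) \<and>
     (\<forall>s t. integrable M (\<lambda>\<omega>. (B t \<omega> - B s \<omega>)\<^sup>2) \<and>
            integral\<^sup>L M (\<lambda>\<omega>. (B t \<omega> - B s \<omega>)\<^sup>2) = \<bar>t - s\<bar> powr (2 * H))"

definition usual_filtration :: "'a measure \<Rightarrow> (real \<Rightarrow> 'a measure) \<Rightarrow> bool" where
  "usual_filtration M F \<longleftrightarrow>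
     (\<forall>t\<ge>0. subalgebra M (F t)) \<and>
     (\<forall>s t. 0 \<le> s \<and> s \<le> t \<longrightarrow> sets (F s) \<subseteq> sets (F t)) \<and>
     (\<forall>t\<ge>0. sets (F t) = (\<Inter>s\<in>{t<..}. sets (F s))) \<and>
     null_sets M \<subseteq> sets (F 0)"

definition F_BM :: "'a measure \<Rightarrow> (real \<Rightarrow> 'a measure) \<Rightarrow> (real \<Rightarrow> 'a \<Rightarrow> real) \<Rightarrow> bool" where
  "F_BM M F V \<longleftrightarrow> std_BM M V \<and> (\<forall>t\<ge>0. V t \<in> borel_measurable (F t)) \<and>
     (\<forall>s t. 0 \<le> s \<and> s \<le> t \<longrightarrow>
        prob_space.indep_set M (sets (gen_sigma M {\<lambda>\<omega>. V t \<omega> - V s \<omega>})) (sets (F s)))"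

end

theory Submission
  imports Defs "HOL-Real_Asymp.Real_Asymp"
begin

text \<open>
  Fix \<open>n\<close>. Every random variable \<open>Z\<close> that is orthogonal to \<open>L\<^sup>2(G n)\<close> gives the lower bound
  \<open>E |X - E(X | G n)|\<^sup>2 \<ge> 2 c E(X Z) - c\<^sup>2 E(Z\<^sup>2)\<close>. Split each interval \<open>[k T/n, (k+1) T/n]\<close>
  into \<open>m\<close> pieces and put \<open>Z = \<Sum>i. exp (Y (t i)) U i\<close>, where \<open>U i\<close> is the increment of \<open>W\<close> over
  the \<open>i\<close>-th piece minus \<open>1/m\<close> times the increment of \<open>W\<close> over the surrounding interval. The
  \<open>U i\<close> are uncorrelated with \<open>B\<close>, with \<open>V\<close> and with the observed values of \<open>W\<close>; by joint Gaussianity they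
  are independent of all of these. Hence \<open>Z\<close> is orthogonal to \<open>G n\<close>, to the drift and
  to the integral against \<open>V\<close>, while \<open>E(Z \<integral> exp Y dW) - E(Z\<^sup>2)\<close> tends to zero as \<open>m\<close> grows. As \<open>Y\<close> is stationary and
  Gaussian, \<open>E(Z\<^sup>2)\<close> is an average over the intervals of
  \<open>exp (2 mu + 2 R\<^sub>Y(0)) (1 - exp (- v/2))\<close> with \<open>v = E (Y s - Y u)\<^sup>2\<close>, which behaves like
  \<open>theta\<^sup>2 |s - u| powr (2 H)\<close>; the double integral of \<open>|s - u| powr (2 H)\<close> over an interval
  produces the constant.
\<close>

text \<open>The bridges are what remains random under far more information than \<open>G n\<close>:
  given all of B, all of V and the observed values of W, only the bridges of W are unknown. More
  information lowers the error, hence a lower bound, and it freezes the drift and the integral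
  against V. The factor \<open>1 - rho\<^sup>2\<close> comes from taking
  \<open>c = sqrt (1 - rho\<^sup>2)\<close>. Ito integrals are touched only as L2 limits of Riemann
  sums, so m tends to infinity with n fixed, and the limit in n is taken last. The volatility is
  given pathwise, through a limit that exists only almost surely, while independence of B and W
  concerns uncompleted sigma-algebras; so the exceptional event has to be measurable in the paths of
  B. Integration by parts writes the centred process at time t, divided by theta, as the mean of B t
  - B (t - r) over an exponentially distributed r. For independent exponential r and p the distance
  |r - p| has the law of r, so the single moment m = Gamma (2 H + 1) / lam^(2 H) enters: twice the
  variance plus m equals 2 m. This is the origin of R_Y(0).\<close>

section \<open>Riemann--Stieltjes integrals of exponentials\<close>

text \<open>The value that integration by parts assigns to the Riemann--Stieltjes integral of
  \<open>exp (lam * s)\<close> against \<open>g\<close> over \<open>[a, b]\<close>.\<close>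

definition ibp_exp :: "real \<Rightarrow> (real \<Rightarrow> real) \<Rightarrow> real \<Rightarrow> real \<Rightarrow> real" where
  "ibp_exp lam g a b = exp (lam * b) * g b - exp (lam * a) * g a
     - lam * integral {a..b} (\<lambda>r. exp (lam * r) * g r)"

lemma has_integral_exp_scaled:
  fixes lam a b :: real
  assumes "a \<le> b"
  shows "((\<lambda>r. lam * exp (lam * r)) has_integral (exp (lam * b) - exp (lam * a))) {a..b}"
  by (rule fundamental_theorem_of_calculus[OF assms])
    (auto intro!: derivative_eq_intros simp flip: has_real_derivative_iff_has_vector_derivative)

text \<open>Up to sign, the difference is the integral of \<open>g w - g r\<close> over the part
  left of the tag plus that of \<open>g v - g r\<close> over the part right of it, both against
  \<open>lam * exp (lam * r)\<close> dr. The integrands are bounded by the oscillation, and the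
  total mass of the piece is the difference of the exponentials.\<close>

lemma ibp_exp_piece:
  fixes lam w \<xi> v \<eta> :: real
  assumes g: "continuous_on UNIV g" and lam: "lam > 0" and le: "w \<le> \<xi>" "\<xi> \<le> v"
    and osc: "\<And>r s. r \<in> {w..v} \<Longrightarrow> s \<in> {w..v} \<Longrightarrow> \<bar>g r - g s\<bar> \<le> \<eta>"
  shows "\<bar>exp (lam * \<xi>) * (g v - g w) - ibp_exp lam g w v\<bar> \<le> \<eta> * (exp (lam * v) - exp (lam * w))"
proof -
  have cont: "continuous_on S g" for S
    using g continuous_on_subset by blast
  let ?k = "\<lambda>c r. lam * exp (lam * r) * (c - g r)"
  have bound: "\<bar>(c * (exp (lam * q) - exp (lam * p))) - lam * integral {p..q} (\<lambda>r. exp (lam * r) * g r)\<bar>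
      \<le> \<eta> * (exp (lam * q) - exp (lam * p))"
    if "p \<le> q" "{p..q} \<subseteq> {w..v}" "c = g z" "z \<in> {w..v}" for p q c z
  proof -
    have hi: "((\<lambda>r. exp (lam * r) * g r) has_integral integral {p..q} (\<lambda>r. exp (lam * r) * g r)) {p..q}"
      by (intro integrable_integral integrable_continuous_real continuous_intros cont)
    have "((\<lambda>r. c * (lam * exp (lam * r)) - lam * (exp (lam * r) * g r)) has_integral
        (c * (exp (lam * q) - exp (lam * p)) - lam * integral {p..q} (\<lambda>r. exp (lam * r) * g r))) {p..q}"
      by (intro has_integral_diff has_integral_mult_right has_integral_exp_scaled that hi)
    then have k: "(?k c has_integral
        (c * (exp (lam * q) - exp (lam * p)) - lam * integral {p..q} (\<lambda>r. exp (lam * r) * g r))) {p..q}"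
      by (rule has_integral_eq[rotated]) (simp add: algebra_simps)
    have e: "((\<lambda>r. \<eta> * (lam * exp (lam * r))) has_integral (\<eta> * (exp (lam * q) - exp (lam * p)))) {p..q}"
      by (intro has_integral_mult_right has_integral_exp_scaled that)
    have "norm (integral {p..q} (?k c)) \<le> integral {p..q} (\<lambda>r. \<eta> * (lam * exp (lam * r)))"
    proof (rule integral_norm_bound_integral)
      show "?k c integrable_on {p..q}" "(\<lambda>r. \<eta> * (lam * exp (lam * r))) integrable_on {p..q}"
        using k e by blast+
      show "norm (?k c r) \<le> \<eta> * (lam * exp (lam * r))" if "r \<in> {p..q}" for r
      proof -
        have "\<bar>c - g r\<bar> \<le> \<eta>"
          using osc[of z r] that \<open>{p..q} \<subseteq> {w..v}\<close> \<open>c = g z\<close> \<open>z \<in> {w..v}\<close> by auto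
        then have "\<bar>c - g r\<bar> * (lam * exp (lam * r)) \<le> \<eta> * (lam * exp (lam * r))"
          using lam by (intro mult_right_mono) auto
        then show ?thesis
          using lam by (simp add: abs_mult mult.commute)
      qed
    qed
    then show ?thesis
      unfolding integral_unique[OF k] integral_unique[OF e] real_norm_def .
  qed
  have split: "integral {w..v} (\<lambda>r. exp (lam * r) * g r)
      = integral {w..\<xi>} (\<lambda>r. exp (lam * r) * g r) + integral {\<xi>..v} (\<lambda>r. exp (lam * r) * g r)"
    using le by (intro Henstock_Kurzweil_Integration.integral_combine[symmetric] integrable_continuous_real continuous_intros cont) auto
  have 1: "\<bar>g w * (exp (lam * \<xi>) - exp (lam * w)) - lam * integral {w..\<xi>} (\<lambda>r. exp (lam * r) * g r)\<bar>
      \<le> \<eta> * (exp (lam * \<xi>) - exp (lam * w))"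
    by (rule bound[of _ _ _ w]) (use le in auto)
  have 2: "\<bar>g v * (exp (lam * v) - exp (lam * \<xi>)) - lam * integral {\<xi>..v} (\<lambda>r. exp (lam * r) * g r)\<bar>
      \<le> \<eta> * (exp (lam * v) - exp (lam * \<xi>))"
    by (rule bound[of _ _ _ v]) (use le in auto)
  show ?thesis
    using 1 2 unfolding ibp_exp_def split by (simp add: algebra_simps abs_le_iff)
qed

lemma ibp_exp_combine:
  assumes g: "continuous_on UNIV g" and "a \<le> b" "b \<le> c"
  shows "ibp_exp lam g a b + ibp_exp lam g b c = ibp_exp lam g a c"
proof -
  have cont: "continuous_on S g" for S
    using g continuous_on_subset by blast
  have "integral {a..c} (\<lambda>r. exp (lam * r) * g r)
      = integral {a..b} (\<lambda>r. exp (lam * r) * g r) + integral {b..c} (\<lambda>r. exp (lam * r) * g r)"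
    using assms by (intro Henstock_Kurzweil_Integration.integral_combine[symmetric] integrable_continuous_real continuous_intros cont) auto
  then show ?thesis
    by (simp add: ibp_exp_def algebra_simps)
qed

lemma ibp_exp_refl [simp]: "ibp_exp lam g a a = 0"
  by (simp add: ibp_exp_def)

lemma sum_ibp_exp:
  fixes t :: "nat \<Rightarrow> real"
  assumes g: "continuous_on UNIV g" and mono: "\<forall>i<n. t i \<le> t (Suc i)"
  shows "(\<Sum>i<n. ibp_exp lam g (t i) (t (Suc i))) = ibp_exp lam g (t 0) (t n) \<and> t 0 \<le> t n"
  using mono
proof (induction n)
  case (Suc n)
  then have "t 0 \<le> t n" "t n \<le> t (Suc n)" by auto
  with Suc show ?case
    using ibp_exp_combine[OF g] by auto
qed simp

text \<open>Paths of B need not have bounded variation, so the monotonicity of the exponential has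
  to carry the argument: each piece contributes an error of at most the oscillation of
  \<open>g\<close> times the mass of the piece, and the masses telescope.\<close>

lemma has_RS_integral_exp:
  fixes lam a b :: real
  assumes g: "continuous_on UNIV g" and lam: "lam > 0" and ab: "a \<le> b"
  shows "has_RS_integral (\<lambda>s. exp (lam * s)) g a b (ibp_exp lam g a b)"
  unfolding has_RS_integral_def
proof (intro allI impI)
  fix \<epsilon> :: real assume "\<epsilon> > 0"
  \<comment> \<open>The summand 1 keeps the denominator positive and the final inequality strict,
    also for \<open>a = b\<close>.\<close>
  define \<eta> where "\<eta> = \<epsilon> / (exp (lam * b) - exp (lam * a) + 1)"
  have pos: "exp (lam * b) - exp (lam * a) \<ge> 0"
    using lam ab by simp
  have \<eta>: "\<eta> > 0" "\<eta> * (exp (lam * b) - exp (lam * a)) < \<epsilon>"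
  proof -
    have "D \<ge> 0 \<Longrightarrow> \<epsilon> / (D + 1) > 0 \<and> \<epsilon> / (D + 1) * D < \<epsilon>" for D
      using \<open>\<epsilon> > 0\<close> by (simp add: field_simps)
    then show "\<eta> > 0" "\<eta> * (exp (lam * b) - exp (lam * a)) < \<epsilon>"
      using pos unfolding \<eta>_def by blast+
  qed
  have "uniformly_continuous_on {a..b} g"
    using g by (intro compact_uniformly_continuous continuous_on_subset[OF g]) auto
  then obtain \<delta> where \<delta>: "\<delta> > 0" "\<And>x y. x \<in> {a..b} \<Longrightarrow> y \<in> {a..b} \<Longrightarrow> dist y x < \<delta> \<Longrightarrow> dist (g y) (g x) < \<eta>"
    using \<eta>(1) unfolding uniformly_continuous_on_def by metis
  show "\<exists>\<delta>>0. \<forall>(n::nat) t \<xi>. t 0 = a \<and> t n = b \<and>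
      (\<forall>i<n. t i \<le> \<xi> i \<and> \<xi> i \<le> t (Suc i) \<and> t (Suc i) - t i < \<delta>) \<longrightarrow>
      \<bar>(\<Sum>i<n. exp (lam * \<xi> i) * (g (t (Suc i)) - g (t i))) - ibp_exp lam g a b\<bar> < \<epsilon>"
  proof (intro exI[of _ \<delta>] conjI allI impI \<delta>(1), elim conjE)
    fix n :: nat and t \<xi> :: "nat \<Rightarrow> real"
    assume t0: "t 0 = a" and tn: "t n = b"
      and p: "\<forall>i<n. t i \<le> \<xi> i \<and> \<xi> i \<le> t (Suc i) \<and> t (Suc i) - t i < \<delta>"
    have mono: "\<forall>i<n. t i \<le> t (Suc i)" using p by force
    have mono2: "t i \<le> t j" if "i \<le> j" "j \<le> n" for i j
      using that by (induction rule: dec_induct) (use mono in \<open>auto intro: order_trans simp: Suc_le_eq\<close>)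
    have "\<bar>(\<Sum>i<n. exp (lam * \<xi> i) * (g (t (Suc i)) - g (t i))) - ibp_exp lam g a b\<bar>
        = \<bar>\<Sum>i<n. exp (lam * \<xi> i) * (g (t (Suc i)) - g (t i)) - ibp_exp lam g (t i) (t (Suc i))\<bar>"
      using sum_ibp_exp[OF g mono, of lam] by (simp add: sum_subtractf t0 tn)
    also have "\<dots> \<le> (\<Sum>i<n. \<eta> * (exp (lam * t (Suc i)) - exp (lam * t i)))"
    proof (rule order_trans[OF sum_abs sum_mono])
      fix i assume i: "i \<in> {..<n}"
      have in_ab: "a \<le> t i" "t (Suc i) \<le> b"
        using mono2[of 0 i] mono2[of "Suc i" n] i t0 tn by auto
      show "\<bar>exp (lam * \<xi> i) * (g (t (Suc i)) - g (t i)) - ibp_exp lam g (t i) (t (Suc i))\<bar>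
          \<le> \<eta> * (exp (lam * t (Suc i)) - exp (lam * t i))"
      proof (rule ibp_exp_piece[OF g lam])
        fix r s assume rs: "r \<in> {t i..t (Suc i)}" "s \<in> {t i..t (Suc i)}"
        have "t (Suc i) - t i < \<delta>" using p i by auto
        then have "\<bar>r - s\<bar> < \<delta>" using rs by auto
        then have "dist (g r) (g s) < \<eta>"
          using rs in_ab by (intro \<delta>(2)) (auto simp: dist_real_def)
        then show "\<bar>g r - g s\<bar> \<le> \<eta>" by (simp add: dist_real_def)
      qed (use p i in auto)
    qed
    also have "\<dots> = \<eta> * (exp (lam * b) - exp (lam * a))"
      unfolding sum_distrib_left[symmetric]
      using sum_lessThan_telescope[of "\<lambda>i. exp (lam * t i)" n] by (simp add: t0 tn)
    finally show "\<bar>(\<Sum>i<n. exp (lam * \<xi> i) * (g (t (Suc i)) - g (t i))) - ibp_exp lam g a b\<bar> < \<epsilon>"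
      using \<eta>(2) by linarith
  qed
qed

text \<open>One explicit sequence of left-endpoint sums over \<open>Suc n\<close> equal pieces. It
  identifies the value of \<open>THE\<close> in \<open>RS_integral\<close>, and it exhibits the
  integral as a limit of finite linear combinations of values of the path, which gives measurability
  and Gaussianity later.\<close>

definition RS_sum_exp :: "real \<Rightarrow> (real \<Rightarrow> real) \<Rightarrow> real \<Rightarrow> real \<Rightarrow> nat \<Rightarrow> real" where
  "RS_sum_exp lam g a b n = (\<Sum>i<Suc n. exp (lam * (a + (b - a) * real i / real (Suc n))) *
     (g (a + (b - a) * real (Suc i) / real (Suc n)) - g (a + (b - a) * real i / real (Suc n))))"

lemma RS_sum_exp_tendsto:
  assumes I: "has_RS_integral (\<lambda>s. exp (lam * s)) g a b I" and ab: "a \<le> b"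
  shows "RS_sum_exp lam g a b \<longlonglongrightarrow> I"
proof (rule LIMSEQ_I)
  fix \<epsilon> :: real assume "\<epsilon> > 0"
  then obtain \<delta> where \<delta>: "\<delta> > 0" and P: "\<forall>(n::nat) t \<xi>. t 0 = a \<and> t n = b \<and>
      (\<forall>i<n. t i \<le> \<xi> i \<and> \<xi> i \<le> t (Suc i) \<and> t (Suc i) - t i < \<delta>) \<longrightarrow>
      \<bar>(\<Sum>i<n. exp (lam * \<xi> i) * (g (t (Suc i)) - g (t i))) - I\<bar> < \<epsilon>"
    using I[unfolded has_RS_integral_def, rule_format, OF \<open>\<epsilon> > 0\<close>] by (elim exE conjE)
  obtain n0 where n0: "(b - a) / \<delta> < real n0" using reals_Archimedean2 by blast
  show "\<exists>no. \<forall>n\<ge>no. norm (RS_sum_exp lam g a b n - I) < \<epsilon>"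
  proof (intro exI[of _ n0] allI impI)
    fix n assume "n0 \<le> n"
    then have "(b - a) / \<delta> < real (Suc n)" using n0 by linarith
    then have mesh: "(b - a) / real (Suc n) < \<delta>"
      using \<delta> by (simp add: field_simps)
    define t where "t i = a + (b - a) * real i / real (Suc n)" for i
    have diff: "t (Suc i) - t i = (b - a) / real (Suc n)" for i
      by (simp add: t_def diff_divide_distrib[symmetric] algebra_simps)
    have "\<bar>(\<Sum>i<Suc n. exp (lam * t i) * (g (t (Suc i)) - g (t i))) - I\<bar> < \<epsilon>"
    proof (rule P[rule_format], intro conjI)
      have "t i \<le> t (Suc i)" for i
        using diff[of i] ab by (smt (verit) divide_nonneg_nonneg of_nat_0_le_iff)
      then show "\<forall>i<Suc n. t i \<le> t i \<and> t i \<le> t (Suc i) \<and> t (Suc i) - t i < \<delta>"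
        using mesh diff by auto
    qed (auto simp: t_def)
    then show "norm (RS_sum_exp lam g a b n - I) < \<epsilon>"
      by (simp add: RS_sum_exp_def t_def)
  qed
qed

lemma RS_integral_exp:
  assumes g: "continuous_on UNIV g" and lam: "lam > 0" and ab: "a \<le> b"
  shows "RS_integral (\<lambda>s. exp (lam * s)) g a b = ibp_exp lam g a b"
  unfolding RS_integral_def
proof (rule the_equality)
  show h: "has_RS_integral (\<lambda>s. exp (lam * s)) g a b (ibp_exp lam g a b)"
    by (rule has_RS_integral_exp[OF assms])
  show "I = ibp_exp lam g a b" if "has_RS_integral (\<lambda>s. exp (lam * s)) g a b I" for I
    using LIMSEQ_unique[OF RS_sum_exp_tendsto[OF that ab] RS_sum_exp_tendsto[OF h ab]] .
qed

text \<open>The upper limit 0 serves all times: for t >= 0, additivity changes the integral by a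
  summand that does not depend on the lower limit. Hence a single exceptional event covers every t
  >= 0.\<close>

definition conv_bot :: "real \<Rightarrow> (real \<Rightarrow> real) \<Rightarrow> bool" where
  "conv_bot lam g \<longleftrightarrow> (\<exists>l. ((\<lambda>a. ibp_exp lam g a 0) \<longlongrightarrow> l) at_bot)"

text \<open>The value of \<open>Lim\<close> at a function that does not converge. It makes the fractional
  Ornstein--Uhlenbeck process deterministic, hence measurable, on the exceptional null set.\<close>

definition Lim_junk :: real where
  "Lim_junk = (THE x. False)"

lemma improper_RS_exp_eq:
  assumes g: "continuous_on UNIV g" and lam: "lam > 0" and t: "t \<ge> 0"
  shows "improper_RS_exp lam g t =
    (if conv_bot lam g then Lim at_bot (\<lambda>a. ibp_exp lam g a 0) + ibp_exp lam g 0 t else Lim_junk)"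
proof -
  have ev: "\<forall>\<^sub>F a in at_bot. RS_integral (\<lambda>s. exp (lam * s)) g a t = ibp_exp lam g a 0 + ibp_exp lam g 0 t"
    using eventually_le_at_bot[of 0]
    by eventually_elim (use RS_integral_exp[OF g lam] ibp_exp_combine[OF g _ t] t in auto)
  have iff: "((\<lambda>a. RS_integral (\<lambda>s. exp (lam * s)) g a t) \<longlongrightarrow> l) at_bot
      \<longleftrightarrow> ((\<lambda>a. ibp_exp lam g a 0) \<longlongrightarrow> l - ibp_exp lam g 0 t) at_bot" for l
    unfolding tendsto_cong[OF ev]
    using tendsto_add[of "\<lambda>a. ibp_exp lam g a 0" "l - ibp_exp lam g 0 t" at_bot "\<lambda>_. ibp_exp lam g 0 t" "ibp_exp lam g 0 t"]
      tendsto_diff[of "\<lambda>a. ibp_exp lam g a 0 + ibp_exp lam g 0 t" l at_bot "\<lambda>_. ibp_exp lam g 0 t" "ibp_exp lam g 0 t"]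
    by auto
  show ?thesis
  proof (cases "conv_bot lam g")
    case True
    then obtain l where l: "((\<lambda>a. ibp_exp lam g a 0) \<longlongrightarrow> l) at_bot"
      by (auto simp: conv_bot_def)
    have nt: "(at_bot :: real filter) \<noteq> bot" by (rule trivial_limit_at_bot_linorder)
    have "Lim at_bot (\<lambda>a. RS_integral (\<lambda>s. exp (lam * s)) g a t) = l + ibp_exp lam g 0 t"
      by (rule tendsto_Lim[OF nt]) (use iff l in auto)
    then show ?thesis
      using True tendsto_Lim[OF nt l] by (simp add: improper_RS_exp_def)
  next
    case False
    then show ?thesis
      using iff by (auto simp: improper_RS_exp_def Topological_Spaces.Lim_def Lim_junk_def conv_bot_def)
  qed
qed

section \<open>Centred Gaussian variables and characteristic functions\<close>

text \<open>The law is encoded as the image of the standard normal law under scaling, so that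
  \<open>\<sigma> = 0\<close> gives the point mass at 0 without a case distinction. This makes the
  notion stable under limits.\<close>

definition centered_gaussian :: "'a measure \<Rightarrow> real \<Rightarrow> ('a \<Rightarrow> real) \<Rightarrow> bool" where
  "centered_gaussian M \<sigma> X \<longleftrightarrow> X \<in> borel_measurable M \<and> 0 \<le> \<sigma> \<and>
     distr M borel X = distr std_normal_distribution borel (\<lambda>x. \<sigma> * x)"

lemma centered_gaussian_measurable: "centered_gaussian M \<sigma> X \<Longrightarrow> X \<in> borel_measurable M"
  by (simp add: centered_gaussian_def)

text \<open>Completing the square turns the weighted density into a normal density with mean
  \<open>c\<close>.\<close>

lemma std_normal_exp:
  fixes c :: real
  shows "integrable std_normal_distribution (\<lambda>x. exp (c * x))"
    and "(\<integral>x. exp (c * x) \<partial>std_normal_distribution) = exp (c\<^sup>2 / 2)"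
proof -
  have eq: "std_normal_density x * exp (c * x) = exp (c\<^sup>2 / 2) * normal_density c 1 x" for x
    by (simp add: normal_density_def exp_add[symmetric] power2_eq_square field_simps)
  have "integrable lborel (\<lambda>x. std_normal_density x * exp (c * x))"
    unfolding eq by (intro integrable_mult_right integrable_normal_density) simp
  then show "integrable std_normal_distribution (\<lambda>x. exp (c * x))"
    by (subst integrable_density) auto
  show "(\<integral>x. exp (c * x) \<partial>std_normal_distribution) = exp (c\<^sup>2 / 2)"
    by (subst integral_density) (auto simp: eq)
qed

lemma
  fixes f :: "real \<Rightarrow> real"
  assumes X: "centered_gaussian M \<sigma> X" and [measurable]: "f \<in> borel_measurable borel"
  shows centered_gaussian_integrable:
      "integrable M (\<lambda>\<omega>. f (X \<omega>)) \<longleftrightarrow> integrable std_normal_distribution (\<lambda>x. f (\<sigma> * x))"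
    and centered_gaussian_integral:
      "(\<integral>\<omega>. f (X \<omega>) \<partial>M) = (\<integral>x. f (\<sigma> * x) \<partial>std_normal_distribution)"
proof -
  have [measurable]: "X \<in> borel_measurable M" and d: "distr M borel X = distr std_normal_distribution borel (\<lambda>x. \<sigma> * x)"
    using X by (auto simp: centered_gaussian_def)
  show "integrable M (\<lambda>\<omega>. f (X \<omega>)) \<longleftrightarrow> integrable std_normal_distribution (\<lambda>x. f (\<sigma> * x))"
    using integrable_distr_eq[of X M borel f] integrable_distr_eq[of "\<lambda>x. \<sigma> * x" std_normal_distribution borel f] d
    by simp
  show "(\<integral>\<omega>. f (X \<omega>) \<partial>M) = (\<integral>x. f (\<sigma> * x) \<partial>std_normal_distribution)"
    using integral_distr[of X M borel f] integral_distr[of "\<lambda>x. \<sigma> * x" std_normal_distribution borel f] d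
    by simp
qed

lemma
  assumes X: "centered_gaussian M \<sigma> X"
  shows centered_gaussian_exp_integrable: "integrable M (\<lambda>\<omega>. exp (c * X \<omega>))"
    and centered_gaussian_exp: "(\<integral>\<omega>. exp (c * X \<omega>) \<partial>M) = exp ((c * \<sigma>)\<^sup>2 / 2)"
  using centered_gaussian_integrable[OF X, of "\<lambda>x. exp (c * x)"] centered_gaussian_integral[OF X, of "\<lambda>x. exp (c * x)"]
    std_normal_exp[of "c * \<sigma>"] by (simp_all add: mult.assoc)

lemma
  assumes X: "centered_gaussian M \<sigma> X"
  shows centered_gaussian_power_integrable: "integrable M (\<lambda>\<omega>. X \<omega> ^ k)"
    and centered_gaussian_power_even:
      "(\<integral>\<omega>. X \<omega> ^ (2 * q) \<partial>M) = \<sigma> ^ (2 * q) * (fact (2 * q) / (2 ^ q * fact q))"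
  using centered_gaussian_integrable[OF X, of "\<lambda>x. x ^ k"] centered_gaussian_integral[OF X, of "\<lambda>x. x ^ (2 * q)"]
    integrable_std_normal_distribution_moment[of k] std_normal_distribution_even_moments(1)[of q]
  by (simp_all add: power_mult_distrib)

lemma centered_gaussian_variance:
  assumes X: "centered_gaussian M \<sigma> X"
  shows "(\<integral>\<omega>. (X \<omega>)\<^sup>2 \<partial>M) = \<sigma>\<^sup>2"
  using centered_gaussian_power_even[OF X, of 1] by (simp add: power2_eq_square)

context prob_space
begin

lemma centered_gaussian_iff_char:
  assumes [measurable]: "X \<in> borel_measurable M" and "0 \<le> \<sigma>"
  shows "centered_gaussian M \<sigma> X \<longleftrightarrow> (\<forall>u. (CLINT \<omega>|M. iexp (u * X \<omega>)) = complex_of_real (exp (- (u * \<sigma>)\<^sup>2 / 2)))"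
proof -
  have rd1: "real_distribution (distr M borel X)"
    by (intro real_distribution_distr) auto
  interpret std: real_distribution std_normal_distribution by (rule real_dist_normal_dist)
  have rd2: "real_distribution (distr std_normal_distribution borel (\<lambda>x. \<sigma> * x))"
    by (intro std.real_distribution_distr) auto
  have c1: "char (distr M borel X) u = (CLINT \<omega>|M. iexp (u * X \<omega>))" for u
    by (simp add: char_def integral_distr)
  have c2: "char (distr std_normal_distribution borel (\<lambda>x. \<sigma> * x)) u = complex_of_real (exp (- (u * \<sigma>)\<^sup>2 / 2))" for u
  proof -
    have "char (distr std_normal_distribution borel (\<lambda>x. \<sigma> * x)) u = char std_normal_distribution (u * \<sigma>)"
      by (simp add: char_def integral_distr mult.assoc)
    then show ?thesis by (simp add: char_std_normal_distribution)
  qed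
  show ?thesis
    using Levy_uniqueness[OF rd1 rd2] assms unfolding centered_gaussian_def c1[symmetric] c2[symmetric]
    by (auto simp: fun_eq_iff)
qed

lemma gaussian_rv_imp_centered_gaussian:
  assumes X: "gaussian_rv M X" and mean: "expectation X = 0"
  obtains \<sigma> where "centered_gaussian M \<sigma> X"
proof -
  have [measurable]: "X \<in> borel_measurable M" using X by (simp add: gaussian_rv_def)
  from X consider m s where "s > 0" "distributed M lborel X (normal_density m s)"
    | c where "AE \<omega> in M. X \<omega> = c"
    unfolding gaussian_rv_def by auto
  then show ?thesis
  proof cases
    case 1
    then have "m = 0" using normal_distributed_expectation[OF 1] mean by simp
    then have "distributed M lborel (\<lambda>x. (X x - 0) / s) std_normal_density"
      using normal_standard_normal_convert[OF 1(1), of X m] 1(2) by simp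
    then have d: "distr M lborel (\<lambda>x. X x / s) = std_normal_distribution"
      by (simp add: distributed_def)
    have "distr M borel X = distr (distr M lborel (\<lambda>x. X x / s)) borel (\<lambda>x. s * x)"
      using 1(1) by (subst distr_distr) (auto simp: comp_def)
    then show ?thesis
      using that[of s] 1(1) unfolding centered_gaussian_def d by auto
  next
    case 2
    have "expectation X = expectation (\<lambda>_. c)"
      using 2 by (intro integral_cong_AE) auto
    then have "c = 0" using mean by (simp add: prob_space)
    have "(CLINT \<omega>|M. iexp (u * X \<omega>)) = (CLINT \<omega>|M. 1)" for u
      using 2 \<open>c = 0\<close> by (intro integral_cong_AE) auto
    then have "centered_gaussian M 0 X"
      by (subst centered_gaussian_iff_char) (auto simp: prob_space)
    then show ?thesis by (rule that)
  qed
qed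

lemma iexp_integrable:
  assumes [measurable]: "X \<in> borel_measurable M"
  shows "integrable M (\<lambda>\<omega>. iexp (X \<omega>))"
  by (intro integrable_iexp) auto

text \<open>The characteristic functions converge by dominated convergence; it remains to see that
  the variances converge. The limit is a characteristic function, hence continuous at 0 with value
  1, so its real part is positive at some \<open>u > 0\<close>. Taking the logarithm there recovers
  the limit of the variances and excludes their divergence.\<close>

lemma centered_gaussian_AE_limit:
  fixes X :: "nat \<Rightarrow> 'a \<Rightarrow> real"
  assumes g: "\<And>k. \<exists>\<sigma>. centered_gaussian M \<sigma> (X k)"
    and lim: "AE \<omega> in M. (\<lambda>k. X k \<omega>) \<longlonglongrightarrow> Y \<omega>" and [measurable]: "Y \<in> borel_measurable M"
  shows "\<exists>\<sigma>. centered_gaussian M \<sigma> Y"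
proof -
  from g obtain \<sigma> where \<sigma>: "\<And>k. centered_gaussian M (\<sigma> k) (X k)" by metis
  have [measurable]: "X k \<in> borel_measurable M" for k
    using \<sigma> by (simp add: centered_gaussian_def)
  have s0: "\<sigma> k \<ge> 0" for k using \<sigma> by (simp add: centered_gaussian_def)
  let ?\<phi> = "\<lambda>u. CLINT \<omega>|M. iexp (u * Y \<omega>)"
  have "(\<lambda>k. CLINT \<omega>|M. iexp (u * X k \<omega>)) \<longlonglongrightarrow> ?\<phi> u" for u
  proof (rule integral_dominated_convergence[where w="\<lambda>_. 1"])
    show "AE \<omega> in M. (\<lambda>k. iexp (u * X k \<omega>)) \<longlonglongrightarrow> iexp (u * Y \<omega>)"
      using lim by eventually_elim (auto intro!: tendsto_intros)
  qed auto
  moreover have "(CLINT \<omega>|M. iexp (u * X k \<omega>)) = complex_of_real (exp (- (u * \<sigma> k)\<^sup>2 / 2))" for u k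
    using centered_gaussian_iff_char[of "X k" "\<sigma> k"] \<sigma> s0 by auto
  ultimately have conv: "(\<lambda>k. complex_of_real (exp (- (u * \<sigma> k)\<^sup>2 / 2))) \<longlonglongrightarrow> ?\<phi> u" for u
    by simp
  interpret Y: real_distribution "distr M borel Y"
    by (intro real_distribution_distr) auto
  have cY: "char (distr M borel Y) u = ?\<phi> u" for u
    by (simp add: char_def integral_distr)
  have "char (distr M borel Y) \<midarrow>0\<rightarrow> 1"
    using Y.isCont_char[of 0] Y.char_zero by (simp add: isCont_def)
  then have "\<forall>\<^sub>F u in at 0. dist (char (distr M borel Y) u) 1 < 1"
    by (rule tendstoD) simp
  then obtain d where d: "d > 0" "\<And>u. u \<noteq> 0 \<Longrightarrow> dist u 0 < d \<Longrightarrow> dist (?\<phi> u) 1 < 1"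
    unfolding eventually_at cY by auto
  define u where "u = d / 2"
  have u: "u > 0" "dist (?\<phi> u) 1 < 1" using d(1) d(2)[of u] by (auto simp: u_def)
  have re: "(\<lambda>k. exp (- (u * \<sigma> k)\<^sup>2 / 2)) \<longlonglongrightarrow> Re (?\<phi> u)"
    using tendsto_Re[OF conv[of u]] by simp
  have "Re (?\<phi> u) > 0"
  proof -
    have "\<bar>Re (?\<phi> u - 1)\<bar> < 1" using abs_Re_le_cmod[of "?\<phi> u - 1"] u(2) by (simp add: dist_norm)
    then show ?thesis by (simp add: abs_less_iff)
  qed
  then have "(\<lambda>k. ln (exp (- (u * \<sigma> k)\<^sup>2 / 2))) \<longlonglongrightarrow> ln (Re (?\<phi> u))"
    by (intro tendsto_ln re) auto
  then have "(\<lambda>k. - 2 / u\<^sup>2 * (- (u * \<sigma> k)\<^sup>2 / 2)) \<longlonglongrightarrow> - 2 / u\<^sup>2 * ln (Re (?\<phi> u))"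
    by (intro tendsto_intros) simp
  moreover have "- 2 / u\<^sup>2 * (- (u * \<sigma> k)\<^sup>2 / 2) = (\<sigma> k)\<^sup>2" for k
    using u by (simp add: power_mult_distrib)
  ultimately have lim2: "(\<lambda>k. (\<sigma> k)\<^sup>2) \<longlonglongrightarrow> - 2 / u\<^sup>2 * ln (Re (?\<phi> u))" by simp
  define v where "v = - 2 / u\<^sup>2 * ln (Re (?\<phi> u))"
  have "v \<ge> 0" using LIMSEQ_le_const[OF lim2, of 0] by (auto simp: v_def)
  have "?\<phi> w = complex_of_real (exp (- (w * sqrt v)\<^sup>2 / 2))" for w
  proof (rule LIMSEQ_unique[OF conv])
    show "(\<lambda>k. complex_of_real (exp (- (w * \<sigma> k)\<^sup>2 / 2))) \<longlonglongrightarrow> complex_of_real (exp (- (w * sqrt v)\<^sup>2 / 2))"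
      using lim2 \<open>v \<ge> 0\<close> unfolding v_def[symmetric] by (auto simp: power_mult_distrib intro!: tendsto_intros)
  qed
  then show ?thesis
    using centered_gaussian_iff_char[of Y "sqrt v"] \<open>v \<ge> 0\<close> by auto
qed

text \<open>Adding a large constant makes the signed weight \<open>g\<close> a density, so that
  uniqueness of characteristic functions applies to the weighted law of \<open>X\<close>.\<close>

lemma weighted_Levy_uniqueness:
  fixes g X :: "'a \<Rightarrow> real"
  assumes [measurable]: "g \<in> borel_measurable M" "X \<in> borel_measurable M"
    and bound: "\<And>\<omega>. \<bar>g \<omega>\<bar> \<le> C"
    and zero: "\<And>u. (CLINT \<omega>|M. g \<omega> * iexp (u * X \<omega>)) = 0"
    and [measurable]: "f \<in> borel_measurable borel" and f: "integrable M (\<lambda>\<omega>. f (X \<omega>))"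
  shows "integrable M (\<lambda>\<omega>. g \<omega> * f (X \<omega>))" "(\<integral>\<omega>. g \<omega> * f (X \<omega>) \<partial>M) = (0::real)"
proof -
  define K where "K = \<bar>C\<bar> + 1"
  have K: "K > 0" "\<And>\<omega>. \<bar>g \<omega>\<bar> \<le> K" using bound unfolding K_def by (force intro: order_trans)+
  define h where "h \<omega> = 1 + g \<omega> / K" for \<omega>
  have [measurable]: "h \<in> borel_measurable M" unfolding h_def by measurable
  have h0: "h \<omega> \<ge> 0" "\<bar>h \<omega>\<bar> \<le> 2" for \<omega>
  proof -
    have "\<bar>g \<omega> / K\<bar> \<le> 1" using K by simp
    then show "h \<omega> \<ge> 0" "\<bar>h \<omega>\<bar> \<le> 2" unfolding h_def by linarith+
  qed
  have ig: "integrable M (\<lambda>\<omega>. complex_of_real (g \<omega>) * iexp (u * X \<omega>))" for u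
    by (rule integrable_const_bound[of _ K]) (use K in \<open>auto simp: norm_mult\<close>)
  \<comment> \<open>The hypothesis at frequency 0 says that the weight has total integral 0, so
    \<open>h\<close> has integral 1 and is a probability density.\<close>
  have gint: "(\<integral>\<omega>. g \<omega> \<partial>M) = 0"
    using zero[of 0] by (simp add: integral_complex_of_real)
  have ig': "integrable M g" by (rule integrable_const_bound[of _ K]) (use K in auto)
  define N where "N = density M (\<lambda>\<omega>. ennreal (h \<omega>))"
  have "(\<integral>\<omega>. h \<omega> \<partial>M) = 1"
    unfolding h_def using ig' gint by (simp add: prob_space)
  moreover have "integrable M h" by (rule integrable_const_bound[of _ 2]) (use h0 in auto)
  ultimately have "(\<integral>\<^sup>+\<omega>. h \<omega> \<partial>M) = 1"
    using h0 by (subst nn_integral_eq_integral) auto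
  then have "emeasure N (space N) = 1"
    unfolding N_def by (subst emeasure_density) (auto cong: nn_integral_cong)
  then interpret N: prob_space N by (rule prob_spaceI)
  have [measurable]: "X \<in> borel_measurable N" by (simp add: N_def)
  have "char (distr N borel X) u = char (distr M borel X) u" for u
  proof -
    have "char (distr N borel X) u = (CLINT \<omega>|M. h \<omega> *\<^sub>R iexp (u * X \<omega>))"
      using h0 unfolding N_def by (simp add: char_def integral_distr integral_density)
    also have "\<dots> = (CLINT \<omega>|M. iexp (u * X \<omega>) + (g \<omega> * iexp (u * X \<omega>)) / K)"
      by (rule Bochner_Integration.integral_cong) (auto simp: h_def scaleR_conv_of_real algebra_simps)
    also have "\<dots> = (CLINT \<omega>|M. iexp (u * X \<omega>)) + (CLINT \<omega>|M. g \<omega> * iexp (u * X \<omega>)) / K"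
      using ig[of u] iexp_integrable[of "\<lambda>\<omega>. u * X \<omega>"] by (subst Bochner_Integration.integral_add) auto
    finally show ?thesis using zero by (simp add: char_def integral_distr)
  qed
  then have eq: "distr N borel X = distr M borel X"
    by (intro Levy_uniqueness N.real_distribution_distr real_distribution_distr) auto
  have 1: "integrable N (\<lambda>\<omega>. f (X \<omega>))"
    using f integrable_distr_eq[of X M borel f] integrable_distr_eq[of X N borel f] eq by simp
  have 2: "(\<integral>\<omega>. f (X \<omega>) \<partial>N) = (\<integral>\<omega>. f (X \<omega>) \<partial>M)"
    using integral_distr[of X M borel f] integral_distr[of X N borel f] eq by simp
  have 3: "integrable M (\<lambda>\<omega>. h \<omega> * f (X \<omega>))"
    using 1 h0 unfolding N_def by (subst (asm) integrable_density) auto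
  have 4: "(\<integral>\<omega>. h \<omega> * f (X \<omega>) \<partial>M) = (\<integral>\<omega>. f (X \<omega>) \<partial>M)"
    using 2 h0 unfolding N_def by (subst (asm) integral_density) auto
  have g_eq: "g \<omega> * f (X \<omega>) = K * (h \<omega> * f (X \<omega>) - f (X \<omega>))" for \<omega>
    using K by (simp add: h_def field_simps)
  show "integrable M (\<lambda>\<omega>. g \<omega> * f (X \<omega>))"
    unfolding g_eq using 3 f by auto
  show "(\<integral>\<omega>. g \<omega> * f (X \<omega>) \<partial>M) = 0"
    unfolding g_eq using 3 4 f by simp
qed

text \<open>Induction on the coordinates: uniqueness in the single variable \<open>X j\<close>
  replaces its exponential by the indicator of \<open>A j\<close>, which is then absorbed into the
  weight. Since uniqueness is available for real weights only, the exponential of the remaining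
  coordinates is handled through its cosine and sine.\<close>

lemma weighted_Levy_cylinder:
  fixes g :: "'a \<Rightarrow> real" and X :: "'i \<Rightarrow> 'a \<Rightarrow> real"
  assumes "finite J" and [measurable]: "g \<in> borel_measurable M"
    and X[measurable]: "\<And>j. j \<in> J \<Longrightarrow> X j \<in> borel_measurable M"
    and bound: "\<And>\<omega>. \<bar>g \<omega>\<bar> \<le> C"
    and zero: "\<And>a. (CLINT \<omega>|M. g \<omega> * iexp (\<Sum>j\<in>J. a j * X j \<omega>)) = 0"
    and A: "\<And>j. j \<in> J \<Longrightarrow> A j \<in> sets borel"
  shows "(\<integral>\<omega>. g \<omega> * (\<Prod>j\<in>J. indicator (A j) (X j \<omega>)) \<partial>M) = 0"
  using assms
proof (induction J arbitrary: g rule: finite_induct)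
  case empty
  then show ?case by (simp add: integral_complex_of_real)
next
  case (insert j J)
  note [measurable] = insert.prems(1)
  have [measurable]: "X j \<in> borel_measurable M" "\<And>i. i \<in> J \<Longrightarrow> X i \<in> borel_measurable M"
    "A j \<in> sets borel"
    using insert.prems by auto
  define S where "S a \<omega> = (\<Sum>i\<in>J. a i * X i \<omega>)" for a \<omega>
  have [measurable]: "S a \<in> borel_measurable M" for a unfolding S_def by measurable
  have z: "(CLINT \<omega>|M. g \<omega> * iexp (S a \<omega>) * iexp (u * X j \<omega>)) = 0" for a u
  proof -
    have "(\<Sum>i\<in>insert j J. (a(j := u)) i * X i \<omega>) = u * X j \<omega> + S a \<omega>" for \<omega>
      using insert.hyps by (auto simp: S_def intro!: sum.cong)
    then show ?thesis
      using insert.prems(4)[of "a(j := u)"] by (simp add: exp_add[symmetric] algebra_simps)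
  qed
  \<comment> \<open>Negating the coefficients gives the conjugate exponential. Half the sum and the
    difference divided by \<open>2 * \<i>\<close> then yield the cosine and sine weights, which are
    real and still bounded by \<open>C\<close>.\<close>
  have z': "(CLINT \<omega>|M. g \<omega> * iexp (- S a \<omega>) * iexp (u * X j \<omega>)) = 0" for a u
    using z[of "\<lambda>i. - a i" u] by (simp add: S_def sum_negf)
  have int: "integrable M (\<lambda>\<omega>. g \<omega> * iexp (s * S a \<omega>) * iexp (u * X j \<omega>))" for s :: real and a u
    by (rule integrable_const_bound[of _ C]) (use insert.prems(3) in \<open>auto simp: norm_mult simp flip: of_real_mult\<close>)
  have ind: "(CLINT \<omega>|M. (g \<omega> * indicator (A j) (X j \<omega>)) * iexp (S a \<omega>)) = 0" for a
  proof -
    have ie: "iexp x = complex_of_real (cos x) + \<i> * complex_of_real (sin x)" for x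
      by (simp add: exp_Euler cos_of_real sin_of_real)
    have ie': "iexp (- x) = complex_of_real (cos x) - \<i> * complex_of_real (sin x)" for x
      using ie[of "- x"] by simp
    have "(CLINT \<omega>|M. (g \<omega> * cos (S a \<omega>)) * iexp (u * X j \<omega>)) = 0" for u
    proof -
      have "(CLINT \<omega>|M. (g \<omega> * cos (S a \<omega>)) * iexp (u * X j \<omega>))
          = (CLINT \<omega>|M. (g \<omega> * iexp (S a \<omega>) * iexp (u * X j \<omega>) + g \<omega> * iexp (- S a \<omega>) * iexp (u * X j \<omega>)) / 2)"
        unfolding ie[of "S a _"] ie'[of "S a _"] by (rule Bochner_Integration.integral_cong) (auto simp: field_simps)
      also have "\<dots> = 0"
        using int[of 1 a u] int[of "-1" a u] z[of a u] z'[of a u] by (simp del: of_real_minus)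
      finally show ?thesis .
    qed
    then have c: "(\<integral>\<omega>. (g \<omega> * cos (S a \<omega>)) * indicator (A j) (X j \<omega>) \<partial>M) = 0"
      by (intro weighted_Levy_uniqueness(2)[where C=C])
        (auto simp: abs_mult intro!: integrable_const_bound[of _ 1] order_trans[OF mult_left_le insert.prems(3)])
    have "(CLINT \<omega>|M. (g \<omega> * sin (S a \<omega>)) * iexp (u * X j \<omega>)) = 0" for u
    proof -
      have "(CLINT \<omega>|M. (g \<omega> * sin (S a \<omega>)) * iexp (u * X j \<omega>))
          = (CLINT \<omega>|M. (g \<omega> * iexp (S a \<omega>) * iexp (u * X j \<omega>) - g \<omega> * iexp (- S a \<omega>) * iexp (u * X j \<omega>)) / (2 * \<i>))"
        unfolding ie[of "S a _"] ie'[of "S a _"] by (rule Bochner_Integration.integral_cong) (auto simp: field_simps)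
      also have "\<dots> = 0"
        using int[of 1 a u] int[of "-1" a u] z[of a u] z'[of a u] by (simp del: of_real_minus)
      finally show ?thesis .
    qed
    then have s: "(\<integral>\<omega>. (g \<omega> * sin (S a \<omega>)) * indicator (A j) (X j \<omega>) \<partial>M) = 0"
      by (intro weighted_Levy_uniqueness(2)[where C=C])
        (auto simp: abs_mult intro!: integrable_const_bound[of _ 1] order_trans[OF mult_left_le insert.prems(3)])
    have i1: "integrable M (\<lambda>\<omega>. (g \<omega> * cos (S a \<omega>)) * indicator (A j) (X j \<omega>) :: real)"
      and i2: "integrable M (\<lambda>\<omega>. (g \<omega> * sin (S a \<omega>)) * indicator (A j) (X j \<omega>) :: real)"
      by (rule integrable_const_bound[of _ C];
        auto simp: abs_mult indicator_def intro!: order_trans[OF mult_left_le insert.prems(3)]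
          order_trans[OF abs_ge_zero insert.prems(3)])+
    have "(CLINT \<omega>|M. (g \<omega> * indicator (A j) (X j \<omega>)) * iexp (S a \<omega>))
      = (CLINT \<omega>|M. complex_of_real ((g \<omega> * cos (S a \<omega>)) * indicator (A j) (X j \<omega>))
          + \<i> * complex_of_real ((g \<omega> * sin (S a \<omega>)) * indicator (A j) (X j \<omega>)))"
      unfolding ie by (rule Bochner_Integration.integral_cong) (auto simp: algebra_simps indicator_def)
    also have "\<dots> = 0"
      using i1 i2 c s by (simp add: integral_complex_of_real del: of_real_mult)
    finally show ?thesis .
  qed
  have "(\<integral>\<omega>. (g \<omega> * indicator (A j) (X j \<omega>)) * (\<Prod>i\<in>J. indicator (A i) (X i \<omega>)) \<partial>M) = 0"
  proof (rule insert.IH)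
    show "\<bar>g \<omega> * indicator (A j) (X j \<omega>)\<bar> \<le> C" for \<omega>
      using insert.prems(3)[of \<omega>] order_trans[OF abs_ge_zero insert.prems(3)[of \<omega>]] by (auto simp: indicator_def)
    show "(CLINT \<omega>|M. complex_of_real (g \<omega> * indicator (A j) (X j \<omega>)) * iexp (\<Sum>i\<in>J. a i * X i \<omega>)) = 0" for a
      using ind[of a] by (simp add: S_def)
  qed (use insert.prems in auto)
  then show ?case
    using insert.hyps by (simp add: mult.assoc)
qed

end

section \<open>Orthogonality to generated sigma-algebras\<close>

lemma space_gen_sigma [simp]: "space (gen_sigma M Fs) = space M"
  by (auto simp: gen_sigma_def space_measure_of_conv)

lemma sets_gen_sigma:
  "sets (gen_sigma M Fs) = sigma_sets (space M) {f -` A \<inter> space M | f A. f \<in> Fs \<and> A \<in> sets borel}"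
  unfolding gen_sigma_def by (intro sets_measure_of) auto

lemma measurable_gen_sigma:
  assumes "f \<in> Fs"
  shows "f \<in> borel_measurable (gen_sigma M Fs)"
proof (rule measurableI)
  fix A :: "real set" assume "A \<in> sets borel"
  then show "f -` A \<inter> space (gen_sigma M Fs) \<in> sets (gen_sigma M Fs)"
    using assms unfolding sets_gen_sigma space_gen_sigma by (intro sigma_sets.Basic) auto
qed auto

lemma gen_sigma_subalgebra:
  assumes "space N = space M" and "\<And>f. f \<in> Fs \<Longrightarrow> f \<in> borel_measurable N"
  shows "subalgebra N (gen_sigma M Fs)"
  unfolding subalgebra_def
proof
  show "sets (gen_sigma M Fs) \<subseteq> sets N"
    unfolding sets_gen_sigma assms(1)[symmetric]
    by (intro sets.sigma_sets_subset) (auto intro: measurable_sets assms(2))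
qed (simp add: assms)

lemma integrable_mult_square:
  fixes X Y :: "'a \<Rightarrow> real"
  assumes [measurable]: "X \<in> borel_measurable M" "Y \<in> borel_measurable M"
    and "integrable M (\<lambda>\<omega>. (X \<omega>)\<^sup>2)" "integrable M (\<lambda>\<omega>. (Y \<omega>)\<^sup>2)"
  shows "integrable M (\<lambda>\<omega>. X \<omega> * Y \<omega>)"
proof (rule Bochner_Integration.integrable_bound)
  show "integrable M (\<lambda>\<omega>. (X \<omega>)\<^sup>2 + (Y \<omega>)\<^sup>2)" using assms by auto
  show "AE \<omega> in M. norm (X \<omega> * Y \<omega>) \<le> norm ((X \<omega>)\<^sup>2 + (Y \<omega>)\<^sup>2)"
  proof (rule AE_I2)
    fix \<omega>
    have "\<bar>x * y\<bar> \<le> x\<^sup>2 + y\<^sup>2" for x y :: real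
      using zero_le_power2[of "x - y"] zero_le_power2[of "x + y"] zero_le_power2[of x] zero_le_power2[of y]
      unfolding power2_diff power2_sum by (simp add: abs_le_iff)
    then show "norm (X \<omega> * Y \<omega>) \<le> norm ((X \<omega>)\<^sup>2 + (Y \<omega>)\<^sup>2)" by simp
  qed
qed measurable

lemma square_integrable_add:
  fixes X Y :: "'a \<Rightarrow> real"
  assumes [measurable]: "X \<in> borel_measurable M" "Y \<in> borel_measurable M"
    and "integrable M (\<lambda>\<omega>. (X \<omega>)\<^sup>2)" "integrable M (\<lambda>\<omega>. (Y \<omega>)\<^sup>2)"
  shows "integrable M (\<lambda>\<omega>. (X \<omega> + Y \<omega>)\<^sup>2)"
  using assms integrable_mult_square[OF assms] by (simp add: power2_sum mult.assoc)

lemma square_integrable_cmult: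
  fixes X :: "'a \<Rightarrow> real"
  assumes "integrable M (\<lambda>\<omega>. (X \<omega>)\<^sup>2)"
  shows "integrable M (\<lambda>\<omega>. (c * X \<omega>)\<^sup>2)"
  using assms by (simp add: power_mult_distrib)

lemma square_integrable_diff:
  fixes X Y :: "'a \<Rightarrow> real"
  assumes [measurable]: "X \<in> borel_measurable M" "Y \<in> borel_measurable M"
    and "integrable M (\<lambda>\<omega>. (X \<omega>)\<^sup>2)" "integrable M (\<lambda>\<omega>. (Y \<omega>)\<^sup>2)"
  shows "integrable M (\<lambda>\<omega>. (X \<omega> - Y \<omega>)\<^sup>2)"
  using square_integrable_add[of X M "\<lambda>\<omega>. - Y \<omega>"] assms by simp

lemma square_integrable_sum:
  fixes X :: "'i \<Rightarrow> 'a \<Rightarrow> real"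
  assumes "finite I" "\<And>i. i \<in> I \<Longrightarrow> X i \<in> borel_measurable M" "\<And>i. i \<in> I \<Longrightarrow> integrable M (\<lambda>\<omega>. (X i \<omega>)\<^sup>2)"
  shows "integrable M (\<lambda>\<omega>. (\<Sum>i\<in>I. X i \<omega>)\<^sup>2)"
  using assms
proof (induction I rule: finite_induct)
  case (insert i I)
  then have "integrable M (\<lambda>\<omega>. (X i \<omega> + (\<Sum>i\<in>I. X i \<omega>))\<^sup>2)"
    by (intro square_integrable_add) auto
  with insert show ?case by simp
qed simp

context prob_space
begin

lemma integrable_of_square:
  fixes X :: "'a \<Rightarrow> real"
  assumes "X \<in> borel_measurable M" "integrable M (\<lambda>\<omega>. (X \<omega>)\<^sup>2)"
  shows "integrable M X"
  using integrable_mult_square[of X M "\<lambda>_. 1"] assms by simp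

lemma sigma_finite_subalgebraI:
  assumes "subalgebra M G"
  shows "sigma_finite_subalgebra M G"
proof -
  interpret finite_measure_subalgebra M G
    using assms by unfold_locales
  show ?thesis by (rule sigma_finite_subalgebra_axioms)
qed

text \<open>Vanishing against indicators means that the conditional expectation of \<open>U\<close>
  is 0 almost everywhere; pulling \<open>f\<close> out of the conditional expectation then treats
  unbounded \<open>f\<close> without approximation.\<close>

lemma orthogonal_to_subalgebra:
  fixes U :: "'a \<Rightarrow> real"
  assumes sub: "subalgebra M G" and U: "integrable M U"
    and zero: "\<And>A. A \<in> sets G \<Longrightarrow> (\<integral>\<omega>. U \<omega> * indicator A \<omega> \<partial>M) = 0"
    and f: "f \<in> borel_measurable G" "integrable M (\<lambda>\<omega>. f \<omega> * U \<omega>)"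
  shows "(\<integral>\<omega>. f \<omega> * U \<omega> \<partial>M) = 0"
proof -
  interpret G: sigma_finite_subalgebra M G by (rule sigma_finite_subalgebraI[OF sub])
  have "AE \<omega> in M. real_cond_exp M G U \<omega> = 0"
    by (rule G.real_cond_exp_charact) (use zero U in \<open>auto simp: set_lebesgue_integral_def mult.commute\<close>)
  then have "(\<integral>\<omega>. f \<omega> * real_cond_exp M G U \<omega> \<partial>M) = (\<integral>\<omega>. 0 \<partial>M)"
    by (intro integral_cong_AE) (use f sub in \<open>auto intro: measurable_from_subalg\<close>)
  then show ?thesis
    using G.real_cond_exp_intg(2)[OF f(2,1)] U by simp
qed

lemma square_integrable_real_cond_exp:
  fixes X :: "'a \<Rightarrow> real"
  assumes sub: "subalgebra M G" and [measurable]: "X \<in> borel_measurable M"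
    and X2: "integrable M (\<lambda>\<omega>. (X \<omega>)\<^sup>2)"
  shows "integrable M (\<lambda>\<omega>. (real_cond_exp M G X \<omega>)\<^sup>2)"
proof -
  interpret G: sigma_finite_subalgebra M G by (rule sigma_finite_subalgebraI[OF sub])
  have "AE \<omega> in M. (real_cond_exp M G X \<omega>)\<^sup>2 \<le> real_cond_exp M G (\<lambda>\<omega>. (X \<omega>)\<^sup>2) \<omega>"
    by (rule G.real_cond_exp_jensens_inequality(2)[where I=UNIV])
      (use X2 in \<open>auto intro: integrable_of_square convex_power2\<close>)
  then have "AE \<omega> in M. norm ((real_cond_exp M G X \<omega>)\<^sup>2) \<le> norm (real_cond_exp M G (\<lambda>\<omega>. (X \<omega>)\<^sup>2) \<omega>)"
    by eventually_elim auto
  then show ?thesis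
    by (rule Bochner_Integration.integrable_bound[OF G.real_cond_exp_int(1)[OF X2], rotated]) measurable
qed

text \<open>Expand \<open>0 \<le> E (D - c Z)\<^sup>2\<close> for the residual \<open>D\<close>, using that \<open>Z\<close> is orthogonal to the
  conditional expectation.\<close>

lemma cond_exp_residual_lower_bound:
  fixes X Z :: "'a \<Rightarrow> real"
  assumes sub: "subalgebra M G" and [measurable]: "X \<in> borel_measurable M" "Z \<in> borel_measurable M"
    and X2: "integrable M (\<lambda>\<omega>. (X \<omega>)\<^sup>2)" and Z2: "integrable M (\<lambda>\<omega>. (Z \<omega>)\<^sup>2)"
    and zero: "\<And>A. A \<in> sets G \<Longrightarrow> (\<integral>\<omega>. Z \<omega> * indicator A \<omega> \<partial>M) = 0"
  shows "(\<integral>\<omega>. (X \<omega> - real_cond_exp M G X \<omega>)\<^sup>2 \<partial>M)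
    \<ge> 2 * c * (\<integral>\<omega>. X \<omega> * Z \<omega> \<partial>M) - c\<^sup>2 * (\<integral>\<omega>. (Z \<omega>)\<^sup>2 \<partial>M)"
proof -
  let ?E = "real_cond_exp M G X"
  have [measurable]: "?E \<in> borel_measurable M" "?E \<in> borel_measurable G"
    by auto
  have E2: "integrable M (\<lambda>\<omega>. (?E \<omega>)\<^sup>2)" by (rule square_integrable_real_cond_exp) fact+
  have D2: "integrable M (\<lambda>\<omega>. (X \<omega> - ?E \<omega>)\<^sup>2)" by (intro square_integrable_diff X2 E2) auto
  have DZ: "integrable M (\<lambda>\<omega>. (X \<omega> - ?E \<omega>) * Z \<omega>)" by (intro integrable_mult_square D2 Z2) auto
  have EZ: "integrable M (\<lambda>\<omega>. ?E \<omega> * Z \<omega>)" by (intro integrable_mult_square E2 Z2) auto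
  have XZ: "integrable M (\<lambda>\<omega>. X \<omega> * Z \<omega>)" by (intro integrable_mult_square X2 Z2) auto
  have "(\<integral>\<omega>. ?E \<omega> * Z \<omega> \<partial>M) = 0"
    by (rule orthogonal_to_subalgebra[OF sub _ zero]) (use EZ Z2 in \<open>auto intro: integrable_of_square\<close>)
  then have eq: "(\<integral>\<omega>. (X \<omega> - ?E \<omega>) * Z \<omega> \<partial>M) = (\<integral>\<omega>. X \<omega> * Z \<omega> \<partial>M)"
    using XZ EZ by (simp add: left_diff_distrib)
  have "0 \<le> (\<integral>\<omega>. ((X \<omega> - ?E \<omega>) - c * Z \<omega>)\<^sup>2 \<partial>M)" by simp
  also have "\<dots> = (\<integral>\<omega>. (X \<omega> - ?E \<omega>)\<^sup>2 - 2 * c * ((X \<omega> - ?E \<omega>) * Z \<omega>) + c\<^sup>2 * (Z \<omega>)\<^sup>2 \<partial>M)"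
    by (rule Bochner_Integration.integral_cong) (auto simp: power2_eq_square algebra_simps)
  also have "\<dots> = (\<integral>\<omega>. (X \<omega> - ?E \<omega>)\<^sup>2 \<partial>M) - 2 * c * (\<integral>\<omega>. X \<omega> * Z \<omega> \<partial>M) + c\<^sup>2 * (\<integral>\<omega>. (Z \<omega>)\<^sup>2 \<partial>M)"
    using D2 DZ Z2 by (simp add: eq)
  finally show ?thesis by simp
qed

text \<open>Uncorrelatedness removes the mixed term from the variance of a linear combination, so
  joint characteristic functions factorize. Uniqueness is used twice: in the members of
  \<open>S\<close>, to replace exponentials by a cylinder event, and in \<open>U\<close>, to replace
  exponentials by \<open>U\<close> itself. Cylinder events are stable under intersection and
  generate the sigma-algebra, so a Dynkin argument finishes.\<close>

lemma gaussian_orthogonal_gen_sigma: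
  fixes U :: "'a \<Rightarrow> real"
  assumes gauss: "\<And>J a u. finite J \<Longrightarrow> J \<subseteq> S \<Longrightarrow> \<exists>\<sigma>. centered_gaussian M \<sigma> (\<lambda>\<omega>. u * U \<omega> + (\<Sum>X\<in>J. a X * X \<omega>))"
    and uncor: "\<And>X. X \<in> S \<Longrightarrow> (\<integral>\<omega>. U \<omega> * X \<omega> \<partial>M) = 0"
    and A: "A \<in> sets (gen_sigma M S)"
  shows "(\<integral>\<omega>. U \<omega> * indicator A \<omega> \<partial>M) = 0"
proof -
  have gU: "\<exists>\<sigma>. centered_gaussian M \<sigma> U" using gauss[of "{}" 1] by simp
  have gX: "\<exists>\<sigma>. centered_gaussian M \<sigma> X" if "X \<in> S" for X
    using gauss[of "{X}" 0 "\<lambda>_. 1"] that by simp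
  have [measurable]: "U \<in> borel_measurable M" using gU by (auto intro: centered_gaussian_measurable)
  have SM[measurable]: "X \<in> borel_measurable M" if "X \<in> S" for X
    using gX[OF that] by (auto intro: centered_gaussian_measurable)
  have U2: "integrable M (\<lambda>\<omega>. (U \<omega>)\<^sup>2)" using gU centered_gaussian_power_integrable by auto
  have iU: "integrable M U" using U2 by (auto intro: integrable_of_square)
  have EU: "(\<integral>\<omega>. U \<omega> \<partial>M) = 0"
    using gU centered_gaussian_integral[of M _ U "\<lambda>x. x"] integral_std_normal_distribution_moment_odd[of 1] by auto
  have X2: "integrable M (\<lambda>\<omega>. (X \<omega>)\<^sup>2)" if "X \<in> S" for X using gX[OF that] centered_gaussian_power_integrable by auto
  define v where "v = (\<integral>\<omega>. (U \<omega>)\<^sup>2 \<partial>M)"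
  have chf: "(CLINT \<omega>|M. iexp (u * U \<omega> + (\<Sum>X\<in>J. a X * X \<omega>)))
      = complex_of_real (exp (- (u\<^sup>2 * v + (\<integral>\<omega>. (\<Sum>X\<in>J. a X * X \<omega>)\<^sup>2 \<partial>M)) / 2))"
    if J: "finite J" "J \<subseteq> S" for J a u
  proof -
    let ?S = "\<lambda>\<omega>. \<Sum>X\<in>J. a X * X \<omega>"
    have [measurable]: "?S \<in> borel_measurable M" using J by (intro borel_measurable_sum) auto
    have S2: "integrable M (\<lambda>\<omega>. (?S \<omega>)\<^sup>2)"
      using J X2 by (intro square_integrable_sum square_integrable_cmult) auto
    have UX: "integrable M (\<lambda>\<omega>. U \<omega> * X \<omega>)" if "X \<in> J" for X
      using that J U2 X2 by (intro integrable_mult_square) auto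
    have US: "(\<integral>\<omega>. U \<omega> * ?S \<omega> \<partial>M) = 0"
    proof -
      have "(\<integral>\<omega>. U \<omega> * ?S \<omega> \<partial>M) = (\<integral>\<omega>. (\<Sum>X\<in>J. a X * (U \<omega> * X \<omega>)) \<partial>M)"
        by (simp add: sum_distrib_left mult.left_commute)
      also have "\<dots> = (\<Sum>X\<in>J. a X * (\<integral>\<omega>. U \<omega> * X \<omega> \<partial>M))"
        using UX by (subst Bochner_Integration.integral_sum) auto
      finally show ?thesis using uncor J by (simp add: subset_iff)
    qed
    have iUS: "integrable M (\<lambda>\<omega>. U \<omega> * ?S \<omega>)" by (intro integrable_mult_square U2 S2) auto
    obtain \<sigma> where \<sigma>: "centered_gaussian M \<sigma> (\<lambda>\<omega>. u * U \<omega> + ?S \<omega>)" using gauss[OF J] by blast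
    have "\<sigma>\<^sup>2 = (\<integral>\<omega>. (u * U \<omega> + ?S \<omega>)\<^sup>2 \<partial>M)" using centered_gaussian_variance[OF \<sigma>] by simp
    also have "\<dots> = (\<integral>\<omega>. u\<^sup>2 * (U \<omega>)\<^sup>2 + 2 * u * (U \<omega> * ?S \<omega>) + (?S \<omega>)\<^sup>2 \<partial>M)"
      by (rule Bochner_Integration.integral_cong) (auto simp: power2_sum power_mult_distrib)
    also have "\<dots> = u\<^sup>2 * v + (\<integral>\<omega>. (?S \<omega>)\<^sup>2 \<partial>M)"
      using U2 iUS S2 US by (simp add: v_def)
    finally have s: "\<sigma>\<^sup>2 = u\<^sup>2 * v + (\<integral>\<omega>. (?S \<omega>)\<^sup>2 \<partial>M)" .
    have "\<sigma> \<ge> 0" using \<sigma> by (simp add: centered_gaussian_def)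
    then have "(CLINT \<omega>|M. iexp (1 * (u * U \<omega> + ?S \<omega>))) = complex_of_real (exp (- (1 * \<sigma>)\<^sup>2 / 2))"
      by (rule iffD1[OF centered_gaussian_iff_char \<sigma>, THEN spec, of 1, rotated 1]) measurable
    then show ?thesis by (simp add: s)
  qed
  define cyl where "cyl = {A. \<exists>J E. finite J \<and> J \<subseteq> S \<and> (\<forall>X\<in>J. E X \<in> sets borel) \<and>
      A = {\<omega> \<in> space M. \<forall>X\<in>J. X \<omega> \<in> E X}}"
  have cyl: "C \<in> sets M \<and> (\<integral>\<omega>. U \<omega> * indicator C \<omega> \<partial>M) = 0" if C: "C \<in> cyl" for C
  proof
    from C obtain J E where J: "finite J" "J \<subseteq> S" and E: "\<And>X. X \<in> J \<Longrightarrow> E X \<in> sets borel"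
      and C_eq: "C = {\<omega> \<in> space M. \<forall>X\<in>J. X \<omega> \<in> E X}" unfolding cyl_def by blast
    have JM: "X \<in> borel_measurable M" if "X \<in> J" for X using that J by auto
    have "{\<omega> \<in> space M. X \<omega> \<in> E X} \<in> sets M" if "X \<in> J" for X
      using measurable_sets[OF JM[OF that] E[OF that]] by (simp add: vimage_def Int_def conj_commute)
    then show CM[measurable]: "C \<in> sets M"
      unfolding C_eq using J by (intro sets.sets_Collect_finite_All) auto
    have prod: "(\<Prod>X\<in>J. indicator (E X) (X \<omega>)) = (indicator C \<omega> :: real)" if "\<omega> \<in> space M" for \<omega>
    proof (cases "\<forall>X\<in>J. X \<omega> \<in> E X")
      case True then show ?thesis using that by (auto simp: C_eq indicator_def)
    next
      case False
      then have "(\<Prod>X\<in>J. indicator (E X) (X \<omega>)) = (0::real)"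
        using J by (intro prod_zero) (auto simp: indicator_def)
      then show ?thesis using False by (auto simp: C_eq indicator_def)
    qed
    let ?S = "\<lambda>a \<omega>. \<Sum>X\<in>J. a X * X \<omega>"
    have [measurable]: "?S a \<in> borel_measurable M" for a using J by (intro borel_measurable_sum) auto
    have ie: "integrable M (\<lambda>\<omega>. iexp (u * U \<omega> + ?S a \<omega>))" for u a
      by (intro iexp_integrable) measurable
    have cyl0: "(\<integral>\<omega>. g \<omega> * indicator C \<omega> \<partial>M) = 0"
      if [measurable]: "g \<in> borel_measurable M" and b: "\<And>\<omega>. \<bar>g \<omega>\<bar> \<le> 2"
        and z: "\<And>a. (CLINT \<omega>|M. g \<omega> * iexp (?S a \<omega>)) = 0" for g :: "'a \<Rightarrow> real"
    proof -
      have "(\<integral>\<omega>. g \<omega> * (\<Prod>X\<in>J. indicator (E X) (X \<omega>)) \<partial>M) = 0"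
        by (rule weighted_Levy_cylinder[where C=2 and X="\<lambda>X. X"]) (use b z E J JM in auto)
      then show ?thesis using prod by (simp cong: Bochner_Integration.integral_cong)
    qed
    have iee: "iexp x = complex_of_real (cos x) + \<i> * complex_of_real (sin x)" for x
      by (simp add: exp_Euler cos_of_real sin_of_real)
    have add: "iexp (x + y) = iexp x * iexp y" for x y by (simp add: exp_add[symmetric] algebra_simps)
    have sub: "iexp (- x + y) = (complex_of_real (cos x) - \<i> * complex_of_real (sin x)) * iexp y" for x y
      unfolding add using iee[of "- x"] by simp
    \<comment> \<open>The cosine minus its mean, and below the sine, whose mean is 0, are bounded
      real weights. By the factorization \<open>chf\<close> both are orthogonal to every exponential
      in the variables of \<open>J\<close>.\<close>
    have cosz: "(\<integral>\<omega>. (cos (u * U \<omega>) - exp (- (u\<^sup>2 * v) / 2)) * indicator C \<omega> \<partial>M) = 0" for u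
    proof (rule cyl0)
      have "v \<ge> 0" by (simp add: v_def)
      then have "exp (- (u\<^sup>2 * v) / 2) \<le> 1" by simp
      then show "\<bar>cos (u * U \<omega>) - exp (- (u\<^sup>2 * v) / 2)\<bar> \<le> 2" for \<omega>
        using cos_le_one[of "u * U \<omega>"] cos_ge_minus_one[of "u * U \<omega>"] exp_gt_zero[of "- (u\<^sup>2 * v) / 2"] by linarith
      show "(CLINT \<omega>|M. complex_of_real (cos (u * U \<omega>) - exp (- (u\<^sup>2 * v) / 2)) * iexp (?S a \<omega>)) = 0" for a
      proof -
        have "(CLINT \<omega>|M. complex_of_real (cos (u * U \<omega>) - exp (- (u\<^sup>2 * v) / 2)) * iexp (?S a \<omega>))
          = (CLINT \<omega>|M. (iexp (u * U \<omega> + ?S a \<omega>) + iexp (- u * U \<omega> + ?S a \<omega>)) / 2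
              - complex_of_real (exp (- (u\<^sup>2 * v) / 2)) * iexp (0 * U \<omega> + ?S a \<omega>))"
        proof (rule Bochner_Integration.integral_cong[OF refl])
          fix \<omega>
          have m: "- u * U \<omega> = - (u * U \<omega>)" by simp
          show "complex_of_real (cos (u * U \<omega>) - exp (- (u\<^sup>2 * v) / 2)) * iexp (?S a \<omega>)
            = (iexp (u * U \<omega> + ?S a \<omega>) + iexp (- u * U \<omega> + ?S a \<omega>)) / 2
              - complex_of_real (exp (- (u\<^sup>2 * v) / 2)) * iexp (0 * U \<omega> + ?S a \<omega>)"
            unfolding m sub add[of "u * U \<omega>"] iee[of "u * U \<omega>"]
            by (simp add: algebra_simps del: of_real_sum)
        qed
        also have "\<dots> = ((CLINT \<omega>|M. iexp (u * U \<omega> + ?S a \<omega>)) + (CLINT \<omega>|M. iexp (- u * U \<omega> + ?S a \<omega>))) / 2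
              - complex_of_real (exp (- (u\<^sup>2 * v) / 2)) * (CLINT \<omega>|M. iexp (0 * U \<omega> + ?S a \<omega>))"
          using ie[of u a] ie[of "- u" a] ie[of 0 a]
          by (subst Bochner_Integration.integral_diff) (auto simp del: of_real_sum of_real_add)
        also have "\<dots> = 0"
          unfolding chf[OF J] by (simp add: exp_add[symmetric] add_divide_distrib[symmetric] flip: of_real_mult)
        finally show ?thesis .
      qed
    qed measurable
    have sinz: "(\<integral>\<omega>. sin (u * U \<omega>) * indicator C \<omega> \<partial>M) = 0" for u
    proof (rule cyl0)
      show "\<bar>sin (u * U \<omega>)\<bar> \<le> 2" for \<omega>
        using abs_sin_le_one[of "u * U \<omega>"] by linarith
      show "(CLINT \<omega>|M. complex_of_real (sin (u * U \<omega>)) * iexp (?S a \<omega>)) = 0" for a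
      proof -
        have "(CLINT \<omega>|M. complex_of_real (sin (u * U \<omega>)) * iexp (?S a \<omega>))
          = (CLINT \<omega>|M. (iexp (u * U \<omega> + ?S a \<omega>) - iexp (- u * U \<omega> + ?S a \<omega>)) / (2 * \<i>))"
        proof (rule Bochner_Integration.integral_cong[OF refl])
          fix \<omega>
          have m: "- u * U \<omega> = - (u * U \<omega>)" by simp
          show "complex_of_real (sin (u * U \<omega>)) * iexp (?S a \<omega>)
            = (iexp (u * U \<omega> + ?S a \<omega>) - iexp (- u * U \<omega> + ?S a \<omega>)) / (2 * \<i>)"
            unfolding m sub add[of "u * U \<omega>"] iee[of "u * U \<omega>"]
            by (simp add: field_simps del: of_real_sum)
        qed
        also have "\<dots> = ((CLINT \<omega>|M. iexp (u * U \<omega> + ?S a \<omega>)) - (CLINT \<omega>|M. iexp (- u * U \<omega> + ?S a \<omega>))) / (2 * \<i>)"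
          using ie[of u a] ie[of "- u" a]
          by (auto simp del: of_real_sum of_real_add)
        also have "\<dots> = 0"
          unfolding chf[OF J] by simp
        finally show ?thesis .
      qed
    qed measurable
    have bdd: "integrable M (\<lambda>\<omega>. g \<omega> * indicator C \<omega>)" if [measurable]: "g \<in> borel_measurable M" and "\<And>\<omega>. \<bar>g \<omega>\<bar> \<le> 1" for g :: "'a \<Rightarrow> real"
      by (rule integrable_const_bound[of _ 1]) (use that in \<open>auto simp: indicator_def\<close>)
    \<comment> \<open>Second use of uniqueness, with the roles exchanged: the centred indicator of
      the cylinder is now the weight and \<open>U\<close> the variable.\<close>
    have "(\<integral>\<omega>. (indicator C \<omega> - prob C) * U \<omega> \<partial>M) = 0"
    proof (rule weighted_Levy_uniqueness(2)[where f="\<lambda>x. x" and C=1])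
      have "prob C \<le> 1" "prob C \<ge> 0" by auto
      then show "\<bar>indicator C \<omega> - prob C\<bar> \<le> 1" for \<omega>
        by (auto simp: indicator_def)
      fix u
      have chU: "(CLINT \<omega>|M. iexp (u * U \<omega>)) = complex_of_real (exp (- (u\<^sup>2 * v) / 2))"
        using chf[of "{}" u] by simp
      have c: "(\<integral>\<omega>. cos (u * U \<omega>) * indicator C \<omega> \<partial>M) = exp (- (u\<^sup>2 * v) / 2) * prob C"
      proof -
        have "(\<integral>\<omega>. (cos (u * U \<omega>) - exp (- (u\<^sup>2 * v) / 2)) * indicator C \<omega> \<partial>M)
          = (\<integral>\<omega>. cos (u * U \<omega>) * indicator C \<omega> \<partial>M) - exp (- (u\<^sup>2 * v) / 2) * prob C"
          using bdd[of "\<lambda>\<omega>. cos (u * U \<omega>)"] bdd[of "\<lambda>_. 1"] by (simp add: left_diff_distrib)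
        then show ?thesis using cosz by simp
      qed
      have "(CLINT \<omega>|M. complex_of_real (indicator C \<omega> - prob C) * iexp (u * U \<omega>))
        = (CLINT \<omega>|M. complex_of_real (cos (u * U \<omega>) * indicator C \<omega>) + \<i> * complex_of_real (sin (u * U \<omega>) * indicator C \<omega>)
            - prob C * iexp (u * U \<omega>))"
        by (rule Bochner_Integration.integral_cong) (auto simp: iee algebra_simps indicator_def simp del: of_real_mult)
      also have "\<dots> = complex_of_real (\<integral>\<omega>. cos (u * U \<omega>) * indicator C \<omega> \<partial>M)
          + \<i> * complex_of_real (\<integral>\<omega>. sin (u * U \<omega>) * indicator C \<omega> \<partial>M) - prob C * (CLINT \<omega>|M. iexp (u * U \<omega>))"
        using bdd[of "\<lambda>\<omega>. cos (u * U \<omega>)"] bdd[of "\<lambda>\<omega>. sin (u * U \<omega>)"] iexp_integrable[of "\<lambda>\<omega>. u * U \<omega>"]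
        by (simp add: integral_complex_of_real del: of_real_mult)
      also have "\<dots> = 0" unfolding chU c sinz by simp
      finally show "(CLINT \<omega>|M. complex_of_real (indicator C \<omega> - prob C) * iexp (u * U \<omega>)) = 0" .
    qed (use iU in auto)
    moreover have "integrable M (\<lambda>\<omega>. indicator C \<omega> * U \<omega>)"
      using integrable_mult_indicator[OF CM iU] by simp
    ultimately show "(\<integral>\<omega>. U \<omega> * indicator C \<omega> \<partial>M) = 0"
      using iU EU by (simp add: left_diff_distrib right_diff_distrib mult.commute)
  qed
  have stable: "Int_stable cyl"
  proof (rule Int_stableI)
    fix A B assume "A \<in> cyl" "B \<in> cyl"
    then obtain J E K F where J: "finite J" "J \<subseteq> S" "\<forall>X\<in>J. E X \<in> sets borel" "A = {\<omega> \<in> space M. \<forall>X\<in>J. X \<omega> \<in> E X}"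
      and K: "finite K" "K \<subseteq> S" "\<forall>X\<in>K. F X \<in> sets borel" "B = {\<omega> \<in> space M. \<forall>X\<in>K. X \<omega> \<in> F X}"
      unfolding cyl_def by blast
    show "A \<inter> B \<in> cyl"
      unfolding cyl_def
      by (intro CollectI exI[of _ "J \<union> K"] exI[of _ "\<lambda>X. (if X \<in> J then E X else UNIV) \<inter> (if X \<in> K then F X else UNIV)"])
        (use J K in auto)
  qed
  have cyl_Pow: "cyl \<subseteq> Pow (space M)" by (auto simp: cyl_def)
  have "A \<in> sigma_sets (space M) cyl"
    using A unfolding sets_gen_sigma
  proof (rule set_mp[OF sigma_sets_mono', rotated])
    show "{f -` A \<inter> space M |f A. f \<in> S \<and> A \<in> sets borel} \<subseteq> cyl"
    proof safe
      fix f and E :: "real set" assume "f \<in> S" "E \<in> sets borel"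
      then show "f -` E \<inter> space M \<in> cyl"
        unfolding cyl_def by (intro CollectI exI[of _ "{f}"] exI[of _ "\<lambda>_. E"]) auto
    qed
  qed
  from stable cyl_Pow this have "A \<in> sets M \<and> (\<integral>\<omega>. U \<omega> * indicator A \<omega> \<partial>M) = 0"
  proof (induction rule: sigma_sets_induct_disjoint)
    case (basic A) then show ?case by (rule cyl)
  next
    case empty then show ?case by simp
  next
    case (compl A)
    have "(\<integral>\<omega>. U \<omega> * indicator (space M - A) \<omega> \<partial>M) = (\<integral>\<omega>. U \<omega> - U \<omega> * indicator A \<omega> \<partial>M)"
      by (rule Bochner_Integration.integral_cong) (auto simp: indicator_def)
    also have "\<dots> = 0"
      using compl iU EU integrable_mult_indicator[of A M U] by (simp add: mult.commute)
    finally show ?case using compl by auto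
  next
    case (union A)
    have "(LINT \<omega>:(\<Union>i. A i)|M. U \<omega>) = (\<Sum>i. LINT \<omega>:A i|M. U \<omega>)"
    proof (rule lebesgue_integral_countable_add)
      show "set_integrable M (\<Union>i. A i) U"
        unfolding set_integrable_def using union iU by (intro integrable_mult_indicator) auto
    qed (use union in \<open>auto simp: disjoint_family_on_def\<close>)
    moreover have "(LINT \<omega>:A i|M. U \<omega>) = 0" for i
      using union by (simp add: set_lebesgue_integral_def mult.commute)
    ultimately have "(LINT \<omega>:(\<Union>i. A i)|M. U \<omega>) = 0" by simp
    then show ?case
      using union by (auto simp: set_lebesgue_integral_def mult.commute)
  qed
  then show ?thesis by simp
qed

end

text \<open>Rounding the time down to a multiple of 1/(n+1) leaves countably many times, where
  measurability in the second argument suffices; continuity of the paths gives the limit.\<close>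

lemma continuous_process_measurable:
  fixes f :: "real \<Rightarrow> 'a \<Rightarrow> real"
  assumes f[measurable]: "\<And>t. f t \<in> borel_measurable M" and cont: "\<And>\<omega>. \<omega> \<in> space M \<Longrightarrow> continuous_on UNIV (\<lambda>t. f t \<omega>)"
  shows "(\<lambda>(t, \<omega>). f t \<omega>) \<in> borel_measurable (borel \<Otimes>\<^sub>M M)"
proof (rule borel_measurable_LIMSEQ_real)
  fix n :: nat
  have "(\<lambda>x. f (real_of_int \<lfloor>real (Suc n) * fst x\<rfloor> / real (Suc n)) (snd x)) \<in> borel_measurable (borel \<Otimes>\<^sub>M M)"
  proof (rule measurable_compose_countable[where f="\<lambda>i x. f (real_of_int i / real (Suc n)) (snd x)"])
    show "(\<lambda>x. f (real_of_int i / real (Suc n)) (snd x)) \<in> borel_measurable (borel \<Otimes>\<^sub>M M)" for i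
      by measurable
    show "(\<lambda>x. \<lfloor>real (Suc n) * fst x\<rfloor>) \<in> (borel \<Otimes>\<^sub>M M) \<rightarrow>\<^sub>M count_space UNIV"
      by measurable
  qed
  then show "(\<lambda>x. f (real_of_int \<lfloor>real (Suc n) * fst x\<rfloor> / real (Suc n)) (snd x)) \<in> borel_measurable (borel \<Otimes>\<^sub>M M)" .
next
  fix x :: "real \<times> 'a" assume x: "x \<in> space (borel \<Otimes>\<^sub>M M)"
  have "(\<lambda>n. real_of_int \<lfloor>real (Suc n) * fst x\<rfloor> / real (Suc n)) \<longlonglongrightarrow> fst x"
  proof (rule tendsto_sandwich)
    show "\<forall>\<^sub>F n in sequentially. fst x - inverse (real (Suc n)) \<le> real_of_int \<lfloor>real (Suc n) * fst x\<rfloor> / real (Suc n)"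
    proof (rule always_eventually, rule allI)
      fix n :: nat
      have "real (Suc n) * fst x - 1 \<le> real_of_int \<lfloor>real (Suc n) * fst x\<rfloor>" by linarith
      moreover have "k > 0 \<Longrightarrow> k * y - 1 \<le> z \<Longrightarrow> y - inverse k \<le> z / k" for k y z :: real
        using divide_right_mono[of "k * y - 1" z k] by (simp add: diff_divide_distrib inverse_eq_divide)
      ultimately show "fst x - inverse (real (Suc n)) \<le> real_of_int \<lfloor>real (Suc n) * fst x\<rfloor> / real (Suc n)"
        by (metis of_nat_0_less_iff zero_less_Suc)
    qed
    show "\<forall>\<^sub>F n in sequentially. real_of_int \<lfloor>real (Suc n) * fst x\<rfloor> / real (Suc n) \<le> fst x"
    proof (rule always_eventually, rule allI)
      fix n :: nat
      have "real_of_int \<lfloor>real (Suc n) * fst x\<rfloor> \<le> real (Suc n) * fst x" by linarith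
      then show "real_of_int \<lfloor>real (Suc n) * fst x\<rfloor> / real (Suc n) \<le> fst x"
        by (simp add: field_simps)
    qed
    show "(\<lambda>n. fst x - inverse (real (Suc n))) \<longlonglongrightarrow> fst x"
      using tendsto_diff[OF tendsto_const LIMSEQ_inverse_real_of_nat, of "fst x"] by simp
  qed simp
  moreover have "isCont (\<lambda>t. f t (snd x)) (fst x)"
    using cont[of "snd x"] x by (auto simp: space_pair_measure continuous_on_eq_continuous_at)
  ultimately show "(\<lambda>n. f (real_of_int \<lfloor>real (Suc n) * fst x\<rfloor> / real (Suc n)) (snd x)) \<longlonglongrightarrow> (case x of (t, \<omega>) \<Rightarrow> f t \<omega>)"
    using isCont_tendsto_compose[of "fst x" "\<lambda>t. f t (snd x)"] by (auto simp: case_prod_beta)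
qed

section \<open>Growth of paths, averages of processes, exponential moments\<close>

text \<open>Chaining along the binary truncations \<open>d j\<close> of \<open>t\<close>: passing
  from level j to j+1 costs nothing or one dyadic step of length 2^-(j+1), and the factors
  \<open>r ^ j\<close> make these costs summable. The remaining walk from 0 to the integer part of
  \<open>t\<close> in unit steps costs the second factor 1 + t.\<close>

lemma dyadic_growth:
  fixes g :: "real \<Rightarrow> real"
  assumes cont: "continuous_on UNIV g" and g0: "g 0 = 0" and K: "K \<ge> 0" and r: "0 < r" "r < 1"
    and step: "\<And>j i::nat. \<bar>g (real (Suc i) / 2 ^ j) - g (real i / 2 ^ j)\<bar> \<le> K * (real (Suc i) / 2 ^ j + 1) * r ^ j"
    and t: "t \<ge> 0"
  shows "\<bar>g t\<bar> \<le> 2 * K / (1 - r) * (1 + t)\<^sup>2"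
proof -
  define n where "n j = nat \<lfloor>t * 2 ^ j\<rfloor>" for j
  define d where "d j = real (n j) / 2 ^ j" for j
  have nle: "real (n j) \<le> t * 2 ^ j" and nge: "t * 2 ^ j < real (n j) + 1" for j
    unfolding n_def using t by (simp_all add: of_nat_nat)
  have dle: "d j \<le> t" for j using nle[of j] by (simp add: d_def field_simps)
  have incr: "\<bar>g (d (Suc j)) - g (d j)\<bar> \<le> K * (t + 1) * r ^ Suc j" for j
  proof -
    have "n (Suc j) \<in> {2 * n j, Suc (2 * n j)}"
    proof -
      have "real (2 * n j) < real (n (Suc j)) + 1" using nle[of j] nge[of "Suc j"] by simp
      then have "2 * n j < n (Suc j) + 1" by (metis of_nat_1 of_nat_add of_nat_less_iff)
      moreover have "real (n (Suc j)) < real (2 * n j + 2)" using nge[of j] nle[of "Suc j"] by simp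
      then have "n (Suc j) < 2 * n j + 2" by (simp only: of_nat_less_iff)
      ultimately show ?thesis by auto
    qed
    moreover have "\<bar>g (d (Suc j)) - g (d j)\<bar> \<le> K * (t + 1) * r ^ Suc j" if e: "n (Suc j) = Suc (2 * n j)"
    proof -
      have dj: "d j = real (2 * n j) / 2 ^ Suc j" by (simp add: d_def)
      have dsj: "d (Suc j) = real (Suc (2 * n j)) / 2 ^ Suc j" by (simp add: d_def e)
      have "\<bar>g (d (Suc j)) - g (d j)\<bar> \<le> K * (d (Suc j) + 1) * r ^ Suc j"
        unfolding dj dsj by (rule step)
      also have "\<dots> \<le> K * (t + 1) * r ^ Suc j"
        using dle[of "Suc j"] K r by (intro mult_right_mono mult_left_mono) auto
      finally show ?thesis .
    qed
    moreover have "\<bar>g (d (Suc j)) - g (d j)\<bar> \<le> K * (t + 1) * r ^ Suc j" if e: "n (Suc j) = 2 * n j"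
    proof -
      have "d (Suc j) = d j" by (simp add: d_def e)
      then show ?thesis using K t r by simp
    qed
    ultimately show ?thesis by auto
  qed
  have tel: "\<bar>g (d j) - g (d 0)\<bar> \<le> K * (t + 1) * (\<Sum>i<j. r ^ Suc i)" for j
  proof (induction j)
    case (Suc j)
    have "\<bar>g (d (Suc j)) - g (d 0)\<bar> \<le> \<bar>g (d (Suc j)) - g (d j)\<bar> + \<bar>g (d j) - g (d 0)\<bar>" by simp
    also have "\<dots> \<le> K * (t + 1) * r ^ Suc j + K * (t + 1) * (\<Sum>i<j. r ^ Suc i)"
      by (intro add_mono incr Suc)
    finally show ?case by (simp add: algebra_simps)
  qed simp
  have geo: "(\<Sum>i<j. r ^ Suc i) \<le> 1 / (1 - r)" for j
  proof -
    have "(\<Sum>i<j. r ^ Suc i) \<le> (\<Sum>i<j. r ^ i)"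
      using r by (intro sum_mono) (simp add: mult_left_le_one_le)
    also have "\<dots> \<le> (\<Sum>i. r ^ i)"
      using r by (intro sum_le_suminf summable_geometric) auto
    also have "\<dots> = 1 / (1 - r)" using r by (simp add: suminf_geometric)
    finally show ?thesis .
  qed
  have base: "\<bar>g (real k)\<bar> \<le> real k * (K * (real k + 1))" for k
  proof -
    have "\<bar>g (real m)\<bar> \<le> real m * (K * (real k + 1))" if "m \<le> k" for m
      using that
    proof (induction m)
      case 0 then show ?case using g0 by simp
    next
      case (Suc m)
      have "\<bar>g (real (Suc m))\<bar> \<le> \<bar>g (real (Suc m)) - g (real m)\<bar> + \<bar>g (real m)\<bar>" by simp
      also have "\<bar>g (real (Suc m)) - g (real m)\<bar> \<le> K * (real (Suc m) + 1)"
        using step[of m 0] by simp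
      also have "\<dots> \<le> K * (real k + 1)" using Suc.prems K by (intro mult_left_mono) auto
      finally show ?case using Suc by (simp add: algebra_simps)
    qed
    then show ?thesis by simp
  qed
  have d0: "\<bar>g (d 0)\<bar> \<le> t * (K * (t + 1))"
  proof -
    have "\<bar>g (d 0)\<bar> \<le> d 0 * (K * (d 0 + 1))" using base[of "n 0"] by (simp add: d_def)
    also have "\<dots> \<le> t * (K * (t + 1))"
      using dle[of 0] K t by (intro mult_mono mult_left_mono) (auto simp: d_def)
    finally show ?thesis .
  qed
  have bound: "\<bar>g (d j)\<bar> \<le> K * (t + 1) * (1 / (1 - r)) + t * (K * (t + 1))" for j
  proof -
    have "K * (t + 1) * (\<Sum>i<j. r ^ Suc i) \<le> K * (t + 1) * (1 / (1 - r))"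
      using K t by (intro mult_left_mono geo) auto
    then show ?thesis using tel[of j] d0 by linarith
  qed
  have "d \<longlonglongrightarrow> t"
  proof (rule tendsto_sandwich)
    show "\<forall>\<^sub>F j in sequentially. t - (1/2) ^ j \<le> d j"
    proof (rule always_eventually, rule allI)
      fix j
      have "t \<le> (real (n j) + 1) / 2 ^ j" using nge[of j] by (simp add: field_simps less_imp_le)
      then show "t - (1/2) ^ j \<le> d j" by (simp add: d_def add_divide_distrib power_one_over)
    qed
    show "(\<lambda>j. t - (1/2) ^ j) \<longlonglongrightarrow> t"
      using tendsto_diff[OF tendsto_const LIMSEQ_realpow_zero[of "1/2::real"], of t] by simp
  qed (use dle in auto)
  moreover have "isCont g t" using cont by (simp add: continuous_on_eq_continuous_at)
  ultimately have "(\<lambda>j. g (d j)) \<longlonglongrightarrow> g t" by (rule isCont_tendsto_compose[rotated])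
  then have "(\<lambda>j. \<bar>g (d j)\<bar>) \<longlonglongrightarrow> \<bar>g t\<bar>" by (rule tendsto_rabs)
  then have "\<bar>g t\<bar> \<le> K * (t + 1) * (1 / (1 - r)) + t * (K * (t + 1))"
    by (rule LIMSEQ_le_const2) (use bound in auto)
  also have "\<dots> \<le> 2 * K / (1 - r) * (1 + t)\<^sup>2"
  proof -
    have q: "1 / (1 - r) \<ge> 1" using r by simp
    have "K * (t + 1) \<le> K * (t + 1)\<^sup>2"
      using K t by (intro mult_left_mono) (auto simp: power2_eq_square algebra_simps)
    then have "K * (t + 1) * (1 / (1 - r)) \<le> K * (t + 1)\<^sup>2 * (1 / (1 - r))"
      using r by (intro mult_right_mono) auto
    moreover have "t * (K * (t + 1)) \<le> K * (t + 1)\<^sup>2 * 1"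
      using K t by (simp add: power2_eq_square algebra_simps)
    moreover have "K * (t + 1)\<^sup>2 * 1 \<le> K * (t + 1)\<^sup>2 * (1 / (1 - r))"
      using K q by (intro mult_left_mono) auto
    ultimately have "K * (t + 1) * (1 / (1 - r)) + t * (K * (t + 1)) \<le> 2 * (K * (t + 1)\<^sup>2 * (1 / (1 - r)))" by linarith
    then show ?thesis by (simp add: algebra_simps)
  qed
  finally show ?thesis .
qed

context prob_space
begin

text \<open>The weights \<open>8 ^ j / (i + 1)\<^sup>2\<close> keep the expectation of the dyadic sum of the
  \<open>2q\<close>-th powers of increments finite, since these have expectation at most \<open>c / 16 ^ j\<close>
  once \<open>2 * q * H \<ge> 4\<close>; finiteness of the sum bounds every single increment.\<close>

lemma fBm_polynomial_growth:
  assumes B: "fBm M H B" and H: "H > 0"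
    and gauss: "\<And>s t. \<exists>\<sigma>. centered_gaussian M \<sigma> (\<lambda>\<omega>. B t \<omega> - B s \<omega>)"
  shows "AE \<omega> in M. \<exists>C. \<forall>t\<ge>0. \<bar>B (- t) \<omega>\<bar> \<le> C * (1 + t)\<^sup>2"
proof -
  obtain q :: nat where "2 / H < real q" using reals_Archimedean2 by blast
  then have qH: "2 * real q * H \<ge> 4" and "q \<noteq> 0"
    using H by (auto simp: field_simps intro!: Nat.gr0I)
  define c :: real where "c = fact (2 * q) / (2 ^ q * fact q)"
  have "c > 0" by (simp add: c_def)
  define D where "D j i \<omega> = B (- (real (Suc i) / 2 ^ j)) \<omega> - B (- (real i / 2 ^ j)) \<omega>" for j i \<omega>
  have [measurable]: "B t \<in> borel_measurable M" for t using B by (simp add: fBm_def)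
  have [measurable]: "D j i \<in> borel_measurable M" for j i unfolding D_def by measurable
  have ED: "integrable M (\<lambda>\<omega>. D j i \<omega> ^ (2 * q))" "(\<integral>\<omega>. D j i \<omega> ^ (2 * q) \<partial>M) \<le> c / 16 ^ j" for j i
  proof -
    obtain \<sigma> where \<sigma>: "centered_gaussian M \<sigma> (D j i)"
      using gauss[of "- (real (Suc i) / 2 ^ j)" "- (real i / 2 ^ j)"] unfolding D_def by blast
    show "integrable M (\<lambda>\<omega>. D j i \<omega> ^ (2 * q))" by (rule centered_gaussian_power_integrable[OF \<sigma>])
    have "\<bar>- (real (Suc i) / 2 ^ j) + real i / 2 ^ j\<bar> = 1 / 2 ^ j"
      by (simp add: add_divide_distrib)
    then have "\<sigma>\<^sup>2 = (1 / 2 ^ j) powr (2 * H)"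
      using centered_gaussian_variance[OF \<sigma>] B by (simp add: D_def fBm_def)
    then have "\<sigma> ^ (2 * q) = ((1 / 2 ^ j) powr (2 * H)) ^ q" by (simp add: power_mult)
    also have "\<dots> = (1 / 2 ^ j) powr (2 * real q * H)" by (simp add: powr_powr powr_realpow[symmetric] algebra_simps)
    also have "\<dots> \<le> (1 / 2 ^ j) powr 4" using qH by (intro powr_mono') auto
    also have "\<dots> = (1 / 2 ^ j) ^ 4" using powr_realpow[of "1 / 2 ^ j" 4] by simp
    also have "\<dots> = 1 / 16 ^ j" by (simp add: power_divide power_mult[symmetric] mult.commute[of j] power_mult)
    finally have "\<sigma> ^ (2 * q) * c \<le> 1 / 16 ^ j * c" using \<open>c > 0\<close> by (intro mult_right_mono) auto
    then show "(\<integral>\<omega>. D j i \<omega> ^ (2 * q) \<partial>M) \<le> c / 16 ^ j"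
      unfolding centered_gaussian_power_even[OF \<sigma>] c_def by (simp add: mult.commute)
  qed
  define S where "S \<omega> = (\<Sum>j. \<Sum>i. ennreal (D j i \<omega> ^ (2 * q) * (8 ^ j / real (Suc i) ^ 2)))" for \<omega>
  have sq: "summable (\<lambda>i. 1 / real (Suc i) ^ 2)"
    using inverse_power_summable[of 2, where 'a=real] summable_Suc_iff[of "\<lambda>i. inverse (real i ^ 2)"]
    by (simp add: inverse_eq_divide)
  define s where "s = (\<Sum>i. 1 / real (Suc i) ^ 2)"
  have "s \<ge> 0" unfolding s_def by (intro suminf_nonneg sq) auto
  have "(\<integral>\<^sup>+\<omega>. S \<omega> \<partial>M) = (\<Sum>j. \<Sum>i. \<integral>\<^sup>+\<omega>. ennreal (D j i \<omega> ^ (2 * q) * (8 ^ j / real (Suc i) ^ 2)) \<partial>M)"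
    unfolding S_def by (simp add: nn_integral_suminf)
  also have "\<dots> \<le> (\<Sum>j. \<Sum>i. ennreal (c * (1/2) ^ j * (1 / real (Suc i) ^ 2)))"
  proof (intro suminf_le summableI)
    fix j i
    have "(\<integral>\<^sup>+\<omega>. ennreal (D j i \<omega> ^ (2 * q) * (8 ^ j / real (Suc i) ^ 2)) \<partial>M)
        = ennreal ((\<integral>\<omega>. D j i \<omega> ^ (2 * q) \<partial>M) * (8 ^ j / real (Suc i) ^ 2))"
      using ED(1)[of j i] by (subst nn_integral_eq_integral) (auto simp: power_mult simp del: of_nat_Suc)
    also have "\<dots> \<le> ennreal (c / 16 ^ j * (8 ^ j / real (Suc i) ^ 2))"
      by (intro ennreal_leI mult_right_mono ED) auto
    also have "c / 16 ^ j * (8 ^ j / real (Suc i) ^ 2) = c * (1/2) ^ j * (1 / real (Suc i) ^ 2)"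
    proof -
      have "(16::real) ^ j = 2 ^ j * 8 ^ j" by (simp add: power_mult_distrib[symmetric])
      then show ?thesis by (simp add: power_one_over)
    qed
    finally show "(\<integral>\<^sup>+\<omega>. ennreal (D j i \<omega> ^ (2 * q) * (8 ^ j / real (Suc i) ^ 2)) \<partial>M)
        \<le> ennreal (c * (1/2) ^ j * (1 / real (Suc i) ^ 2))" .
  qed
  also have "\<dots> = (\<Sum>j. ennreal (c * (1/2) ^ j * s))"
  proof (intro suminf_cong)
    fix j
    show "(\<Sum>i. ennreal (c * (1/2) ^ j * (1 / real (Suc i) ^ 2))) = ennreal (c * (1/2) ^ j * s)"
      using \<open>c > 0\<close> suminf_mult[OF sq, of "c * (1/2) ^ j"] summable_mult[OF sq, of "c * (1/2) ^ j"] unfolding s_def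
      by (subst suminf_ennreal2) (auto simp del: of_nat_Suc)
  qed
  also have "\<dots> = ennreal (\<Sum>j. c * (1/2) ^ j * s)"
    using \<open>c > 0\<close> \<open>s \<ge> 0\<close> by (intro suminf_ennreal2 summable_mult2 summable_mult summable_geometric) auto
  finally have fin: "(\<integral>\<^sup>+\<omega>. S \<omega> \<partial>M) \<noteq> \<infinity>" by (auto simp: top_unique)
  have [measurable]: "S \<in> borel_measurable M" unfolding S_def by measurable
  have "AE \<omega> in M. S \<omega> \<noteq> \<infinity>" by (rule nn_integral_noteq_infinite[OF _ fin]) measurable
  then have "AE \<omega> in M. S \<omega> \<noteq> \<infinity> \<and> \<omega> \<in> space M" using AE_space by eventually_elim simp
  moreover have "\<exists>C. \<forall>t\<ge>0. \<bar>B (- t) \<omega>\<bar> \<le> C * (1 + t)\<^sup>2" if fin: "S \<omega> \<noteq> \<infinity>" and \<omega>: "\<omega> \<in> space M" for \<omega>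
  proof -
    obtain x where x: "x \<ge> 0" "S \<omega> = ennreal x" using fin by (cases "S \<omega>") auto
    \<comment> \<open>With \<open>x\<close> the finite value of the sum and y = (i+1)/2^j, each
      single term gives \<open>D j i \<omega> ^ (2 * q)\<close> <= x y^2 2^-j. Bounding y^2 by
      (y+1)^(2q) makes the right-hand side a perfect 2q-th power, whose root has the two factors
      \<open>K\<close> and \<open>r ^ j\<close>.\<close>
    define K where "K = root (2 * q) x"
    define r :: real where "r = root (2 * q) (1/2)"
    have K: "K \<ge> 0" "K ^ (2 * q) = x" using x \<open>q \<noteq> 0\<close> by (auto simp: K_def)
    have r: "r > 0" "r ^ (2 * q) = 1/2" "r < 1" using \<open>q \<noteq> 0\<close> by (auto simp: r_def)
    have step: "\<bar>D j i \<omega>\<bar> \<le> K * (real (Suc i) / 2 ^ j + 1) * r ^ j" for j i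
    proof -
      let ?y = "real (Suc i) / 2 ^ j"
      have "ennreal (D j i \<omega> ^ (2 * q) * (8 ^ j / real (Suc i) ^ 2)) \<le> S \<omega>"
      proof -
        have le: "f k \<le> (\<Sum>k. f k)" for f :: "nat \<Rightarrow> ennreal" and k
          using sum_le_suminf[OF summableI, of "{k}" f] by simp
        show ?thesis
          unfolding S_def
          by (rule order_trans[OF le[of "\<lambda>i. ennreal (D j i \<omega> ^ (2 * q) * (8 ^ j / real (Suc i) ^ 2))"]
              le[of "\<lambda>j. \<Sum>i. ennreal (D j i \<omega> ^ (2 * q) * (8 ^ j / real (Suc i) ^ 2))"]])
      qed
      then have "D j i \<omega> ^ (2 * q) * (8 ^ j / real (Suc i) ^ 2) \<le> x" using x by simp
      then have "D j i \<omega> ^ (2 * q) \<le> x * (real (Suc i) ^ 2 / 8 ^ j)" by (simp add: field_simps)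
      also have "real (Suc i) ^ 2 / 8 ^ j = ?y ^ 2 * (1/2) ^ j"
      proof -
        have "(8::real) ^ j = (2 ^ j) ^ 2 * 2 ^ j" by (simp add: power_mult[symmetric] mult.commute[of j] power_mult power_mult_distrib[symmetric])
        then show ?thesis by (simp add: power_one_over power_divide)
      qed
      also have "x * (?y ^ 2 * (1/2) ^ j) \<le> x * ((?y + 1) ^ (2 * q) * (1/2) ^ j)"
      proof (intro mult_left_mono mult_right_mono)
        have "?y ^ 2 \<le> (?y + 1) ^ 2" by (intro power_mono) auto
        also have "\<dots> \<le> (?y + 1) ^ (2 * q)" using \<open>q \<noteq> 0\<close> by (intro power_increasing) auto
        finally show "?y ^ 2 \<le> (?y + 1) ^ (2 * q)" .
      qed (use x in auto)
      also have "\<dots> = (K * (?y + 1) * r ^ j) ^ (2 * q)"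
        unfolding power_mult_distrib K(2) r(2)[symmetric] power_mult[symmetric] by (simp add: mult.commute)
      finally have "\<bar>D j i \<omega>\<bar> ^ (2 * q) \<le> (K * (?y + 1) * r ^ j) ^ (2 * q)" by (simp add: power_even_abs)
      then show ?thesis
        by (subst (asm) power_mono_iff) (use K r \<open>q \<noteq> 0\<close> in auto)
    qed
    have "\<bar>B (- t) \<omega>\<bar> \<le> 2 * K / (1 - r) * (1 + t)\<^sup>2" if "t \<ge> 0" for t
    proof (rule dyadic_growth[where g="\<lambda>t. B (- t) \<omega>"])
      have "continuous_on UNIV (\<lambda>t. B t \<omega>)" using B \<omega> by (simp add: fBm_def)
      then have "continuous_on UNIV ((\<lambda>t. B t \<omega>) \<circ> uminus)"
        by (intro continuous_on_compose continuous_on_minus continuous_on_id) (auto intro: continuous_on_subset)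
      then show "continuous_on UNIV (\<lambda>t. B (- t) \<omega>)" by (simp add: comp_def)
      show "B (- 0) \<omega> = 0" using B \<omega> by (simp add: fBm_def)
    qed (use K r that step in \<open>auto simp: D_def\<close>)
    then show ?thesis by blast
  qed
  ultimately show ?thesis by (elim eventually_mono) auto
qed

end

text \<open>Integrate \<open>2 (\<integral> f)\<^sup>2 = 2 \<integral> f\<^sup>2 - \<integral>\<integral> (f r - f p)\<^sup>2\<close> over \<open>\<omega>\<close>: for a Gaussian process only the
  variances of increments enter, and Tonelli suffices.\<close>

lemma
  fixes f :: "'b \<Rightarrow> 'a \<Rightarrow> real"
  assumes M: "prob_space M" and N: "prob_space N"
    and f: "(\<lambda>(r, \<omega>). f r \<omega>) \<in> borel_measurable (N \<Otimes>\<^sub>M M)"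
    and fin: "(\<integral>\<^sup>+r. \<integral>\<^sup>+\<omega>. ennreal ((f r \<omega>)\<^sup>2) \<partial>M \<partial>N) < \<infinity>"
  shows average_AE_integrable: "AE \<omega> in M. integrable N (\<lambda>r. f r \<omega>)"
    and average_second_moment: "2 * (\<integral>\<^sup>+\<omega>. ennreal ((\<integral>r. f r \<omega> \<partial>N)\<^sup>2) \<partial>M)
      + (\<integral>\<^sup>+r. \<integral>\<^sup>+p. \<integral>\<^sup>+\<omega>. ennreal ((f r \<omega> - f p \<omega>)\<^sup>2) \<partial>M \<partial>N \<partial>N)
      = 2 * (\<integral>\<^sup>+r. \<integral>\<^sup>+\<omega>. ennreal ((f r \<omega>)\<^sup>2) \<partial>M \<partial>N)"
proof -
  interpret M: prob_space M by fact
  interpret N: prob_space N by fact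
  interpret NM: pair_sigma_finite N M ..
  have fm[measurable (raw)]: "(\<lambda>x. f (g x) (h x)) \<in> borel_measurable L" if "g \<in> L \<rightarrow>\<^sub>M N" "h \<in> L \<rightarrow>\<^sub>M M" for g h L
    using measurable_compose[OF measurable_Pair[OF that] f] by simp
  have swap1: "(\<integral>\<^sup>+\<omega>. \<integral>\<^sup>+r. ennreal ((f r \<omega>)\<^sup>2) \<partial>N \<partial>M) = (\<integral>\<^sup>+r. \<integral>\<^sup>+\<omega>. ennreal ((f r \<omega>)\<^sup>2) \<partial>M \<partial>N)"
    by (rule NM.Fubini') measurable
  have "AE \<omega> in M. (\<integral>\<^sup>+r. ennreal ((f r \<omega>)\<^sup>2) \<partial>N) \<noteq> \<infinity>"
    by (rule nn_integral_noteq_infinite) (use fin swap1 in auto)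
  then have sq: "AE \<omega> in M. \<omega> \<in> space M \<and> integrable N (\<lambda>r. (f r \<omega>)\<^sup>2)"
    using AE_space by eventually_elim (auto intro!: integrableI_bounded simp: less_top)
  then show int: "AE \<omega> in M. integrable N (\<lambda>r. f r \<omega>)"
    by eventually_elim (auto intro!: N.integrable_of_square)
  \<comment> \<open>The identity is kept in additive form, because subtraction of extended
    nonnegative reals truncates.\<close>
  have id: "AE \<omega> in M. 2 * ennreal ((\<integral>r. f r \<omega> \<partial>N)\<^sup>2) + (\<integral>\<^sup>+r. \<integral>\<^sup>+p. ennreal ((f r \<omega> - f p \<omega>)\<^sup>2) \<partial>N \<partial>N)
      = 2 * (\<integral>\<^sup>+r. ennreal ((f r \<omega>)\<^sup>2) \<partial>N)"
    using sq int
  proof eventually_elim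
    case (elim \<omega>)
    then have i1: "integrable N (\<lambda>r. f r \<omega>)" and i2: "integrable N (\<lambda>r. (f r \<omega>)\<^sup>2)" by auto
    define I where "I = (\<integral>r. f r \<omega> \<partial>N)"
    define Q where "Q = (\<integral>r. (f r \<omega>)\<^sup>2 \<partial>N)"
    have i3: "integrable N (\<lambda>p. (c - f p \<omega>)\<^sup>2)" for c
      using i1 i2 by (simp add: power2_diff)
    have inner': "(\<integral>p. (c - f p \<omega>)\<^sup>2 \<partial>N) = c\<^sup>2 - 2 * c * I + Q" for c
      using i1 i2 by (simp add: power2_diff I_def Q_def N.prob_space)
    have inner: "(\<integral>\<^sup>+p. ennreal ((c - f p \<omega>)\<^sup>2) \<partial>N) = ennreal (c\<^sup>2 - 2 * c * I + Q)" for c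
      unfolding inner'[symmetric] by (rule nn_integral_eq_integral[OF i3]) auto
    have nonneg: "0 \<le> c\<^sup>2 - 2 * c * I + Q" for c
      unfolding inner'[symmetric] by simp
    have i4: "integrable N (\<lambda>r. (f r \<omega>)\<^sup>2 - 2 * f r \<omega> * I + Q)" using i1 i2 by auto
    have "(\<integral>\<^sup>+r. \<integral>\<^sup>+p. ennreal ((f r \<omega> - f p \<omega>)\<^sup>2) \<partial>N \<partial>N) = ennreal (2 * Q - 2 * I\<^sup>2)"
    proof -
      have "(\<integral>r. (f r \<omega>)\<^sup>2 - 2 * f r \<omega> * I + Q \<partial>N) = 2 * Q - 2 * I\<^sup>2"
        using i1 i2 by (simp add: I_def[symmetric] Q_def[symmetric] N.prob_space) (simp add: power2_eq_square)
      then show ?thesis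
        unfolding inner using nonneg nn_integral_eq_integral[OF i4] by simp
    qed
    moreover have "(\<integral>\<^sup>+r. ennreal ((f r \<omega>)\<^sup>2) \<partial>N) = ennreal Q"
      unfolding Q_def by (rule nn_integral_eq_integral[OF i2]) auto
    moreover have "2 * Q - 2 * I\<^sup>2 \<ge> 0" using nonneg[of I] by (simp add: power2_eq_square)
    moreover have "Q \<ge> 0" by (simp add: Q_def)
    ultimately show ?case
      unfolding I_def[symmetric] numeral_2_eq_2
      by (simp add: ennreal_mult'[symmetric] ennreal_plus[symmetric] ennreal_numeral[symmetric] del: ennreal_plus ennreal_numeral flip: numeral_2_eq_2)
  qed
  have swap2: "(\<integral>\<^sup>+\<omega>. \<integral>\<^sup>+r. \<integral>\<^sup>+p. ennreal ((f r \<omega> - f p \<omega>)\<^sup>2) \<partial>N \<partial>N \<partial>M)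
      = (\<integral>\<^sup>+r. \<integral>\<^sup>+p. \<integral>\<^sup>+\<omega>. ennreal ((f r \<omega> - f p \<omega>)\<^sup>2) \<partial>M \<partial>N \<partial>N)"
  proof -
    have "(\<integral>\<^sup>+\<omega>. \<integral>\<^sup>+r. \<integral>\<^sup>+p. ennreal ((f r \<omega> - f p \<omega>)\<^sup>2) \<partial>N \<partial>N \<partial>M)
        = (\<integral>\<^sup>+r. \<integral>\<^sup>+\<omega>. \<integral>\<^sup>+p. ennreal ((f r \<omega> - f p \<omega>)\<^sup>2) \<partial>N \<partial>M \<partial>N)"
      by (rule NM.Fubini') measurable
    also have "\<dots> = (\<integral>\<^sup>+r. \<integral>\<^sup>+p. \<integral>\<^sup>+\<omega>. ennreal ((f r \<omega> - f p \<omega>)\<^sup>2) \<partial>M \<partial>N \<partial>N)"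
      by (intro nn_integral_cong NM.Fubini') measurable
    finally show ?thesis .
  qed
  have [measurable]: "(\<lambda>\<omega>. \<integral>r. f r \<omega> \<partial>N) \<in> borel_measurable M" by measurable
  have "2 * (\<integral>\<^sup>+\<omega>. ennreal ((\<integral>r. f r \<omega> \<partial>N)\<^sup>2) \<partial>M)
      + (\<integral>\<^sup>+\<omega>. \<integral>\<^sup>+r. \<integral>\<^sup>+p. ennreal ((f r \<omega> - f p \<omega>)\<^sup>2) \<partial>N \<partial>N \<partial>M)
    = (\<integral>\<^sup>+\<omega>. 2 * ennreal ((\<integral>r. f r \<omega> \<partial>N)\<^sup>2) + (\<integral>\<^sup>+r. \<integral>\<^sup>+p. ennreal ((f r \<omega> - f p \<omega>)\<^sup>2) \<partial>N \<partial>N) \<partial>M)"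
    by (subst nn_integral_add) (auto simp: nn_integral_cmult)
  also have "\<dots> = (\<integral>\<^sup>+\<omega>. 2 * (\<integral>\<^sup>+r. ennreal ((f r \<omega>)\<^sup>2) \<partial>N) \<partial>M)"
    by (rule nn_integral_cong_AE[OF id])
  also have "\<dots> = 2 * (\<integral>\<^sup>+\<omega>. \<integral>\<^sup>+r. ennreal ((f r \<omega>)\<^sup>2) \<partial>N \<partial>M)"
    by (rule nn_integral_cmult) measurable
  finally show "2 * (\<integral>\<^sup>+\<omega>. ennreal ((\<integral>r. f r \<omega> \<partial>N)\<^sup>2) \<partial>M)
      + (\<integral>\<^sup>+r. \<integral>\<^sup>+p. \<integral>\<^sup>+\<omega>. ennreal ((f r \<omega> - f p \<omega>)\<^sup>2) \<partial>M \<partial>N \<partial>N)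
      = 2 * (\<integral>\<^sup>+r. \<integral>\<^sup>+\<omega>. ennreal ((f r \<omega>)\<^sup>2) \<partial>M \<partial>N)"
    unfolding swap1 swap2 .
qed

text \<open>The law of the age \<open>r\<close> in the representation of the stationary process:
  substituting s = t - r turns the kernel \<open>lam * exp (- lam * (t - s))\<close> on s <= t into
  this density.\<close>

abbreviation exp_law :: "real \<Rightarrow> real measure" where
  "exp_law lam \<equiv> density lborel (\<lambda>x. ennreal (exponential_density lam x))"

lemma exp_law_moment:
  assumes lam: "lam > 0" and a: "a > 0"
  shows "(\<integral>\<^sup>+r. ennreal (\<bar>r\<bar> powr a) \<partial>exp_law lam) = ennreal (Gamma (a + 1) / lam powr a)"
proof -
  have "(\<integral>\<^sup>+r. ennreal (\<bar>r\<bar> powr a) \<partial>exp_law lam)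
      = (\<integral>\<^sup>+r. ennreal (exponential_density lam r) * ennreal (\<bar>r\<bar> powr a) \<partial>lborel)"
    by (rule nn_integral_density) auto
  also have "\<dots> = ennreal \<bar>1 / lam\<bar> * (\<integral>\<^sup>+x. ennreal (exponential_density lam (0 + 1 / lam * x)) * ennreal (\<bar>0 + 1 / lam * x\<bar> powr a) \<partial>lborel)"
    using lam by (intro nn_integral_real_affine) auto
  also have "(\<integral>\<^sup>+x. ennreal (exponential_density lam (0 + 1 / lam * x)) * ennreal (\<bar>0 + 1 / lam * x\<bar> powr a) \<partial>lborel)
      = (\<integral>\<^sup>+x. ennreal (lam / lam powr a) * ennreal (indicator {0..} x * x powr (a + 1 - 1) / exp x) \<partial>lborel)"
  proof (rule nn_integral_cong)
    fix x :: real
    have "exponential_density lam (1 / lam * x) * (\<bar>1 / lam * x\<bar> powr a)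
        = lam / lam powr a * (indicator {0..} x * x powr (a + 1 - 1) / exp x)"
      using lam by (auto simp: exponential_density_def indicator_def powr_divide exp_minus field_simps)
    then show "ennreal (exponential_density lam (0 + 1 / lam * x)) * ennreal (\<bar>0 + 1 / lam * x\<bar> powr a)
        = ennreal (lam / lam powr a) * ennreal (indicator {0..} x * x powr (a + 1 - 1) / exp x)"
      using lam by (simp add: ennreal_mult'[symmetric] ennreal_mult''[symmetric])
  qed
  also have "\<dots> = ennreal (lam / lam powr a) * ennreal (Gamma (a + 1))"
    using a by (subst nn_integral_cmult) (auto simp: Gamma_conv_nn_integral_real)
  also have "ennreal \<bar>1 / lam\<bar> * (ennreal (lam / lam powr a) * ennreal (Gamma (a + 1))) = ennreal (Gamma (a + 1) / lam powr a)"
    using lam a by (simp add: ennreal_mult'[symmetric] Gamma_real_pos less_imp_le)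
  finally show ?thesis .
qed

text \<open>The value is the probability that one of two independent exponential variables exceeds
  the other. The product of the density with the exponential is half the density with doubled
  rate.\<close>

lemma exp_law_nn_integral_exp:
  assumes lam: "lam > 0"
  shows "(\<integral>\<^sup>+x. ennreal (exp (- lam * x)) \<partial>exp_law lam) = ennreal (1/2)"
proof -
  interpret prob_space "exp_law (2 * lam)" using lam by (intro prob_space_exponential_density) auto
  have "(\<integral>\<^sup>+x. ennreal (exp (- lam * x)) \<partial>exp_law lam)
      = (\<integral>\<^sup>+x. ennreal (exponential_density lam x) * ennreal (exp (- lam * x)) \<partial>lborel)"
    by (rule nn_integral_density) auto
  also have "\<dots> = (\<integral>\<^sup>+x. ennreal (1/2) * ennreal (exponential_density (2 * lam) x) \<partial>lborel)"
  proof (rule nn_integral_cong)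
    fix x :: real
    have "exponential_density lam x * exp (- lam * x) = 1/2 * exponential_density (2 * lam) x"
      by (auto simp: exponential_density_def exp_add[symmetric] mult.commute)
    then show "ennreal (exponential_density lam x) * ennreal (exp (- lam * x)) = ennreal (1/2) * ennreal (exponential_density (2 * lam) x)"
      using lam by (simp add: ennreal_mult'[symmetric] ennreal_mult''[symmetric] del: ennreal_half)
  qed
  also have "\<dots> = ennreal (1/2) * (\<integral>\<^sup>+x. ennreal (exponential_density (2 * lam) x) \<partial>lborel)"
    by (rule nn_integral_cmult) auto
  also have "(\<integral>\<^sup>+x. ennreal (exponential_density (2 * lam) x) \<partial>lborel) = 1"
    using emeasure_space_1 by (simp add: emeasure_density)
  finally show ?thesis by simp
qed

text \<open>Memorylessness: on \<open>p \<le> r\<close>, an event of probability 1/2, the excess of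
  \<open>r\<close> over \<open>p\<close> is again exponential. The other half is the same by
  symmetry, so |r - p| has the same moments as \<open>r\<close>.\<close>

lemma exp_law_abs_diff_moment:
  assumes lam: "lam > 0" and a: "a > 0"
  shows "(\<integral>\<^sup>+p. \<integral>\<^sup>+r. ennreal (\<bar>r - p\<bar> powr a) \<partial>exp_law lam \<partial>exp_law lam) = ennreal (Gamma (a + 1) / lam powr a)"
proof -
  let ?\<nu> = "exp_law lam"
  interpret \<nu>: prob_space ?\<nu> using lam by (intro prob_space_exponential_density)
  interpret pair_sigma_finite ?\<nu> ?\<nu> ..
  define m where "m = Gamma (a + 1) / lam powr a"
  have "m \<ge> 0" using a by (simp add: m_def Gamma_real_pos less_imp_le)
  let ?h = "\<lambda>p r::real. ennreal (if p \<le> r then \<bar>r - p\<bar> powr a else 0)"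
  have half: "(\<integral>\<^sup>+p. \<integral>\<^sup>+r. ?h p r \<partial>?\<nu> \<partial>?\<nu>) = ennreal (m / 2)"
  proof -
    have inner: "(\<integral>\<^sup>+r. ?h p r \<partial>?\<nu>) = ennreal (exp (- lam * p)) * ennreal m" if "p \<ge> 0" for p
    proof -
      have "(\<integral>\<^sup>+r. ?h p r \<partial>?\<nu>) = (\<integral>\<^sup>+r. ennreal (exponential_density lam r) * ?h p r \<partial>lborel)"
        by (rule nn_integral_density) auto
      also have "\<dots> = ennreal \<bar>1\<bar> * (\<integral>\<^sup>+x. ennreal (exponential_density lam (p + 1 * x)) * ?h p (p + 1 * x) \<partial>lborel)"
        by (rule nn_integral_real_affine) auto
      also have "\<dots> = (\<integral>\<^sup>+x. ennreal (exp (- lam * p)) * (ennreal (exponential_density lam x) * ennreal (\<bar>x\<bar> powr a)) \<partial>lborel)"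
      proof -
        have "ennreal (exponential_density lam (p + 1 * x)) * ?h p (p + 1 * x)
          = ennreal (exp (- lam * p)) * (ennreal (exponential_density lam x) * ennreal (\<bar>x\<bar> powr a))" for x
          using that lam by (auto simp: exponential_density_def exp_add[symmetric] ennreal_mult'[symmetric] ennreal_mult''[symmetric] algebra_simps)
        then show ?thesis by simp
      qed
      also have "\<dots> = ennreal (exp (- lam * p)) * (\<integral>\<^sup>+x. ennreal (exponential_density lam x) * ennreal (\<bar>x\<bar> powr a) \<partial>lborel)"
        by (rule nn_integral_cmult) auto
      also have "(\<integral>\<^sup>+x. ennreal (exponential_density lam x) * ennreal (\<bar>x\<bar> powr a) \<partial>lborel) = ennreal m"
        using exp_law_moment[OF assms] by (subst (asm) nn_integral_density) (auto simp: m_def)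
      finally show ?thesis .
    qed
    have "AE p in ?\<nu>. p \<ge> 0"
      by (subst AE_density) (auto simp: exponential_density_def intro!: AE_I2)
    then have "(\<integral>\<^sup>+p. \<integral>\<^sup>+r. ?h p r \<partial>?\<nu> \<partial>?\<nu>) = (\<integral>\<^sup>+p. ennreal (exp (- lam * p)) * ennreal m \<partial>?\<nu>)"
      by (intro nn_integral_cong_AE) (auto elim!: eventually_mono simp: inner)
    also have "\<dots> = ennreal (1/2) * ennreal m"
      using exp_law_nn_integral_exp[OF lam] by (subst nn_integral_multc) auto
    also have "\<dots> = ennreal (m / 2)" using \<open>m \<ge> 0\<close> by (subst ennreal_mult'[symmetric]) auto
    finally show ?thesis .
  qed
  have split: "ennreal (\<bar>r - p\<bar> powr a) = ?h p r + ?h r p" for p r :: real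
    by (auto simp: abs_minus_commute)
  have "(\<integral>\<^sup>+p. \<integral>\<^sup>+r. ennreal (\<bar>r - p\<bar> powr a) \<partial>?\<nu> \<partial>?\<nu>) = (\<integral>\<^sup>+p. \<integral>\<^sup>+r. ?h p r + ?h r p \<partial>?\<nu> \<partial>?\<nu>)"
    using split by simp
  also have "\<dots> = (\<integral>\<^sup>+p. \<integral>\<^sup>+r. ?h p r \<partial>?\<nu> \<partial>?\<nu>) + (\<integral>\<^sup>+p. \<integral>\<^sup>+r. ?h r p \<partial>?\<nu> \<partial>?\<nu>)"
    by (simp add: nn_integral_add)
  also have "(\<integral>\<^sup>+p. \<integral>\<^sup>+r. ?h r p \<partial>?\<nu> \<partial>?\<nu>) = (\<integral>\<^sup>+r. \<integral>\<^sup>+p. ?h r p \<partial>?\<nu> \<partial>?\<nu>)"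
    by (rule Fubini') measurable
  finally show ?thesis
    unfolding half using \<open>m \<ge> 0\<close> by (simp add: m_def ennreal_plus[symmetric] del: ennreal_plus)
qed

section \<open>The stationary fractional Ornstein--Uhlenbeck process\<close>

lemma ibp_exp_continuous_left:
  assumes g: "continuous_on UNIV g"
  shows "continuous_on {..0} (\<lambda>a. ibp_exp lam g a 0)"
proof -
  have cont: "continuous_on S g" for S
    using g continuous_on_subset by blast
  have "continuous_on {c<..0} (\<lambda>a. ibp_exp lam g a 0)" for c
  proof (rule continuous_on_subset)
    have "continuous_on {c..0} (\<lambda>a. integral {a..0} (\<lambda>r. exp (lam * r) * g r))"
      by (intro indefinite_integral_continuous_1' integrable_continuous_real continuous_intros cont)
    then show "continuous_on {c..0} (\<lambda>a. ibp_exp lam g a 0)"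
      unfolding ibp_exp_def by (intro continuous_intros cont)
  qed auto
  then have "\<And>x. x \<in> {..0} \<Longrightarrow> continuous (at x within {..0}) (\<lambda>a. ibp_exp lam g a 0)"
  proof -
    fix x :: real assume x: "x \<in> {..0}" and *: "\<And>c. continuous_on {c<..0} (\<lambda>a. ibp_exp lam g a 0)"
    have "continuous (at x within {x - 1<..0}) (\<lambda>a. ibp_exp lam g a 0)"
      using *[of "x - 1"] x by (simp add: continuous_on_eq_continuous_within)
    moreover have "at x within {x - 1<..0} = at x within {..0}"
      by (rule at_within_nhd[of _ "{x - 1<..}"]) (use x in auto)
    ultimately show "continuous (at x within {..0}) (\<lambda>a. ibp_exp lam g a 0)" by simp
  qed
  then show ?thesis by (simp add: continuous_on_eq_continuous_within)
qed

text \<open>Countably many conditions, so that convergence is a measurable event.\<close>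

lemma conv_bot_iff_rational_Cauchy:
  assumes g: "continuous_on UNIV g"
  shows "conv_bot lam g \<longleftrightarrow> (\<forall>k::nat. \<exists>N::nat. \<forall>a b::rat.
    \<bar>ibp_exp lam g (- real N - \<bar>of_rat a\<bar>) 0 - ibp_exp lam g (- real N - \<bar>of_rat b\<bar>) 0\<bar> \<le> 1 / real (Suc k))"
    (is "_ \<longleftrightarrow> ?R")
proof
  let ?J = "\<lambda>a. ibp_exp lam g a 0"
  assume "conv_bot lam g"
  then obtain l where l: "(?J \<longlongrightarrow> l) at_bot" by (auto simp: conv_bot_def)
  show ?R
  proof
    fix k :: nat
    have "\<forall>\<^sub>F a in at_bot. dist (?J a) l < 1 / (2 * real (Suc k))"
      using l by (rule tendstoD) simp
    then obtain x where x: "\<And>a. a \<le> x \<Longrightarrow> dist (?J a) l < 1 / (2 * real (Suc k))"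
      by (auto simp: eventually_at_bot_linorder)
    obtain N :: nat where N: "- x < real N" using reals_Archimedean2 by blast
    show "\<exists>N::nat. \<forall>a b::rat. \<bar>?J (- real N - \<bar>of_rat a\<bar>) - ?J (- real N - \<bar>of_rat b\<bar>)\<bar> \<le> 1 / real (Suc k)"
    proof (intro exI allI)
      fix a b :: rat
      have "dist (?J (- real N - \<bar>of_rat a\<bar>)) l < 1 / (2 * real (Suc k))"
        "dist (?J (- real N - \<bar>of_rat b\<bar>)) l < 1 / (2 * real (Suc k))"
        using N by (intro x; linarith)+
      moreover have "\<bar>x - l\<bar> < 1 / (2 * c) \<Longrightarrow> \<bar>y - l\<bar> < 1 / (2 * c) \<Longrightarrow> \<bar>x - y\<bar> \<le> 1 / c" for x y c :: real
        by (simp add: abs_less_iff abs_le_iff)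
      ultimately show "\<bar>?J (- real N - \<bar>of_rat a\<bar>) - ?J (- real N - \<bar>of_rat b\<bar>)\<bar> \<le> 1 / real (Suc k)"
        unfolding dist_real_def by blast
    qed
  qed
next
  let ?J = "\<lambda>a. ibp_exp lam g a 0"
  assume R: ?R
  \<comment> \<open>Writing points of the half line left of - N as - N - |x| with unrestricted x
    lets density of the rationals in the whole line be used, for one argument at a time.\<close>
  have cF: "continuous_on UNIV (\<lambda>x::real. ?J (- real N - \<bar>x\<bar>))" for N
    by (rule continuous_on_compose2[OF ibp_exp_continuous_left[OF g]]) (auto intro!: continuous_intros)
  have real_R: "\<exists>N::nat. \<forall>x y. x \<le> - real N \<longrightarrow> y \<le> - real N \<longrightarrow> \<bar>?J x - ?J y\<bar> \<le> 1 / real (Suc k)" for k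
  proof -
    from R obtain N where N: "\<And>a b::rat. \<bar>?J (- real N - \<bar>of_rat a\<bar>) - ?J (- real N - \<bar>of_rat b\<bar>)\<bar> \<le> 1 / real (Suc k)"
      by blast
    let ?F = "\<lambda>x. ?J (- real N - \<bar>x\<bar>)"
    have 1: "\<bar>?F x - ?F (of_rat b)\<bar> \<le> 1 / real (Suc k)" for x b
    proof (rule continuous_le_on_closure[where S="\<rat>" and x=x])
      show "continuous_on (closure \<rat>) (\<lambda>x. \<bar>?F x - ?F (of_rat b)\<bar>)"
        by (intro continuous_intros continuous_on_subset[OF cF]) auto
      show "\<And>y. y \<in> \<rat> \<Longrightarrow> \<bar>?F y - ?F (of_rat b)\<bar> \<le> 1 / real (Suc k)"
        using N by (auto elim!: Rats_cases)
    qed (simp add: Rats_closure_real)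
    have 2: "\<bar>?F x - ?F y\<bar> \<le> 1 / real (Suc k)" for x y
    proof (rule continuous_le_on_closure[where S="\<rat>" and x=y])
      show "continuous_on (closure \<rat>) (\<lambda>y. \<bar>?F x - ?F y\<bar>)"
        by (intro continuous_intros continuous_on_subset[OF cF]) auto
      show "\<And>y. y \<in> \<rat> \<Longrightarrow> \<bar>?F x - ?F y\<bar> \<le> 1 / real (Suc k)"
        using 1 by (auto elim!: Rats_cases)
    qed (simp add: Rats_closure_real)
    show ?thesis
    proof (intro exI allI impI)
      fix x y assume "x \<le> - real N" "y \<le> - real N"
      then have "- real N - \<bar>- x - real N\<bar> = x" "- real N - \<bar>- y - real N\<bar> = y" by auto
      then show "\<bar>?J x - ?J y\<bar> \<le> 1 / real (Suc k)" using 2[of "- x - real N" "- y - real N"] by simp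
    qed
  qed
  have "Cauchy (\<lambda>n. ?J (- real n))"
  proof (rule metric_CauchyI)
    fix e :: real assume "e > 0"
    then obtain k where k: "1 / real (Suc k) < e" using nat_approx_posE by blast
    obtain N where N: "\<And>x y. x \<le> - real N \<Longrightarrow> y \<le> - real N \<Longrightarrow> \<bar>?J x - ?J y\<bar> \<le> 1 / real (Suc k)"
      using real_R by blast
    show "\<exists>M. \<forall>m\<ge>M. \<forall>n\<ge>M. dist (?J (- real m)) (?J (- real n)) < e"
    proof (intro exI[of _ N] allI impI)
      fix m n assume "N \<le> m" "N \<le> n"
      then have "\<bar>?J (- real m) - ?J (- real n)\<bar> \<le> 1 / real (Suc k)" by (intro N) auto
      then show "dist (?J (- real m)) (?J (- real n)) < e" using k by (simp add: dist_real_def)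
    qed
  qed
  then obtain l where l: "(\<lambda>n. ?J (- real n)) \<longlonglongrightarrow> l" by (auto simp: Cauchy_convergent_iff convergent_def)
  have "(?J \<longlongrightarrow> l) at_bot"
  proof (rule tendstoI)
    fix e :: real assume "e > 0"
    then obtain k where k: "1 / real (Suc k) < e" using nat_approx_posE by blast
    obtain N where N: "\<And>x y. x \<le> - real N \<Longrightarrow> y \<le> - real N \<Longrightarrow> \<bar>?J x - ?J y\<bar> \<le> 1 / real (Suc k)"
      using real_R by blast
    have "\<bar>?J x - l\<bar> \<le> 1 / real (Suc k)" if "x \<le> - real N" for x
    proof (rule LIMSEQ_le_const2)
      show "(\<lambda>n. \<bar>?J x - ?J (- real n)\<bar>) \<longlonglongrightarrow> \<bar>?J x - l\<bar>" by (intro tendsto_intros l)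
      show "\<exists>N. \<forall>n\<ge>N. \<bar>?J x - ?J (- real n)\<bar> \<le> 1 / real (Suc k)"
        using N that by (intro exI[of _ N]) auto
    qed
    then have "\<forall>x\<le>- real N. dist (?J x) l < e"
      using k unfolding dist_real_def by (metis le_less_trans)
    then show "\<forall>\<^sub>F x in at_bot. dist (?J x) l < e"
      unfolding eventually_at_bot_linorder by blast
  qed
  then show "conv_bot lam g" by (auto simp: conv_bot_def)
qed

text \<open>Reflecting s = t - r turns the mean of \<open>g (t - r)\<close> under the exponential
  law into the integral left over by integration by parts. The boundary term at the lower limit dies
  by \<open>decay\<close>, and the constant \<open>g t\<close> goes inside the mean because the law
  has mass 1.\<close>

lemma ibp_exp_tendsto:
  assumes g: "continuous_on UNIV g" and lam: "lam > 0"
    and decay: "((\<lambda>a. exp (lam * a) * g a) \<longlongrightarrow> 0) at_bot"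
    and int: "integrable (exp_law lam) (\<lambda>r. g t - g (t - r))"
  shows "((\<lambda>a. ibp_exp lam g a t) \<longlongrightarrow> exp (lam * t) * (\<integral>r. g t - g (t - r) \<partial>exp_law lam)) at_bot"
proof -
  interpret \<nu>: prob_space "exp_law lam" using lam by (intro prob_space_exponential_density)
  have cont: "continuous_on S g" for S
    using g continuous_on_subset by blast
  have [measurable]: "g \<in> borel_measurable borel" using g by (rule borel_measurable_continuous_onI)
  let ?h = "\<lambda>s. lam * (exp (lam * s) * g s)"
  have i1: "integrable (exp_law lam) (\<lambda>r. g (t - r))"
  proof -
    have "integrable (exp_law lam) (\<lambda>r. g t - (g t - g (t - r)))"
      by (intro Bochner_Integration.integrable_diff int) auto
    then show ?thesis by simp
  qed
  have pw: "exponential_density lam r * g (t - r) = exp (- lam * t) * (indicator {..t} (t + (-1) * r) * ?h (t + (-1) * r))" for r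
    by (auto simp: exponential_density_def indicator_def exp_diff exp_minus exp_add field_simps)
  have i2: "integrable lborel (\<lambda>r. exponential_density lam r * g (t - r))"
    using i1 lam by (subst (asm) integrable_density) auto
  then have "integrable lborel (\<lambda>r. exp (lam * t) * (exponential_density lam r * g (t - r)))" by simp
  then have "integrable lborel (\<lambda>r. indicator {..t} (t + (-1) * r) * ?h (t + (-1) * r))"
    unfolding pw by (simp add: exp_minus)
  then have si: "set_integrable lborel {..t} ?h"
    unfolding set_integrable_def
    using lborel_integrable_real_affine_iff[of "-1" "\<lambda>s. indicator {..t} s *\<^sub>R ?h s" t] by simp
  have "(LINT s:{..t}|lborel. ?h s) = (\<integral>r. indicator {..t} (t + (-1) * r) * ?h (t + (-1) * r) \<partial>lborel)"
    unfolding set_lebesgue_integral_def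
    by (subst lborel_integral_real_affine[where c="-1" and t=t]) auto
  also have "\<dots> = exp (lam * t) * (\<integral>r. exponential_density lam r * g (t - r) \<partial>lborel)"
    unfolding pw by (simp add: exp_minus)
  also have "(\<integral>r. exponential_density lam r * g (t - r) \<partial>lborel) = (\<integral>r. g (t - r) \<partial>exp_law lam)"
    using lam by (subst integral_density) auto
  finally have val: "(LINT s:{..t}|lborel. ?h s) = exp (lam * t) * (\<integral>r. g (t - r) \<partial>exp_law lam)" .
  have "((\<lambda>a. LINT s:{a..t}|lborel. ?h s) \<longlongrightarrow> (LINT s:{..t}|lborel. ?h s)) at_bot"
    by (rule tendsto_set_lebesgue_integral_at_bot[OF _ si]) auto
  moreover have "(\<lambda>a. LINT s:{a..t}|lborel. ?h s) = (\<lambda>a. lam * integral {a..t} (\<lambda>r. exp (lam * r) * g r))"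
    by (rule ext, subst set_borel_integral_eq_integral) (auto intro!: borel_integrable_atLeastAtMost' continuous_intros cont)
  ultimately have "((\<lambda>a. lam * integral {a..t} (\<lambda>r. exp (lam * r) * g r)) \<longlongrightarrow> exp (lam * t) * (\<integral>r. g (t - r) \<partial>exp_law lam)) at_bot"
    unfolding val by (elim subst)
  then have "((\<lambda>a. ibp_exp lam g a t) \<longlongrightarrow> exp (lam * t) * g t - 0 - exp (lam * t) * (\<integral>r. g (t - r) \<partial>exp_law lam)) at_bot"
    unfolding ibp_exp_def by (intro tendsto_diff[OF tendsto_diff[OF tendsto_const decay]])
  moreover have "(\<integral>r. g t - g (t - r) \<partial>exp_law lam) = g t - (\<integral>r. g (t - r) \<partial>exp_law lam)"
    using i1 \<nu>.prob_space by (subst Bochner_Integration.integral_diff) auto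
  ultimately show ?thesis by (simp add: right_diff_distrib)
qed

lemma decay_of_polynomial_growth:
  fixes g :: "real \<Rightarrow> real"
  assumes lam: "lam > 0" and growth: "\<And>t. t \<ge> 0 \<Longrightarrow> \<bar>g (- t)\<bar> \<le> C * (1 + t)\<^sup>2"
  shows "((\<lambda>a. exp (lam * a) * g a) \<longlongrightarrow> 0) at_bot"
proof (rule Lim_null_comparison)
  show "((\<lambda>a. C * (exp (lam * a) * (1 - a)\<^sup>2)) \<longlongrightarrow> 0) at_bot"
    using lam by real_asymp
  show "\<forall>\<^sub>F a in at_bot. norm (exp (lam * a) * g a) \<le> C * (exp (lam * a) * (1 - a)\<^sup>2)"
    using eventually_le_at_bot[of 0]
  proof eventually_elim
    case (elim a)
    have "exp (lam * a) * \<bar>g a\<bar> \<le> exp (lam * a) * (C * (1 - a)\<^sup>2)"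
      using growth[of "- a"] elim by (intro mult_left_mono) auto
    then show ?case by (simp add: abs_mult algebra_simps)
  qed
qed

section \<open>Linear combinations of the driving Gaussian processes\<close>

locale gaussian_model = prob_space M for M :: "'a measure" +
  fixes B V W :: "real \<Rightarrow> 'a \<Rightarrow> real" and H lam :: real
  assumes H: "0 < H" "H < 1/2" and lam: "lam > 0"
    and B: "fBm M H B" and V: "std_BM M V" and W: "std_BM M W"
    and gauss: "jointly_gaussian3 M B V W"
begin

lemma B_measurable [measurable]: "B t \<in> borel_measurable M"
  using B by (simp add: fBm_def)

lemma B_continuous: "\<omega> \<in> space M \<Longrightarrow> continuous_on UNIV (\<lambda>t. B t \<omega>)"
  using B by (simp add: fBm_def)

lemma B_zero: "\<omega> \<in> space M \<Longrightarrow> B 0 \<omega> = 0"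
  using B by (simp add: fBm_def)

lemma B_incr: "integrable M (\<lambda>\<omega>. (B t \<omega> - B s \<omega>)\<^sup>2)" "(\<integral>\<omega>. (B t \<omega> - B s \<omega>)\<^sup>2 \<partial>M) = \<bar>t - s\<bar> powr (2 * H)"
  using B by (auto simp: fBm_def)

lemma V_measurable: "t \<ge> 0 \<Longrightarrow> V t \<in> borel_measurable M"
  using V by (simp add: std_BM_def)

lemma W_measurable: "t \<ge> 0 \<Longrightarrow> W t \<in> borel_measurable M"
  using W by (simp add: std_BM_def)

lemma W_cov:
  assumes "s \<ge> 0" "t \<ge> 0"
  shows "integrable M (\<lambda>\<omega>. W s \<omega> * W t \<omega>)" "(\<integral>\<omega>. W s \<omega> * W t \<omega> \<partial>M) = min s t"
  using W assms by (auto simp: std_BM_def)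

lemma centered_B: "integrable M (B t)" "expectation (B t) = 0"
proof -
  have "integrable M (\<lambda>\<omega>. (B t \<omega>)\<^sup>2)"
    using B_incr(1)[of t 0] B_zero by (simp cong: Bochner_Integration.integrable_cong)
  then show "integrable M (B t)" by (auto intro: integrable_of_square)
  show "expectation (B t) = 0" using B by (simp add: fBm_def)
qed

lemma centered_V: "t \<ge> 0 \<Longrightarrow> integrable M (V t)" "t \<ge> 0 \<Longrightarrow> expectation (V t) = 0"
proof -
  assume t: "t \<ge> 0"
  then have "integrable M (\<lambda>\<omega>. (V t \<omega>)\<^sup>2)" using V by (simp add: std_BM_def power2_eq_square)
  then show "integrable M (V t)" using V_measurable[OF t] by (auto intro: integrable_of_square)
  show "expectation (V t) = 0" using V t by (simp add: std_BM_def)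
qed

lemma centered_W: "t \<ge> 0 \<Longrightarrow> integrable M (W t)" "t \<ge> 0 \<Longrightarrow> expectation (W t) = 0"
proof -
  assume t: "t \<ge> 0"
  then have "integrable M (\<lambda>\<omega>. (W t \<omega>)\<^sup>2)" using W by (simp add: std_BM_def power2_eq_square)
  then show "integrable M (W t)" using W_measurable[OF t] by (auto intro: integrable_of_square)
  show "expectation (W t) = 0" using W t by (simp add: std_BM_def)
qed

text \<open>The linear span of the driving variables. All members are centred Gaussian, so joint
  Gaussianity of any finite family of members reduces to closure of \<open>lin\<close> under linear
  combinations.\<close>

definition lin :: "('a \<Rightarrow> real) set" where
  "lin = {X. \<exists>J1 J2 J3 a b c. finite J1 \<and> finite J2 \<and> finite J3 \<and> J2 \<subseteq> {0..} \<and> J3 \<subseteq> {0..} \<and>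
     X = (\<lambda>\<omega>. (\<Sum>t\<in>J1. a t * B t \<omega>) + (\<Sum>t\<in>J2. b t * V t \<omega>) + (\<Sum>t\<in>J3. c t * W t \<omega>))}"

lemma lin_gaussian:
  assumes "X \<in> lin"
  shows "\<exists>\<sigma>. centered_gaussian M \<sigma> X"
proof -
  from assms obtain J1 J2 J3 a b c where J: "finite J1" "finite J2" "finite J3" "J2 \<subseteq> {0..}" "J3 \<subseteq> {0..}"
    and X: "X = (\<lambda>\<omega>. (\<Sum>t\<in>J1. a t * B t \<omega>) + (\<Sum>t\<in>J2. b t * V t \<omega>) + (\<Sum>t\<in>J3. c t * W t \<omega>))"
    unfolding lin_def by blast
  have "gaussian_rv M X" using gauss J unfolding X jointly_gaussian3_def by blast
  moreover have "expectation X = 0"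
  proof -
    have iB: "integrable M (\<lambda>\<omega>. a t * B t \<omega>)" for t using centered_B by auto
    have iV: "integrable M (\<lambda>\<omega>. b t * V t \<omega>)" if "t \<in> J2" for t using centered_V that J by auto
    have iW: "integrable M (\<lambda>\<omega>. c t * W t \<omega>)" if "t \<in> J3" for t using centered_W that J by auto
    have "expectation X = (\<Sum>t\<in>J1. a t * expectation (B t)) + (\<Sum>t\<in>J2. b t * expectation (V t)) + (\<Sum>t\<in>J3. c t * expectation (W t))"
      unfolding X using iB iV iW by (simp add: Bochner_Integration.integral_sum)
    then show ?thesis using centered_B centered_V centered_W J by (simp add: subset_iff)
  qed
  ultimately show ?thesis by (metis gaussian_rv_imp_centered_gaussian)
qed

lemma lin_add:
  assumes "X \<in> lin" "Y \<in> lin"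
  shows "(\<lambda>\<omega>. X \<omega> + Y \<omega>) \<in> lin"
proof -
  from assms(1) obtain J1 J2 J3 a b c where J: "finite J1" "finite J2" "finite J3" "J2 \<subseteq> {0..}" "J3 \<subseteq> {0..}"
    and X: "X = (\<lambda>\<omega>. (\<Sum>t\<in>J1. a t * B t \<omega>) + (\<Sum>t\<in>J2. b t * V t \<omega>) + (\<Sum>t\<in>J3. c t * W t \<omega>))"
    unfolding lin_def by blast
  from assms(2) obtain K1 K2 K3 d e f where K: "finite K1" "finite K2" "finite K3" "K2 \<subseteq> {0..}" "K3 \<subseteq> {0..}"
    and Y: "Y = (\<lambda>\<omega>. (\<Sum>t\<in>K1. d t * B t \<omega>) + (\<Sum>t\<in>K2. e t * V t \<omega>) + (\<Sum>t\<in>K3. f t * W t \<omega>))"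
    unfolding lin_def by blast
  \<comment> \<open>Coefficients are extended by zero so that both sums can run over the union of
    the index sets.\<close>
  let ?c = "\<lambda>J K a b t. (if t \<in> J then a t else 0) + (if t \<in> K then b t else (0::real))"
  have u: "(\<Sum>t\<in>J \<union> K. ?c J K a b t * Z t) = (\<Sum>t\<in>J. a t * Z t) + (\<Sum>t\<in>K. b t * Z t)"
    if "finite J" "finite K" for J K :: "real set" and a b and Z :: "real \<Rightarrow> real"
  proof -
    have "(\<Sum>t\<in>J \<union> K. (if t \<in> J then a t else 0) * Z t) = (\<Sum>t\<in>J. a t * Z t)"
      using that by (intro sum.mono_neutral_cong_right) auto
    moreover have "(\<Sum>t\<in>J \<union> K. (if t \<in> K then b t else 0) * Z t) = (\<Sum>t\<in>K. b t * Z t)"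
      using that by (intro sum.mono_neutral_cong_right) auto
    ultimately show ?thesis by (simp add: distrib_right sum.distrib)
  qed
  have "(\<lambda>\<omega>. X \<omega> + Y \<omega>) = (\<lambda>\<omega>. (\<Sum>t\<in>J1 \<union> K1. ?c J1 K1 a d t * B t \<omega>) + (\<Sum>t\<in>J2 \<union> K2. ?c J2 K2 b e t * V t \<omega>)
      + (\<Sum>t\<in>J3 \<union> K3. ?c J3 K3 c f t * W t \<omega>))"
    unfolding u[OF J(1) K(1)] u[OF J(2) K(2)] u[OF J(3) K(3)] X Y by (simp add: algebra_simps)
  then show ?thesis
    unfolding lin_def using J K by (intro CollectI exI[of _ "J1 \<union> K1"] exI[of _ "J2 \<union> K2"] exI[of _ "J3 \<union> K3"] exI conjI) auto
qed

lemma lin_cmult: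
  assumes "X \<in> lin"
  shows "(\<lambda>\<omega>. k * X \<omega>) \<in> lin"
proof -
  from assms obtain J1 J2 J3 a b c where J: "finite J1" "finite J2" "finite J3" "J2 \<subseteq> {0..}" "J3 \<subseteq> {0..}"
    and X: "X = (\<lambda>\<omega>. (\<Sum>t\<in>J1. a t * B t \<omega>) + (\<Sum>t\<in>J2. b t * V t \<omega>) + (\<Sum>t\<in>J3. c t * W t \<omega>))"
    unfolding lin_def by blast
  have "(\<lambda>\<omega>. k * X \<omega>) = (\<lambda>\<omega>. (\<Sum>t\<in>J1. (k * a t) * B t \<omega>) + (\<Sum>t\<in>J2. (k * b t) * V t \<omega>) + (\<Sum>t\<in>J3. (k * c t) * W t \<omega>))"
    unfolding X by (simp add: algebra_simps sum_distrib_left)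
  then show ?thesis
    unfolding lin_def using J by (intro CollectI exI[of _ J1] exI[of _ J2] exI[of _ J3] exI conjI) auto
qed

lemma lin_diff: "X \<in> lin \<Longrightarrow> Y \<in> lin \<Longrightarrow> (\<lambda>\<omega>. X \<omega> - Y \<omega>) \<in> lin"
  using lin_add[OF _ lin_cmult[of Y "-1"], of X] by simp

lemma lin_B: "B t \<in> lin"
  unfolding lin_def
  by (intro CollectI exI[of _ "{t}"] exI[of _ "{}"] exI[of _ "\<lambda>_. 1"]) auto

lemma lin_V: "t \<ge> 0 \<Longrightarrow> V t \<in> lin"
  unfolding lin_def
  by (intro CollectI exI[of _ "{}"] exI[of _ "{t}"] exI[of _ "{}"] exI[of _ "\<lambda>_. 1"]) auto

lemma lin_W: "t \<ge> 0 \<Longrightarrow> W t \<in> lin"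
  unfolding lin_def
  by (intro CollectI exI[of _ "{}"] exI[of _ "{}"] exI[of _ "{t}"] exI[of _ "\<lambda>_. 1"]) auto

lemma lin_zero: "(\<lambda>_. 0) \<in> lin"
  using lin_cmult[OF lin_B, of 0] by simp

lemma lin_sum: "finite I \<Longrightarrow> (\<And>i. i \<in> I \<Longrightarrow> X i \<in> lin) \<Longrightarrow> (\<lambda>\<omega>. \<Sum>i\<in>I. X i \<omega>) \<in> lin"
  by (induction I rule: finite_induct) (auto intro: lin_zero lin_add)

section \<open>Measurability, stationary variance and Gaussianity of the process\<close>

abbreviation J :: "real \<Rightarrow> real \<Rightarrow> 'a \<Rightarrow> real" where
  "J a t \<omega> \<equiv> ibp_exp lam (\<lambda>s. B s \<omega>) a t"

definition Z :: "real \<Rightarrow> 'a \<Rightarrow> real" where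
  "Z t \<omega> = exp (- lam * t) * improper_RS_exp lam (\<lambda>s. B s \<omega>) t"

lemma fOU_eq: "fOU mu theta lam B t \<omega> = mu + theta * Z t \<omega>"
  by (simp add: fOU_def Z_def)

text \<open>Independence from W will be assumed for exactly this sigma-algebra, which is not
  completed by null sets. Measurability of \<open>Z\<close> is therefore proved with respect to it,
  including the event on which the improper integral converges.\<close>

abbreviation sigmaB :: "'a measure" where
  "sigmaB \<equiv> gen_sigma M (range B)"

lemma B_sigmaB [measurable]: "B t \<in> borel_measurable sigmaB"
  by (rule measurable_gen_sigma) auto

lemma J_limit:
  assumes "\<omega> \<in> space M" "a \<le> t"
  shows "(\<lambda>n. RS_sum_exp lam (\<lambda>s. B s \<omega>) a t n) \<longlonglongrightarrow> J a t \<omega>"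
  using RS_sum_exp_tendsto[OF has_RS_integral_exp[OF B_continuous[OF assms(1)] lam assms(2)] assms(2)] .

lemma J_sigmaB [measurable]:
  assumes "a \<le> t"
  shows "J a t \<in> borel_measurable sigmaB"
proof (rule borel_measurable_LIMSEQ_real)
  show "(\<lambda>n. RS_sum_exp lam (\<lambda>s. B s \<omega>) a t n) \<longlonglongrightarrow> J a t \<omega>" if "\<omega> \<in> space sigmaB" for \<omega>
    using J_limit[of \<omega>] that assms by simp
  show "(\<lambda>\<omega>. RS_sum_exp lam (\<lambda>s. B s \<omega>) a t n) \<in> borel_measurable sigmaB" for n
    unfolding RS_sum_exp_def by measurable
qed

lemma RS_sum_lin: "(\<lambda>\<omega>. RS_sum_exp lam (\<lambda>s. B s \<omega>) a t n) \<in> lin"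
  unfolding RS_sum_exp_def by (intro lin_sum lin_cmult lin_diff lin_B) auto

lemma conv_sigmaB [measurable]: "Measurable.pred sigmaB (\<lambda>\<omega>. conv_bot lam (\<lambda>s. B s \<omega>))"
proof (subst measurable_cong)
  show "conv_bot lam (\<lambda>s. B s \<omega>) \<longleftrightarrow> (\<forall>k::nat. \<exists>N::nat. \<forall>a b::rat.
    \<bar>J (- real N - \<bar>of_rat a\<bar>) 0 \<omega> - J (- real N - \<bar>of_rat b\<bar>) 0 \<omega>\<bar> \<le> 1 / real (Suc k))" if "\<omega> \<in> space sigmaB" for \<omega>
    using conv_bot_iff_rational_Cauchy[OF B_continuous, of \<omega> lam] that by simp
  have [measurable]: "J (- real N - \<bar>of_rat a\<bar>) 0 \<in> borel_measurable sigmaB" for N and a :: rat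
    by (rule J_sigmaB) linarith
  show "Measurable.pred sigmaB (\<lambda>\<omega>. \<forall>k::nat. \<exists>N::nat. \<forall>a b::rat.
    \<bar>J (- real N - \<bar>of_rat a\<bar>) 0 \<omega> - J (- real N - \<bar>of_rat b\<bar>) 0 \<omega>\<bar> \<le> 1 / real (Suc k))"
    by measurable
qed

definition L0 :: "'a \<Rightarrow> real" where
  "L0 \<omega> = (if conv_bot lam (\<lambda>s. B s \<omega>) then Lim at_bot (\<lambda>a. J a 0 \<omega>) else 0)"

lemma conv_limit:
  assumes "conv_bot lam (\<lambda>s. B s \<omega>)"
  shows "((\<lambda>a. J a 0 \<omega>) \<longlongrightarrow> L0 \<omega>) at_bot"
  using assms tendsto_Lim[OF trivial_limit_at_bot_linorder] by (fastforce simp: L0_def conv_bot_def)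

lemma L0_sigmaB [measurable]: "L0 \<in> borel_measurable sigmaB"
proof (rule borel_measurable_LIMSEQ_real)
  fix n :: nat
  have [measurable]: "J (- real n) 0 \<in> borel_measurable sigmaB" by (rule J_sigmaB) auto
  show "(\<lambda>\<omega>. if conv_bot lam (\<lambda>s. B s \<omega>) then J (- real n) 0 \<omega> else 0) \<in> borel_measurable sigmaB" by measurable
next
  fix \<omega>
  show "(\<lambda>n. if conv_bot lam (\<lambda>s. B s \<omega>) then J (- real n) 0 \<omega> else 0) \<longlonglongrightarrow> L0 \<omega>"
  proof (cases "conv_bot lam (\<lambda>s. B s \<omega>)")
    case True
    have "filterlim (\<lambda>n. - real n) at_bot sequentially"
      by (simp add: filterlim_uminus_at_bot filterlim_real_sequentially)
    then show ?thesis using filterlim_compose[OF conv_limit[OF True]] True by simp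
  qed (simp add: L0_def)
qed

lemma Z_eq:
  assumes "\<omega> \<in> space M" "t \<ge> 0"
  shows "Z t \<omega> = exp (- lam * t) * (if conv_bot lam (\<lambda>s. B s \<omega>) then L0 \<omega> + J 0 t \<omega> else Lim_junk)"
  using improper_RS_exp_eq[OF B_continuous[OF assms(1)] lam assms(2)] by (simp add: Z_def L0_def)

lemma Z_sigmaB [measurable]:
  assumes "t \<ge> 0"
  shows "Z t \<in> borel_measurable sigmaB"
proof (subst measurable_cong)
  show "Z t \<omega> = exp (- lam * t) * (if conv_bot lam (\<lambda>s. B s \<omega>) then L0 \<omega> + J 0 t \<omega> else Lim_junk)" if "\<omega> \<in> space sigmaB" for \<omega>
    using Z_eq that assms by simp
  have [measurable]: "J 0 t \<in> borel_measurable sigmaB" by (rule J_sigmaB[OF assms])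
  show "(\<lambda>\<omega>. exp (- lam * t) * (if conv_bot lam (\<lambda>s. B s \<omega>) then L0 \<omega> + J 0 t \<omega> else Lim_junk)) \<in> borel_measurable sigmaB"
    by measurable
qed

lemma subalgebra_sigmaB: "subalgebra M sigmaB"
  by (rule gen_sigma_subalgebra) auto

lemma Z_measurable: "t \<ge> 0 \<Longrightarrow> Z t \<in> borel_measurable M"
  using measurable_from_subalg[OF subalgebra_sigmaB Z_sigmaB] .

text \<open>This holds on every path: where the improper integral diverges, \<open>Z\<close> is a
  constant multiple of \<open>exp (- lam * t)\<close>.\<close>

lemma Z_continuous:
  assumes "\<omega> \<in> space M"
  shows "continuous_on {0..b} (\<lambda>t. Z t \<omega>)"
proof -
  have cont: "continuous_on S (\<lambda>s. B s \<omega>)" for S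
    using B_continuous[OF assms] continuous_on_subset by blast
  have "continuous_on {0..b} (\<lambda>t. integral {0..t} (\<lambda>r. exp (lam * r) * B r \<omega>))"
    by (intro indefinite_integral_continuous_1 integrable_continuous_real continuous_intros cont)
  then have c: "continuous_on {0..b} (\<lambda>t. J 0 t \<omega>)"
    unfolding ibp_exp_def by (intro continuous_intros cont)
  have "continuous_on {0..b} (\<lambda>t. exp (- lam * t) * (if conv_bot lam (\<lambda>s. B s \<omega>) then L0 \<omega> + J 0 t \<omega> else Lim_junk))"
    by (cases "conv_bot lam (\<lambda>s. B s \<omega>)") (auto intro!: continuous_intros c)
  then show ?thesis
    by (rule continuous_on_eq) (use Z_eq[OF assms] in auto)
qed

lemma growth: "AE \<omega> in M. ((\<lambda>a. exp (lam * a) * B a \<omega>) \<longlongrightarrow> 0) at_bot"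
proof -
  have "AE \<omega> in M. \<exists>C. \<forall>t\<ge>0. \<bar>B (- t) \<omega>\<bar> \<le> C * (1 + t)\<^sup>2"
    by (rule fBm_polynomial_growth[OF B H(1)]) (intro lin_gaussian lin_diff lin_B)
  then show ?thesis
    by eventually_elim (auto intro: decay_of_polynomial_growth[OF lam])
qed

text \<open>The stationary variance of \<open>Z\<close>, so R_Y(0) is
  \<open>theta\<^sup>2 * R0\<close>.\<close>

definition R0 :: real where
  "R0 = Gamma (2 * H + 1) / (2 * lam powr (2 * H))"

lemma R0_pos: "R0 > 0"
  using H lam by (simp add: R0_def Gamma_real_pos)

text \<open>Almost surely \<open>Z t\<close> is the mean of \<open>f r\<close> = B t - B (t - r)
  over exponential \<open>r\<close>. A difference \<open>f r - f p\<close> is again an increment of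
  B, with lag r - p, so both terms of the averaging identity equal the same moment \<open>m\<close>
  of the exponential law: 2 E(Z t)^2 + m = 2 m.\<close>

lemma
  assumes t: "t \<ge> 0"
  shows Z_limit: "AE \<omega> in M. ((\<lambda>a. exp (- lam * t) * J a t \<omega>) \<longlongrightarrow> Z t \<omega>) at_bot"
    and Z_square_integrable: "integrable M (\<lambda>\<omega>. (Z t \<omega>)\<^sup>2)"
    and Z_variance: "(\<integral>\<omega>. (Z t \<omega>)\<^sup>2 \<partial>M) = R0"
proof -
  have [measurable]: "Z t \<in> borel_measurable M" by (rule Z_measurable[OF t])
  define f where "f r \<omega> = B t \<omega> - B (t - r) \<omega>" for r \<omega>
  define m where "m = Gamma (2 * H + 1) / lam powr (2 * H)"
  have m: "m \<ge> 0" "m = 2 * R0" using R0_pos by (auto simp: m_def R0_def)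
  have \<nu>: "prob_space (exp_law lam)" using lam by (intro prob_space_exponential_density)
  have "(\<lambda>(r, \<omega>). f r \<omega>) \<in> borel_measurable (borel \<Otimes>\<^sub>M M)"
  proof (rule continuous_process_measurable)
    show "continuous_on UNIV (\<lambda>r. f r \<omega>)" if "\<omega> \<in> space M" for \<omega>
      unfolding f_def
      by (intro continuous_intros continuous_on_compose2[OF B_continuous[OF that]]) auto
  qed (simp add: f_def)
  then have fm: "(\<lambda>(r, \<omega>). f r \<omega>) \<in> borel_measurable (exp_law lam \<Otimes>\<^sub>M M)"
    by (simp cong: measurable_cong_sets sets_pair_measure_cong)
  have Ef: "(\<integral>\<^sup>+\<omega>. ennreal ((f r \<omega>)\<^sup>2) \<partial>M) = ennreal (\<bar>r\<bar> powr (2 * H))" for r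
    unfolding f_def using B_incr[of t "t - r"] by (subst nn_integral_eq_integral) auto
  have Ed: "(\<integral>\<^sup>+\<omega>. ennreal ((f r \<omega> - f p \<omega>)\<^sup>2) \<partial>M) = ennreal (\<bar>r - p\<bar> powr (2 * H))" for r p
  proof -
    have "f r \<omega> - f p \<omega> = B (t - p) \<omega> - B (t - r) \<omega>" for \<omega> by (simp add: f_def)
    then show ?thesis using B_incr[of "t - p" "t - r"] by (subst nn_integral_eq_integral) auto
  qed
  have A: "(\<integral>\<^sup>+r. \<integral>\<^sup>+\<omega>. ennreal ((f r \<omega>)\<^sup>2) \<partial>M \<partial>exp_law lam) = ennreal m"
    unfolding Ef m_def using H lam by (intro exp_law_moment) auto
  have D: "(\<integral>\<^sup>+r. \<integral>\<^sup>+p. \<integral>\<^sup>+\<omega>. ennreal ((f r \<omega> - f p \<omega>)\<^sup>2) \<partial>M \<partial>exp_law lam \<partial>exp_law lam) = ennreal m"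
    unfolding Ed m_def abs_minus_commute[of _ "_::real"] using H lam exp_law_abs_diff_moment[of lam "2 * H"]
    by (simp add: abs_minus_commute)
  have fin: "(\<integral>\<^sup>+r. \<integral>\<^sup>+\<omega>. ennreal ((f r \<omega>)\<^sup>2) \<partial>M \<partial>exp_law lam) < \<infinity>" by (simp add: A)
  note P = prob_space_axioms
  have lim: "AE \<omega> in M. ((\<lambda>a. J a t \<omega>) \<longlongrightarrow> exp (lam * t) * (\<integral>r. f r \<omega> \<partial>exp_law lam)) at_bot"
    using average_AE_integrable[OF P \<nu> fm fin] growth AE_space
    by eventually_elim (auto simp: f_def intro!: ibp_exp_tendsto[OF B_continuous lam])
  have Zf: "AE \<omega> in M. Z t \<omega> = (\<integral>r. f r \<omega> \<partial>exp_law lam)"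
    using lim AE_space
  proof eventually_elim
    case (elim \<omega>)
    have "\<forall>\<^sub>F a in at_bot. J a t \<omega> = RS_integral (\<lambda>s. exp (lam * s)) (\<lambda>s. B s \<omega>) a t"
      using eventually_le_at_bot[of t] by eventually_elim (use RS_integral_exp[OF B_continuous lam] elim in auto)
    then have "((\<lambda>a. RS_integral (\<lambda>s. exp (lam * s)) (\<lambda>s. B s \<omega>) a t) \<longlongrightarrow> exp (lam * t) * (\<integral>r. f r \<omega> \<partial>exp_law lam)) at_bot"
      using elim(1) by (simp add: tendsto_cong)
    then have "improper_RS_exp lam (\<lambda>s. B s \<omega>) t = exp (lam * t) * (\<integral>r. f r \<omega> \<partial>exp_law lam)"
      unfolding improper_RS_exp_def by (rule tendsto_Lim[OF trivial_limit_at_bot_linorder])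
    then show ?case by (simp add: Z_def exp_minus)
  qed
  show "AE \<omega> in M. ((\<lambda>a. exp (- lam * t) * J a t \<omega>) \<longlongrightarrow> Z t \<omega>) at_bot"
    using lim Zf
  proof eventually_elim
    case (elim \<omega>)
    have "((\<lambda>a. exp (- lam * t) * J a t \<omega>) \<longlongrightarrow> exp (- lam * t) * (exp (lam * t) * (\<integral>r. f r \<omega> \<partial>exp_law lam))) at_bot"
      by (intro tendsto_intros elim)
    moreover have "exp (- lam * t) * (exp (lam * t) * x) = x" for x by (simp add: exp_minus)
    ultimately show ?case using elim by metis
  qed
  have "(\<integral>\<^sup>+\<omega>. ennreal ((Z t \<omega>)\<^sup>2) \<partial>M) = (\<integral>\<^sup>+\<omega>. ennreal ((\<integral>r. f r \<omega> \<partial>exp_law lam)\<^sup>2) \<partial>M)" (is "?E = ?E'")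
    by (rule nn_integral_cong_AE) (use Zf in eventually_elim, simp)
  moreover have "2 * ?E' + ennreal m = 2 * ennreal m"
    using average_second_moment[OF P \<nu> fm fin] unfolding A D .
  ultimately have e: "2 * ?E + ennreal m = 2 * ennreal m" by simp
  \<comment> \<open>Cancelling \<open>m\<close> needs finiteness: an infinite second moment would
    force the finite right-hand side of \<open>e\<close> to be infinite.\<close>
  have E: "?E = ennreal R0"
  proof (cases ?E)
    case (real x)
    then have "ennreal (2 * x + m) = ennreal (2 * m)"
      using e m by (simp add: ennreal_mult'[symmetric] ennreal_plus[symmetric] del: ennreal_plus flip: ennreal_numeral)
    then have "2 * x + m = 2 * m" using real m by (subst (asm) ennreal_inj) auto
    then show ?thesis using real m by simp
  next
    case top
    have "2 * ennreal m = ennreal (2 * m)" using m by (simp add: ennreal_mult')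
    with top e have "top = ennreal (2 * m)" by (simp add: ennreal_mult_eq_top_iff ennreal_top_mult)
    then show ?thesis by simp
  qed
  show i: "integrable M (\<lambda>\<omega>. (Z t \<omega>)\<^sup>2)"
    by (rule integrableI_bounded) (use E in auto)
  then have "?E = ennreal (\<integral>\<omega>. (Z t \<omega>)\<^sup>2 \<partial>M)" by (intro nn_integral_eq_integral) auto
  then show "(\<integral>\<omega>. (Z t \<omega>)\<^sup>2 \<partial>M) = R0"
    using R0_pos unfolding E by (subst (asm) ennreal_inj) auto
qed

text \<open>Two successive limits of centred Gaussian variables: Riemann sums tend to the integral
  from - k, and then - k tends to minus infinity.\<close>

lemma Z_gaussian:
  assumes s: "s \<ge> 0" and u: "u \<ge> 0"
  shows "\<exists>\<sigma>. centered_gaussian M \<sigma> (\<lambda>\<omega>. \<alpha> * Z s \<omega> + \<beta> * Z u \<omega>)"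
proof -
  have [measurable]: "Z s \<in> borel_measurable M" "Z u \<in> borel_measurable M" using Z_measurable s u by auto
  have JM: "J a t \<in> borel_measurable M" if "a \<le> t" for a t
    using measurable_from_subalg[OF subalgebra_sigmaB J_sigmaB[OF that]] .
  show ?thesis
  proof (rule centered_gaussian_AE_limit)
    fix k :: nat
    let ?X = "\<lambda>\<omega>. \<alpha> * (exp (- lam * s) * J (- real k) s \<omega>) + \<beta> * (exp (- lam * u) * J (- real k) u \<omega>)"
    show "\<exists>\<sigma>. centered_gaussian M \<sigma> ?X"
    proof (rule centered_gaussian_AE_limit)
      let ?S = "\<lambda>n \<omega>. \<alpha> * (exp (- lam * s) * RS_sum_exp lam (\<lambda>s. B s \<omega>) (- real k) s n)
          + \<beta> * (exp (- lam * u) * RS_sum_exp lam (\<lambda>s. B s \<omega>) (- real k) u n)"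
      show "\<exists>\<sigma>. centered_gaussian M \<sigma> (?S n)" for n
        by (intro lin_gaussian lin_add lin_cmult RS_sum_lin)
      show "AE \<omega> in M. (\<lambda>n. ?S n \<omega>) \<longlonglongrightarrow> ?X \<omega>"
        by (rule AE_I2) (intro tendsto_intros J_limit; use s u in simp)
      have [measurable]: "J (- real k) s \<in> borel_measurable M" "J (- real k) u \<in> borel_measurable M"
        using s u by (auto intro!: JM)
      show "?X \<in> borel_measurable M" by measurable
    qed
  next
    have fl: "filterlim (\<lambda>n. - real n) at_bot sequentially"
      by (simp add: filterlim_uminus_at_bot filterlim_real_sequentially)
    show "AE \<omega> in M. (\<lambda>k. \<alpha> * (exp (- lam * s) * J (- real k) s \<omega>) + \<beta> * (exp (- lam * u) * J (- real k) u \<omega>))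
        \<longlonglongrightarrow> \<alpha> * Z s \<omega> + \<beta> * Z u \<omega>"
      using Z_limit[OF s] Z_limit[OF u]
      by eventually_elim (intro tendsto_intros filterlim_compose[OF _ fl])
  qed measurable
qed

end

text \<open>A right-endpoint sum of an increasing function dominates its integral; the mean value
  theorem compares one summand. The reversed index \<open>m - q\<close> is the form in which the
  last row of the double sum appears.\<close>

lemma sum_powr_lower:
  fixes b :: real
  assumes b: "b \<ge> 0"
  shows "(\<Sum>q<m. real (m - q) powr b) \<ge> real m powr (b + 1) / (b + 1)"
proof (induction m)
  case 0 then show ?case using b by simp
next
  case (Suc m)
  have step: "real (Suc m) powr (b + 1) / (b + 1) - real m powr (b + 1) / (b + 1) \<le> real (Suc m) powr b"
  proof (cases "m = 0")
    case True then show ?thesis using b by simp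
  next
    case False
    have "\<exists>z>real m. z < real (Suc m) \<and> real (Suc m) powr (b + 1) / (b + 1) - real m powr (b + 1) / (b + 1)
        = (real (Suc m) - real m) * (z powr b)"
    proof (rule MVT2)
      show "((\<lambda>x. x powr (b + 1) / (b + 1)) has_real_derivative x powr b) (at x)"
        if "real m \<le> x" "x \<le> real (Suc m)" for x
        using that False b by (auto intro!: derivative_eq_intros)
    qed simp
    then obtain z where "z > real m" "z < real (Suc m)"
      "real (Suc m) powr (b + 1) / (b + 1) - real m powr (b + 1) / (b + 1) = z powr b" by auto
    then show ?thesis using b by (auto intro!: powr_mono2)
  qed
  have "(\<Sum>q<Suc m. real (Suc m - q) powr b) = real (Suc m) powr b + (\<Sum>q<m. real (m - q) powr b)"
    by (simp add: sum.lessThan_Suc_shift del: sum.lessThan_Suc)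
  with Suc step show ?case by linarith
qed

text \<open>Discrete counterpart of the integral of |x - y|^a over the unit square, which is
  2/((a+1)(a+2)). Enlarging the square by one row and one column adds twice a sum of powers;
  bounding that sum and then summing over the rows gives the two factors of the denominator. The
  loss from \<open>m\<close> in place of \<open>Suc m\<close> disappears after
  normalization.\<close>

lemma double_sum_powr_lower:
  fixes a :: real
  assumes a: "a > 0"
  shows "(\<Sum>p<Suc m. \<Sum>q<Suc m. \<bar>real p - real q\<bar> powr a) \<ge> 2 / ((a + 1) * (a + 2)) * real m powr (a + 2)"
proof -
  have "(\<Sum>p<m. \<Sum>q<m. \<bar>real p - real q\<bar> powr a) \<ge> 2 / (a + 1) * (\<Sum>p<m. real p powr (a + 1))" for m
  proof (induction m)
    case (Suc m)
    have "(\<Sum>q<m. \<bar>real m - real q\<bar> powr a) = (\<Sum>q<m. real (m - q) powr a)"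
      by (intro sum.cong) (auto simp: of_nat_diff)
    then have r: "(\<Sum>q<m. \<bar>real m - real q\<bar> powr a) \<ge> real m powr (a + 1) / (a + 1)"
      using sum_powr_lower[of a m] a by simp
    have c: "(\<Sum>p<m. \<bar>real p - real m\<bar> powr a) = (\<Sum>q<m. \<bar>real m - real q\<bar> powr a)"
      by (simp add: abs_minus_commute)
    have "(\<Sum>p<Suc m. \<Sum>q<Suc m. \<bar>real p - real q\<bar> powr a)
        = (\<Sum>p<m. \<Sum>q<m. \<bar>real p - real q\<bar> powr a) + 2 * (\<Sum>q<m. \<bar>real m - real q\<bar> powr a)"
      using c by (simp add: sum.distrib)
    then show ?case using Suc r by (simp add: distrib_left)
  qed simp
  from this[of "Suc m"] have 1: "(\<Sum>p<Suc m. \<Sum>q<Suc m. \<bar>real p - real q\<bar> powr a) \<ge> 2 / (a + 1) * (\<Sum>p<Suc m. real p powr (a + 1))" .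
  have "(\<Sum>p<Suc m. real p powr (a + 1)) = (\<Sum>q<m. real (m - q) powr (a + 1))"
  proof -
    have "(\<Sum>p<Suc m. real p powr (a + 1)) = (\<Sum>p<m. real (Suc p) powr (a + 1))"
      by (simp add: sum.lessThan_Suc_shift del: sum.lessThan_Suc)
    also have "\<dots> = (\<Sum>q<m. real (Suc (m - Suc q)) powr (a + 1))"
      by (rule sum.nat_diff_reindex[symmetric])
    also have "\<dots> = (\<Sum>q<m. real (m - q) powr (a + 1))"
      by (intro sum.cong) (auto simp: Suc_diff_Suc)
    finally show ?thesis .
  qed
  then have 2: "(\<Sum>p<Suc m. real p powr (a + 1)) \<ge> real m powr (a + 2) / (a + 2)"
    using sum_powr_lower[of "a + 1" m] a by (simp add: add.assoc)
  have "2 / ((a + 1) * (a + 2)) * real m powr (a + 2) = 2 / (a + 1) * (real m powr (a + 2) / (a + 2))" by simp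
  also have "\<dots> \<le> 2 / (a + 1) * (\<Sum>p<Suc m. real p powr (a + 1))"
    using a by (intro mult_left_mono 2) auto
  finally show ?thesis using 1 by linarith
qed

section \<open>Variance of short increments of the process\<close>

definition unif :: "real \<Rightarrow> real \<Rightarrow> real measure" where
  "unif u s = density lborel (\<lambda>r. ennreal (indicator {u..s} r / (s - u)))"

lemma prob_space_unif:
  assumes "u < s"
  shows "prob_space (unif u s)"
proof (rule prob_spaceI)
  have "emeasure (unif u s) (space (unif u s)) = (\<integral>\<^sup>+r. ennreal (1 / (s - u)) * indicator {u..s} r \<partial>lborel)"
    unfolding unif_def by (auto simp: emeasure_density indicator_def intro!: nn_integral_cong)
  also have "\<dots> = ennreal (1 / (s - u)) * ennreal (s - u)"
    using assms by (simp add: nn_integral_cmult_indicator)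
  also have "\<dots> = 1" using assms by (simp add: ennreal_mult'[symmetric])
  finally show "emeasure (unif u s) (space (unif u s)) = 1" .
qed

lemma sets_unif [measurable_cong]: "sets (unif u s) = sets borel"
  by (simp add: unif_def)

lemma integral_unif:
  fixes f :: "real \<Rightarrow> real"
  assumes "u < s" "continuous_on UNIV f"
  shows "(\<integral>r. f r \<partial>unif u s) = integral {u..s} f / (s - u)"
proof -
  have [measurable]: "f \<in> borel_measurable borel" using assms by (intro borel_measurable_continuous_onI)
  have "(\<integral>r. f r \<partial>unif u s) = (\<integral>r. (indicator {u..s} r / (s - u)) * f r \<partial>lborel)"
    unfolding unif_def using assms by (subst integral_density) auto
  also have "\<dots> = (LINT r:{u..s}|lborel. f r) / (s - u)"
    unfolding set_lebesgue_integral_def by (simp add: mult.commute)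
  also have "(LINT r:{u..s}|lborel. f r) = integral {u..s} f"
    by (intro set_borel_integral_eq_integral borel_integrable_atLeastAtMost' continuous_on_subset[OF assms(2)]) auto
  finally show ?thesis .
qed

text \<open>\<open>ibp_exp\<close> vanishes on constants, so the path may be recentred at
  \<open>g u\<close> for free. What remains beside \<open>g s - g u\<close> carries an additional
  factor \<open>s - u\<close>, which makes it negligible for short intervals.\<close>

lemma ibp_exp_increment:
  assumes g: "continuous_on UNIV g" and lam: "lam > 0" and us: "u < s"
  shows "exp (- lam * s) * ibp_exp lam g u s
    = (g s - g u) - lam * (s - u) * (\<integral>r. exp (- lam * (s - r)) * (g r - g u) \<partial>unif u s)"
proof -
  have cont: "continuous_on S g" for S
    using g continuous_on_subset by blast
  have "((\<lambda>r. exp (- lam * s) * (lam * (exp (lam * r) * g r) - g u * (lam * exp (lam * r)))) has_integral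
      exp (- lam * s) * (lam * integral {u..s} (\<lambda>r. exp (lam * r) * g r) - g u * (exp (lam * s) - exp (lam * u)))) {u..s}"
    using us by (intro has_integral_mult_right has_integral_diff has_integral_exp_scaled integrable_integral
      integrable_continuous_real continuous_intros cont) auto
  moreover have "exp (- lam * s) * (lam * (exp (lam * r) * g r) - g u * (lam * exp (lam * r))) = lam * (exp (- lam * (s - r)) * (g r - g u))" for r
  proof -
    have "- lam * (s - r) = - lam * s + lam * r" by (simp add: algebra_simps)
    then have "exp (- lam * (s - r)) = exp (- lam * s) * exp (lam * r)" by (simp only: exp_add)
    then show ?thesis by (simp only:) (simp only: algebra_simps)
  qed
  ultimately have "lam * integral {u..s} (\<lambda>r. exp (- lam * (s - r)) * (g r - g u))
      = exp (- lam * s) * (lam * integral {u..s} (\<lambda>r. exp (lam * r) * g r) - g u * (exp (lam * s) - exp (lam * u)))"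
    by (auto dest: integral_unique)
  moreover have "lam * (s - u) * (\<integral>r. exp (- lam * (s - r)) * (g r - g u) \<partial>unif u s)
      = lam * integral {u..s} (\<lambda>r. exp (- lam * (s - r)) * (g r - g u))"
    using us by (subst integral_unif) (auto intro!: continuous_intros cont)
  moreover have "exp (- lam * s) * exp (lam * s) = 1" by (simp add: exp_minus)
  ultimately show ?thesis
    unfolding ibp_exp_def by (simp add: algebra_simps)
qed

text \<open>Young's inequality: expand the nonnegative square
  \<open>(\<eta> * x + y)\<^sup>2 / \<eta>\<close>.\<close>

lemma square_add_lower:
  fixes x y \<eta> :: real
  assumes "\<eta> > 0"
  shows "(x + y)\<^sup>2 \<ge> (1 - \<eta>) * x\<^sup>2 - y\<^sup>2 / \<eta>"
proof -
  have "0 \<le> (\<eta> * x + y)\<^sup>2 / \<eta>" using assms by simp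
  also have "\<dots> = \<eta> * x\<^sup>2 + 2 * x * y + y\<^sup>2 / \<eta>" using assms by (simp add: power2_eq_square field_simps)
  finally have "0 \<le> \<eta> * x\<^sup>2 + 2 * x * y + y\<^sup>2 / \<eta>" .
  moreover have "(x + y)\<^sup>2 = x\<^sup>2 + 2 * x * y + y\<^sup>2" by (simp add: power2_sum)
  moreover have "y\<^sup>2 \<ge> 0" by simp
  moreover have "(1 - \<eta>) * x\<^sup>2 = x\<^sup>2 - \<eta> * x\<^sup>2" by (simp add: left_diff_distrib)
  ultimately show ?thesis by linarith
qed

context gaussian_model
begin

lemma conv_AE: "AE \<omega> in M. conv_bot lam (\<lambda>s. B s \<omega>)"
  using Z_limit[of 0] by (auto simp: conv_bot_def elim!: eventually_mono)

lemma Z_diff_square_integrable: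
  assumes "s \<ge> 0" "u \<ge> 0"
  shows "integrable M (\<lambda>\<omega>. (Z s \<omega> - Z u \<omega>)\<^sup>2)"
  using assms by (intro square_integrable_diff Z_measurable Z_square_integrable)

text \<open>The increment of \<open>Z\<close> is that of \<open>B\<close> plus a perturbation, made
  of damping of \<open>Z u\<close> by \<open>exp (- lam * \<delta>) - 1\<close> and of the
  correction from integration by parts; both are of order \<open>\<delta>\<close> in L2. Young's
  inequality separates the perturbation without computing its covariance with the increment of
  \<open>B\<close>.\<close>

lemma Z_increment_lower:
  assumes u: "0 \<le> u" and us: "u < s" and \<eta>: "\<eta> > 0"
  shows "(\<integral>\<omega>. (Z s \<omega> - Z u \<omega>)\<^sup>2 \<partial>M)
    \<ge> (1 - \<eta>) * (s - u) powr (2 * H) - 2 * lam\<^sup>2 * (s - u)\<^sup>2 * (R0 + (s - u) powr (2 * H)) / \<eta>"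
proof -
  define \<delta> where "\<delta> = s - u"
  have \<delta>: "\<delta> > 0" using us by (simp add: \<delta>_def)
  have s: "s \<ge> 0" using u us by simp
  note [measurable] = Z_measurable[OF s] Z_measurable[OF u]
  define f where "f r \<omega> = exp (- lam * (s - r)) * (B r \<omega> - B u \<omega>)" for r \<omega>
  define I where "I \<omega> = (\<integral>r. f r \<omega> \<partial>unif u s)" for \<omega>
  interpret N: prob_space "unif u s" by (rule prob_space_unif[OF us])
  have "(\<lambda>(r, \<omega>). f r \<omega>) \<in> borel_measurable (borel \<Otimes>\<^sub>M M)"
  proof (rule continuous_process_measurable)
    show "continuous_on UNIV (\<lambda>r. f r \<omega>)" if "\<omega> \<in> space M" for \<omega>
      unfolding f_def using B_continuous[OF that] by (intro continuous_intros)
  qed (simp add: f_def)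
  then have fm: "(\<lambda>(r, \<omega>). f r \<omega>) \<in> borel_measurable (unif u s \<Otimes>\<^sub>M M)"
    by (simp add: sets_unif cong: measurable_cong_sets sets_pair_measure_cong)
  have fm'[measurable]: "(\<lambda>\<omega>. f r \<omega>) \<in> borel_measurable M" for r unfolding f_def by measurable
  have Im[measurable]: "I \<in> borel_measurable M"
  proof -
    have "(\<lambda>(\<omega>, r). f r \<omega>) \<in> borel_measurable (M \<Otimes>\<^sub>M unif u s)"
      using measurable_pair_swap[OF fm] by (simp add: split_beta')
    then show ?thesis unfolding I_def by (rule N.borel_measurable_lebesgue_integral)
  qed
  have A: "(\<integral>\<^sup>+r. \<integral>\<^sup>+\<omega>. ennreal ((f r \<omega>)\<^sup>2) \<partial>M \<partial>unif u s) \<le> ennreal (\<delta> powr (2 * H))"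
  proof -
    have "AE r in unif u s. r \<in> {u..s}"
      unfolding unif_def by (subst AE_density) (auto simp: indicator_def intro!: AE_I2)
    then have "AE r in unif u s. (\<integral>\<^sup>+\<omega>. ennreal ((f r \<omega>)\<^sup>2) \<partial>M) \<le> ennreal (\<delta> powr (2 * H))"
    proof eventually_elim
      case (elim r)
      have "(\<integral>\<^sup>+\<omega>. ennreal ((f r \<omega>)\<^sup>2) \<partial>M) \<le> (\<integral>\<^sup>+\<omega>. ennreal ((B r \<omega> - B u \<omega>)\<^sup>2) \<partial>M)"
      proof (intro nn_integral_mono ennreal_leI)
        fix \<omega>
        have "(exp (- lam * (s - r)))\<^sup>2 \<le> 1" using elim lam by (intro power_le_one) auto
        then have "(exp (- lam * (s - r)))\<^sup>2 * (B r \<omega> - B u \<omega>)\<^sup>2 \<le> 1 * (B r \<omega> - B u \<omega>)\<^sup>2"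
          by (intro mult_right_mono) auto
        then show "(f r \<omega>)\<^sup>2 \<le> (B r \<omega> - B u \<omega>)\<^sup>2" by (simp add: f_def power_mult_distrib)
      qed
      also have "\<dots> = ennreal (\<bar>r - u\<bar> powr (2 * H))"
        using B_incr[of r u] by (subst nn_integral_eq_integral) auto
      also have "\<dots> \<le> ennreal (\<delta> powr (2 * H))"
        using elim H by (intro ennreal_leI powr_mono2) (auto simp: \<delta>_def)
      finally show ?case .
    qed
    then have "(\<integral>\<^sup>+r. \<integral>\<^sup>+\<omega>. ennreal ((f r \<omega>)\<^sup>2) \<partial>M \<partial>unif u s) \<le> (\<integral>\<^sup>+r. ennreal (\<delta> powr (2 * H)) \<partial>unif u s)"
      by (rule nn_integral_mono_AE)
    then show ?thesis using N.emeasure_space_1 by simp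
  qed
  have fin: "(\<integral>\<^sup>+r. \<integral>\<^sup>+\<omega>. ennreal ((f r \<omega>)\<^sup>2) \<partial>M \<partial>unif u s) < \<infinity>"
    by (rule le_less_trans[OF A]) simp
  have EI: "(\<integral>\<^sup>+\<omega>. ennreal ((I \<omega>)\<^sup>2) \<partial>M) \<le> ennreal (\<delta> powr (2 * H))"
  proof -
    have "2 * (\<integral>\<^sup>+\<omega>. ennreal ((I \<omega>)\<^sup>2) \<partial>M) \<le> 2 * (\<integral>\<^sup>+r. \<integral>\<^sup>+\<omega>. ennreal ((f r \<omega>)\<^sup>2) \<partial>M \<partial>unif u s)"
      unfolding I_def average_second_moment[OF prob_space_axioms N.prob_space_axioms fm fin, symmetric]
      by (rule add_increasing2) auto
    also have "\<dots> \<le> 2 * ennreal (\<delta> powr (2 * H))" by (intro mult_left_mono A) simp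
    finally show ?thesis
      by (subst (asm) ennreal_mult_le_mult_iff) auto
  qed
  have I2: "integrable M (\<lambda>\<omega>. (I \<omega>)\<^sup>2)"
    by (rule integrableI_bounded) (use EI in \<open>auto intro: le_less_trans\<close>)
  have EI': "(\<integral>\<omega>. (I \<omega>)\<^sup>2 \<partial>M) \<le> \<delta> powr (2 * H)"
    using EI by (subst (asm) nn_integral_eq_integral[OF I2]) (auto simp: ennreal_le_iff)
  have pw: "AE \<omega> in M. (Z s \<omega> - Z u \<omega>)\<^sup>2 \<ge> (1 - \<eta>) * (B s \<omega> - B u \<omega>)\<^sup>2
      - 2 * lam\<^sup>2 * \<delta>\<^sup>2 / \<eta> * ((Z u \<omega>)\<^sup>2 + (I \<omega>)\<^sup>2)"
    using conv_AE AE_space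
  proof eventually_elim
    case (elim \<omega>)
    note c = B_continuous[OF elim(2)]
    have "exp (- lam * s) * J u s \<omega> = (B s \<omega> - B u \<omega>) - lam * \<delta> * I \<omega>"
      using ibp_exp_increment[OF c lam us] unfolding I_def f_def \<delta>_def by simp
    moreover have "Z s \<omega> = exp (- lam * s) * (L0 \<omega> + J 0 s \<omega>)" and Zu: "Z u \<omega> = exp (- lam * u) * (L0 \<omega> + J 0 u \<omega>)"
      using Z_eq[OF elim(2) s] Z_eq[OF elim(2) u] elim(1) by auto
    moreover have "J 0 s \<omega> = J 0 u \<omega> + J u s \<omega>" by (rule ibp_exp_combine[OF c u, symmetric]) (use us in auto)
    moreover have "exp (- lam * s) * (L0 \<omega> + J 0 u \<omega>) = exp (- lam * \<delta>) * Z u \<omega>"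
    proof -
      have "- lam * s = - lam * \<delta> + - lam * u" by (simp add: \<delta>_def algebra_simps)
      then have "exp (- lam * s) = exp (- lam * \<delta>) * exp (- lam * u)" by (simp only: exp_add)
      then show ?thesis unfolding Zu by simp
    qed
    ultimately have "Z s \<omega> = exp (- lam * \<delta>) * Z u \<omega> + ((B s \<omega> - B u \<omega>) - lam * \<delta> * I \<omega>)"
      by (metis add.assoc distrib_left)
    then have dec: "Z s \<omega> - Z u \<omega> = (B s \<omega> - B u \<omega>) + ((exp (- lam * \<delta>) - 1) * Z u \<omega> - lam * \<delta> * I \<omega>)" (is "_ = _ + ?y")
      by (simp add: algebra_simps)
    have e: "\<bar>exp (- lam * \<delta>) - 1\<bar> \<le> lam * \<delta>"
      using exp_ge_add_one_self[of "- lam * \<delta>"] lam \<delta> by (simp add: abs_if)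
    have "?y\<^sup>2 \<le> 2 * ((exp (- lam * \<delta>) - 1) * Z u \<omega>)\<^sup>2 + 2 * (lam * \<delta> * I \<omega>)\<^sup>2"
    proof -
      have "(x - y)\<^sup>2 \<le> 2 * x\<^sup>2 + 2 * y\<^sup>2" for x y :: real
        using zero_le_power2[of "x + y"] by (simp add: power2_sum power2_diff)
      then show ?thesis .
    qed
    also have "((exp (- lam * \<delta>) - 1) * Z u \<omega>)\<^sup>2 \<le> (lam * \<delta>)\<^sup>2 * (Z u \<omega>)\<^sup>2"
      unfolding power_mult_distrib[of "exp (- lam * \<delta>) - 1"]
      using power_mono[OF e, of 2] by (intro mult_right_mono) auto
    finally have "?y\<^sup>2 \<le> 2 * lam\<^sup>2 * \<delta>\<^sup>2 * ((Z u \<omega>)\<^sup>2 + (I \<omega>)\<^sup>2)"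
      by (simp add: power_mult_distrib algebra_simps)
    then have "?y\<^sup>2 / \<eta> \<le> 2 * lam\<^sup>2 * \<delta>\<^sup>2 * ((Z u \<omega>)\<^sup>2 + (I \<omega>)\<^sup>2) / \<eta>"
      using \<eta> by (intro divide_right_mono) auto
    then show ?case
      unfolding dec using square_add_lower[OF \<eta>, of "B s \<omega> - B u \<omega>" ?y] by simp
  qed
  have "(\<integral>\<omega>. (1 - \<eta>) * (B s \<omega> - B u \<omega>)\<^sup>2 - 2 * lam\<^sup>2 * \<delta>\<^sup>2 / \<eta> * ((Z u \<omega>)\<^sup>2 + (I \<omega>)\<^sup>2) \<partial>M) \<le> (\<integral>\<omega>. (Z s \<omega> - Z u \<omega>)\<^sup>2 \<partial>M)"
    using B_incr(1)[of s u] I2 Z_square_integrable[OF u]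
    by (intro integral_mono_AE pw Z_diff_square_integrable s u) auto
  also have "(\<integral>\<omega>. (1 - \<eta>) * (B s \<omega> - B u \<omega>)\<^sup>2 - 2 * lam\<^sup>2 * \<delta>\<^sup>2 / \<eta> * ((Z u \<omega>)\<^sup>2 + (I \<omega>)\<^sup>2) \<partial>M)
      = (1 - \<eta>) * \<delta> powr (2 * H) - 2 * lam\<^sup>2 * \<delta>\<^sup>2 / \<eta> * (R0 + (\<integral>\<omega>. (I \<omega>)\<^sup>2 \<partial>M))"
    using B_incr[of s u] I2 Z_square_integrable[OF u] Z_variance[OF u] us
    by (simp add: \<delta>_def)
  finally have main: "(1 - \<eta>) * \<delta> powr (2 * H) - 2 * lam\<^sup>2 * \<delta>\<^sup>2 / \<eta> * (R0 + (\<integral>\<omega>. (I \<omega>)\<^sup>2 \<partial>M)) \<le> (\<integral>\<omega>. (Z s \<omega> - Z u \<omega>)\<^sup>2 \<partial>M)" .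
  have "2 * lam\<^sup>2 * \<delta>\<^sup>2 / \<eta> * (R0 + (\<integral>\<omega>. (I \<omega>)\<^sup>2 \<partial>M)) \<le> 2 * lam\<^sup>2 * \<delta>\<^sup>2 / \<eta> * (R0 + \<delta> powr (2 * H))"
    using EI' \<eta> by (intro mult_left_mono) auto
  then show ?thesis using main unfolding \<delta>_def[symmetric] by simp
qed

lemma Z_increment_asymptotics:
  assumes \<epsilon>: "0 < \<epsilon>" "\<epsilon> < 1"
  shows "\<exists>d>0. \<forall>u\<ge>0. \<forall>s\<ge>0. \<bar>s - u\<bar> \<le> d \<longrightarrow> (\<integral>\<omega>. (Z s \<omega> - Z u \<omega>)\<^sup>2 \<partial>M) \<ge> (1 - \<epsilon>) * \<bar>s - u\<bar> powr (2 * H)"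
proof -
  define \<eta> where "\<eta> = \<epsilon> / 2"
  have \<eta>: "\<eta> > 0" using \<epsilon> by (simp add: \<eta>_def)
  define K where "K = 2 * lam\<^sup>2 * (R0 + 1) / \<eta>"
  have K: "K > 0" using lam R0_pos \<eta> by (simp add: K_def)
  define d where "d = min 1 (\<eta> / K)"
  have d: "d > 0" "d \<le> 1" "K * d \<le> \<eta>" using K \<eta> by (auto simp: d_def min_def field_simps)
  have main: "(\<integral>\<omega>. (Z s \<omega> - Z u \<omega>)\<^sup>2 \<partial>M) \<ge> (1 - \<epsilon>) * (s - u) powr (2 * H)" if u: "0 \<le> u" "u < s" "s - u \<le> d" for u s
  proof -
    let ?\<delta> = "s - u"
    have \<delta>: "0 < ?\<delta>" "?\<delta> \<le> 1" using u d by auto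
    have p1: "?\<delta> powr (2 * H) \<le> 1" using \<delta> H by (intro powr_le1) auto
    have "?\<delta>\<^sup>2 = ?\<delta> powr 2" using \<delta> powr_realpow[of ?\<delta> 2] by simp
    \<comment> \<open>Since H < 1/2, the exponent 1 + 2 H is at most 2. The factor
      \<open>?\<delta>\<close> gained over \<open>?\<delta> powr (2 * H)\<close> is bounded by
      \<open>d\<close>, and \<open>d\<close> was chosen with
      \<open>K * d \<le> \<eta>\<close>.\<close>
    also have "\<dots> \<le> ?\<delta> powr (1 + 2 * H)" using \<delta> H by (intro powr_mono') auto
    also have "\<dots> = ?\<delta> * ?\<delta> powr (2 * H)" using \<delta> by (simp add: powr_add)
    finally have p2: "?\<delta>\<^sup>2 \<le> ?\<delta> * ?\<delta> powr (2 * H)" .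
    have "2 * lam\<^sup>2 * ?\<delta>\<^sup>2 * (R0 + ?\<delta> powr (2 * H)) / \<eta> \<le> 2 * lam\<^sup>2 * ?\<delta>\<^sup>2 * (R0 + 1) / \<eta>"
      using p1 \<eta> by (intro divide_right_mono mult_left_mono) auto
    also have "\<dots> = K * ?\<delta>\<^sup>2" by (simp add: K_def)
    also have "\<dots> \<le> K * (?\<delta> * ?\<delta> powr (2 * H))" using K p2 by (intro mult_left_mono) auto
    also have "\<dots> \<le> K * d * ?\<delta> powr (2 * H)"
      unfolding mult.assoc[symmetric] using u K by (intro mult_right_mono mult_left_mono) auto
    also have "\<dots> \<le> \<eta> * ?\<delta> powr (2 * H)" using d by (intro mult_right_mono) auto
    finally have "2 * lam\<^sup>2 * ?\<delta>\<^sup>2 * (R0 + ?\<delta> powr (2 * H)) / \<eta> \<le> \<eta> * ?\<delta> powr (2 * H)" .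
    moreover have "(1 - \<epsilon>) * ?\<delta> powr (2 * H) = (1 - \<eta>) * ?\<delta> powr (2 * H) - \<eta> * ?\<delta> powr (2 * H)"
      by (simp add: \<eta>_def algebra_simps)
    ultimately show ?thesis using Z_increment_lower[OF u(1,2) \<eta>] by linarith
  qed
  show ?thesis
  proof (intro exI[of _ d] conjI allI impI d(1))
    fix u s :: real assume us: "u \<ge> 0" "s \<ge> 0" "\<bar>s - u\<bar> \<le> d"
    consider "u < s" | "s < u" | "s = u" by linarith
    then show "(\<integral>\<omega>. (Z s \<omega> - Z u \<omega>)\<^sup>2 \<partial>M) \<ge> (1 - \<epsilon>) * \<bar>s - u\<bar> powr (2 * H)"
    proof cases
      case 1 then show ?thesis using main[of u s] us by simp
    next
      case 2 then show ?thesis using main[of s u] us by (simp add: power2_commute)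
    next
      case 3 then show ?thesis by simp
    qed
  qed
qed

text \<open>By the parallelogram identity the variance of the sum is 4 R0 minus that of the
  increment, so the stationary variance and the increments determine the exponential moment and no
  covariance function is required.\<close>

lemma
  assumes "s \<ge> 0" "u \<ge> 0"
  shows exp_Z_integrable: "integrable M (\<lambda>\<omega>. exp (\<alpha> * Z s \<omega> + \<beta> * Z u \<omega>))"
    and exp_Z_sum: "(\<integral>\<omega>. exp (c * (Z s \<omega> + Z u \<omega>)) \<partial>M) = exp (c\<^sup>2 * (2 * R0 - (\<integral>\<omega>. (Z s \<omega> - Z u \<omega>)\<^sup>2 \<partial>M) / 2))"
proof -
  show "integrable M (\<lambda>\<omega>. exp (\<alpha> * Z s \<omega> + \<beta> * Z u \<omega>))"
    using Z_gaussian[OF assms, of \<alpha> \<beta>] centered_gaussian_exp_integrable[where c=1] by auto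
  obtain \<sigma> where \<sigma>: "centered_gaussian M \<sigma> (\<lambda>\<omega>. Z s \<omega> + Z u \<omega>)"
    using Z_gaussian[OF assms, of 1 1] by auto
  have "\<sigma>\<^sup>2 = (\<integral>\<omega>. (Z s \<omega> + Z u \<omega>)\<^sup>2 \<partial>M)" using centered_gaussian_variance[OF \<sigma>] by simp
  also have "\<dots> = (\<integral>\<omega>. 2 * (Z s \<omega>)\<^sup>2 + 2 * (Z u \<omega>)\<^sup>2 - (Z s \<omega> - Z u \<omega>)\<^sup>2 \<partial>M)"
    by (rule Bochner_Integration.integral_cong) (auto simp: power2_sum power2_diff)
  also have "\<dots> = 4 * R0 - (\<integral>\<omega>. (Z s \<omega> - Z u \<omega>)\<^sup>2 \<partial>M)"
    using Z_square_integrable[OF assms(1)] Z_square_integrable[OF assms(2)] Z_diff_square_integrable[OF assms]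
      Z_variance[OF assms(1)] Z_variance[OF assms(2)]
    by (subst Bochner_Integration.integral_diff) auto
  finally have "(c * \<sigma>)\<^sup>2 / 2 = c\<^sup>2 * (2 * R0 - (\<integral>\<omega>. (Z s \<omega> - Z u \<omega>)\<^sup>2 \<partial>M) / 2)"
    by (simp add: power_mult_distrib)
  then show "(\<integral>\<omega>. exp (c * (Z s \<omega> + Z u \<omega>)) \<partial>M) = exp (c\<^sup>2 * (2 * R0 - (\<integral>\<omega>. (Z s \<omega> - Z u \<omega>)\<^sup>2 \<partial>M) / 2))"
    using centered_gaussian_exp[OF \<sigma>, of c] by simp
qed

text \<open>With \<open>v = E (Z s - Z u)\<^sup>2\<close> the left-hand side is \<open>exp (2 c\<^sup>2 R0) (1 - exp (- c\<^sup>2 v / 2))\<close>.\<close>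

lemma exp_Z_covariance_gap:
  assumes \<epsilon>: "0 < \<epsilon>" "\<epsilon> < 1" and c: "c > 0"
  shows "\<exists>d>0. \<forall>u\<ge>0. \<forall>s\<ge>0. \<bar>s - u\<bar> \<le> d \<longrightarrow>
    exp (2 * c\<^sup>2 * R0) - (\<integral>\<omega>. exp (c * (Z s \<omega> + Z u \<omega>)) \<partial>M)
      \<ge> (1 - \<epsilon>) * exp (2 * c\<^sup>2 * R0) * (c\<^sup>2 / 2) * \<bar>s - u\<bar> powr (2 * H)"
proof -
  define e where "e = \<epsilon> / 2"
  have e: "0 < e" "e < 1" using \<epsilon> by (auto simp: e_def)
  obtain d0 where d0: "d0 > 0" and inc: "\<And>u s. u \<ge> 0 \<Longrightarrow> s \<ge> 0 \<Longrightarrow> \<bar>s - u\<bar> \<le> d0 \<Longrightarrow>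
      (\<integral>\<omega>. (Z s \<omega> - Z u \<omega>)\<^sup>2 \<partial>M) \<ge> (1 - e) * \<bar>s - u\<bar> powr (2 * H)"
    using Z_increment_asymptotics[OF e] by blast
  \<comment> \<open>Solves c^2/2 * d1^(2H) = e, so that the exponent below stays in [0, e].\<close>
  define d1 where "d1 = (2 * e / c\<^sup>2) powr (1 / (2 * H))"
  have d1: "d1 > 0" using e c by (simp add: d1_def)
  show ?thesis
  proof (intro exI[of _ "min d0 d1"] conjI allI impI)
    fix u s :: real assume us: "u \<ge> 0" "s \<ge> 0" "\<bar>s - u\<bar> \<le> min d0 d1"
    define p where "p = \<bar>s - u\<bar> powr (2 * H)"
    define v where "v = (\<integral>\<omega>. (Z s \<omega> - Z u \<omega>)\<^sup>2 \<partial>M)"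
    have p0: "p \<ge> 0" by (simp add: p_def)
    have "p \<le> d1 powr (2 * H)" unfolding p_def using us H by (intro powr_mono2) auto
    also have "\<dots> = 2 * e / c\<^sup>2" using H e c by (simp add: d1_def powr_powr)
    finally have pe: "c\<^sup>2 / 2 * p \<le> e" using c by (simp add: field_simps)
    define x where "x = c\<^sup>2 / 2 * ((1 - e) * p)"
    have x0: "x \<ge> 0" using e p0 by (simp add: x_def)
    have "c\<^sup>2 / 2 * ((1 - e) * p) \<le> c\<^sup>2 / 2 * (1 * p)"
      using e p0 by (intro mult_left_mono mult_right_mono) auto
    then have xe: "x \<le> e" using pe by (simp add: x_def)
    have "x \<le> c\<^sup>2 / 2 * v"
      unfolding x_def v_def p_def using inc[of u s] us by (intro mult_left_mono) auto
    then have "exp (- (c\<^sup>2 / 2 * v)) \<le> exp (- x)" by simp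
    \<comment> \<open>For 0 <= x <= e one has exp (- x) <= 1/(1 + x) <= 1 - (1 - e) x, a
      quantitative form of 1 - exp (- x) ~ x. The second factor 1 - e is the reason for halving
      \<open>\<epsilon>\<close>.\<close>
    also have "\<dots> \<le> 1 / (1 + x)"
      using exp_ge_add_one_self[of x] x0 by (simp add: exp_minus inverse_eq_divide frac_le)
    also have "\<dots> \<le> 1 - (1 - e) * x"
    proof -
      have "(1 - (1 - e) * x) * (1 + x) = 1 + x * (e - (1 - e) * x)" by (simp add: algebra_simps)
      moreover have "(1 - e) * x \<le> 1 * x" using x0 e by (intro mult_right_mono) auto
      then have "x * (e - (1 - e) * x) \<ge> 0" using x0 xe by (intro mult_nonneg_nonneg) auto
      ultimately have "1 \<le> (1 - (1 - e) * x) * (1 + x)" by linarith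
      then show ?thesis using x0 by (simp add: divide_le_eq)
    qed
    finally have g: "1 - exp (- (c\<^sup>2 / 2 * v)) \<ge> (1 - e) * x" by simp
    have "(1 - \<epsilon>) * (c\<^sup>2 / 2 * p) \<le> ((1 - e) * (1 - e)) * (c\<^sup>2 / 2 * p)"
      using p0 c by (intro mult_right_mono) (auto simp: e_def algebra_simps)
    also have "\<dots> = (1 - e) * x" by (simp add: x_def)
    finally have "(1 - \<epsilon>) * (c\<^sup>2 / 2 * p) \<le> 1 - exp (- (c\<^sup>2 / 2 * v))" using g by linarith
    then have "exp (2 * c\<^sup>2 * R0) * ((1 - \<epsilon>) * (c\<^sup>2 / 2 * p)) \<le> exp (2 * c\<^sup>2 * R0) * (1 - exp (- (c\<^sup>2 / 2 * v)))"
      by (intro mult_left_mono) auto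
    also have "\<dots> = exp (2 * c\<^sup>2 * R0) - (\<integral>\<omega>. exp (c * (Z s \<omega> + Z u \<omega>)) \<partial>M)"
      unfolding exp_Z_sum[OF us(2,1)] v_def[symmetric] by (simp add: right_diff_distrib exp_add[symmetric] algebra_simps)
    finally show "exp (2 * c\<^sup>2 * R0) - (\<integral>\<omega>. exp (c * (Z s \<omega> + Z u \<omega>)) \<partial>M)
      \<ge> (1 - \<epsilon>) * exp (2 * c\<^sup>2 * R0) * (c\<^sup>2 / 2) * \<bar>s - u\<bar> powr (2 * H)"
      by (simp add: p_def mult_ac)
  qed (use d0 d1 in auto)
qed

end

section \<open>Brownian bridges on the observation grid\<close>

context prob_space
begin

section \<open>Square-integrable random variables and orthogonality in the limit\<close>

definition L2 :: "('a \<Rightarrow> real) \<Rightarrow> bool" where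
  "L2 X \<longleftrightarrow> X \<in> borel_measurable M \<and> integrable M (\<lambda>\<omega>. (X \<omega>)\<^sup>2)"

lemma L2_measurable: "L2 X \<Longrightarrow> X \<in> borel_measurable M"
  and L2_square: "L2 X \<Longrightarrow> integrable M (\<lambda>\<omega>. (X \<omega>)\<^sup>2)"
  by (auto simp: L2_def)

lemma L2_add: "L2 X \<Longrightarrow> L2 Y \<Longrightarrow> L2 (\<lambda>\<omega>. X \<omega> + Y \<omega>)"
  by (auto simp: L2_def intro: square_integrable_add)

lemma L2_diff: "L2 X \<Longrightarrow> L2 Y \<Longrightarrow> L2 (\<lambda>\<omega>. X \<omega> - Y \<omega>)"
  by (auto simp: L2_def intro: square_integrable_diff)

lemma L2_cmult: "L2 X \<Longrightarrow> L2 (\<lambda>\<omega>. k * X \<omega>)"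
  unfolding L2_def using square_integrable_cmult[of M X k] by auto

lemma L2_sum: "finite I \<Longrightarrow> (\<And>i. i \<in> I \<Longrightarrow> L2 (X i)) \<Longrightarrow> L2 (\<lambda>\<omega>. \<Sum>i\<in>I. X i \<omega>)"
  by (auto simp: L2_def intro!: square_integrable_sum borel_measurable_sum)

lemma L2_mult: "L2 X \<Longrightarrow> L2 Y \<Longrightarrow> integrable M (\<lambda>\<omega>. X \<omega> * Y \<omega>)"
  by (auto simp: L2_def intro: integrable_mult_square)

lemma L2_bounded:
  assumes [measurable]: "X \<in> borel_measurable M" and "\<And>\<omega>. \<bar>X \<omega>\<bar> \<le> 1"
  shows "L2 X"
  unfolding L2_def
  by (intro conjI assms(1) integrable_const_bound[of _ 1]) (use assms in \<open>auto simp: power2_le_iff_abs_le abs_square_le_1\<close>)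

text \<open>Weighted arithmetic-geometric mean in the role of Cauchy-Schwarz: linear in both second
  moments, with a weight \<open>K\<close> that can be tuned to put a small factor on either of
  them.\<close>

lemma L2_mult_bound:
  assumes X: "L2 X" and Y: "L2 Y" and K: "K > 0"
  shows "2 * \<bar>\<integral>\<omega>. X \<omega> * Y \<omega> \<partial>M\<bar> \<le> K * (\<integral>\<omega>. (X \<omega>)\<^sup>2 \<partial>M) + (\<integral>\<omega>. (Y \<omega>)\<^sup>2 \<partial>M) / K"
proof -
  have bound: "2 * s * (\<integral>\<omega>. X \<omega> * Y \<omega> \<partial>M) \<le> K * (\<integral>\<omega>. (X \<omega>)\<^sup>2 \<partial>M) + (\<integral>\<omega>. (Y \<omega>)\<^sup>2 \<partial>M) / K" if s: "s\<^sup>2 = 1" for s :: real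
  proof -
    have "(\<integral>\<omega>. 2 * s * (X \<omega> * Y \<omega>) \<partial>M) \<le> (\<integral>\<omega>. K * (X \<omega>)\<^sup>2 + (Y \<omega>)\<^sup>2 / K \<partial>M)"
    proof (rule integral_mono)
      show "2 * s * (X \<omega> * Y \<omega>) \<le> K * (X \<omega>)\<^sup>2 + (Y \<omega>)\<^sup>2 / K" for \<omega>
      proof -
        have "0 \<le> (K * X \<omega> - s * Y \<omega>)\<^sup>2 / K" using K by simp
        also have "\<dots> = K * (X \<omega>)\<^sup>2 + s\<^sup>2 * (Y \<omega>)\<^sup>2 / K - 2 * s * (X \<omega> * Y \<omega>)"
          using K by (simp add: power2_eq_square field_simps)
        finally show ?thesis by (simp add: s)
      qed
    qed (use L2_mult[OF X Y] L2_square[OF X] L2_square[OF Y] in auto)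
    then show ?thesis using L2_mult[OF X Y] L2_square[OF X] L2_square[OF Y] by simp
  qed
  show ?thesis using bound[of 1] bound[of "-1"] by (simp add: abs_if)
qed

lemma L2_limit_orthogonal:
  assumes X: "\<And>k. L2 (X k)" and X': "L2 X'" and Z: "L2 Z"
    and orth: "\<And>k. (\<integral>\<omega>. X k \<omega> * Z \<omega> \<partial>M) = 0"
    and lim: "(\<lambda>k. \<integral>\<omega>. (X k \<omega> - X' \<omega>)\<^sup>2 \<partial>M) \<longlonglongrightarrow> 0"
  shows "(\<integral>\<omega>. X' \<omega> * Z \<omega> \<partial>M) = 0"
proof (rule ccontr)
  let ?x = "\<integral>\<omega>. X' \<omega> * Z \<omega> \<partial>M" and ?z = "\<integral>\<omega>. (Z \<omega>)\<^sup>2 \<partial>M"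
  assume "?x \<noteq> 0"
  \<comment> \<open>Makes \<open>?z / K\<close> smaller than |x| for x = \<open>?x\<close>, whereas
    the limit forces 2 |x| <= \<open>?z / K\<close>. The summand 1 keeps \<open>K\<close> positive
    when \<open>Z\<close> vanishes.\<close>
  define K where "K = (?z + 1) / \<bar>?x\<bar>"
  have z: "?z \<ge> 0" by simp
  then have K: "K > 0" using \<open>?x \<noteq> 0\<close> unfolding K_def by (intro divide_pos_pos add_nonneg_pos) auto
  have "2 * \<bar>?x\<bar> \<le> K * (\<integral>\<omega>. (X k \<omega> - X' \<omega>)\<^sup>2 \<partial>M) + ?z / K" for k
  proof -
    have "(\<integral>\<omega>. (X k \<omega> - X' \<omega>) * Z \<omega> \<partial>M) = - ?x"
      using L2_mult[OF X Z] L2_mult[OF X' Z] orth by (simp add: left_diff_distrib)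
    then show ?thesis using L2_mult_bound[OF L2_diff[OF X X'] Z K, of k] by simp
  qed
  moreover have "(\<lambda>k. K * (\<integral>\<omega>. (X k \<omega> - X' \<omega>)\<^sup>2 \<partial>M) + ?z / K) \<longlonglongrightarrow> K * 0 + ?z / K"
    by (intro tendsto_intros lim)
  ultimately have "2 * \<bar>?x\<bar> \<le> K * 0 + ?z / K"
    by (intro LIMSEQ_le_const) auto
  also have "\<dots> = ?z / (?z + 1) * \<bar>?x\<bar>" by (simp add: K_def)
  also have "\<dots> \<le> 1 * \<bar>?x\<bar>"
  proof (rule mult_right_mono)
    have "y / (y + 1) \<le> 1" if "y \<ge> 0" for y :: real using that by simp
    then show "?z / (?z + 1) \<le> 1" using z .
  qed simp
  finally show False using \<open>?x \<noteq> 0\<close> by simp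
qed

lemma indep_sigma_integral:
  fixes f g :: "'a \<Rightarrow> real"
  assumes ind: "indep_set (sets F) (sets G)" and sp: "space F = space M" "space G = space M"
    and f: "f \<in> borel_measurable F" "integrable M f" and g: "g \<in> borel_measurable G" "integrable M g"
  shows "(\<integral>\<omega>. f \<omega> * g \<omega> \<partial>M) = (\<integral>\<omega>. f \<omega> \<partial>M) * (\<integral>\<omega>. g \<omega> \<partial>M)"
proof -
  have sub: "sigma_sets (space M) {h -` A \<inter> space M |A. A \<in> sets borel} \<subseteq> sets N"
    if "space N = space M" "h \<in> borel_measurable N" for h :: "'a \<Rightarrow> real" and N
    unfolding that(1)[symmetric] by (intro sets.sigma_sets_subset) (auto intro: measurable_sets that)
  have "indep_set (sigma_sets (space M) {f -` A \<inter> space M |A. A \<in> sets borel})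
      (sigma_sets (space M) {g -` A \<inter> space M |A. A \<in> sets borel})"
    by (rule indep_setI)
      (use sub[OF sp(1) f(1)] sub[OF sp(2) g(1)] indep_setD[OF ind] indep_setD_ev1[OF ind] indep_setD_ev2[OF ind] in blast)+
  then have "indep_var borel f borel g"
    unfolding indep_var_eq using f g by auto
  then show ?thesis by (rule indep_var_lebesgue_integral) (use f g in auto)
qed

end

section \<open>The volatility model with its two stochastic integrals\<close>

locale rough_vol = gaussian_model +
  fixes mu theta rho T :: real and IV IW :: "'a \<Rightarrow> real"
  assumes theta: "theta > 0" and rho: "-1 < rho" "rho < 1" and T: "T > 0"
    and indepVW: "indep_set (sets (gen_sigma M (V ` {0..}))) (sets (gen_sigma M (W ` {0..})))"
    and indepBW: "indep_set (sets (gen_sigma M (range B))) (sets (gen_sigma M (W ` {0..})))"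
    and IV: "has_ito_integral M (\<lambda>s \<omega>. exp (fOU mu theta lam B s \<omega>)) V T IV"
    and IW: "has_ito_integral M (\<lambda>s \<omega>. exp (fOU mu theta lam B s \<omega>)) W T IW"
begin

abbreviation Y :: "real \<Rightarrow> 'a \<Rightarrow> real" where
  "Y \<equiv> fOU mu theta lam B"

abbreviation sigmaW :: "'a measure" where
  "sigmaW \<equiv> gen_sigma M (W ` {0..})"

text \<open>The second moment of exp (Y s), the same for all s >= 0 by stationarity. It supplies the
  factors exp (2 mu) and exp (2 R_Y(0)) of the final constant.\<close>

definition w0 :: real where
  "w0 = exp (2 * mu) * exp (2 * theta\<^sup>2 * R0)"

lemma Y_sigmaB: "t \<ge> 0 \<Longrightarrow> Y t \<in> borel_measurable sigmaB"
  using Z_sigmaB[of t] by (simp add: fOU_eq[abs_def])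

lemma Y_measurable: "t \<ge> 0 \<Longrightarrow> Y t \<in> borel_measurable M"
  using measurable_from_subalg[OF subalgebra_sigmaB Y_sigmaB] .

lemma exp_Y_integrable:
  assumes "s \<ge> 0" "u \<ge> 0"
  shows "integrable M (\<lambda>\<omega>. exp (\<alpha> * Y s \<omega> + \<beta> * Y u \<omega>))"
proof -
  have "\<alpha> * Y s \<omega> + \<beta> * Y u \<omega> = (\<alpha> + \<beta>) * mu + ((\<alpha> * theta) * Z s \<omega> + (\<beta> * theta) * Z u \<omega>)" for \<omega>
    by (simp add: fOU_eq algebra_simps)
  then show ?thesis
    using exp_Z_integrable[OF assms, of "\<alpha> * theta" "\<beta> * theta"] by (simp add: exp_add)
qed

lemma exp_Y_integral:
  "(\<integral>\<omega>. exp (Y s \<omega> + Y u \<omega>) \<partial>M) = exp (2 * mu) * (\<integral>\<omega>. exp (theta * (Z s \<omega> + Z u \<omega>)) \<partial>M)"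
proof -
  have "Y s \<omega> + Y u \<omega> = 2 * mu + theta * (Z s \<omega> + Z u \<omega>)" for \<omega>
    by (simp add: fOU_eq algebra_simps)
  then show ?thesis by (simp add: exp_add)
qed

lemma exp_Y_same: "s \<ge> 0 \<Longrightarrow> (\<integral>\<omega>. exp (Y s \<omega> + Y s \<omega>) \<partial>M) = w0"
  unfolding exp_Y_integral using exp_Z_sum[of s s theta] by (simp add: w0_def mult_ac)

lemma lin_L2: "X \<in> lin \<Longrightarrow> L2 X"
  using lin_gaussian[of X] centered_gaussian_power_integrable[of M _ X 2]
  by (auto simp: L2_def intro: centered_gaussian_measurable)

text \<open>\<open>X\<close> may involve V, which can be correlated with Y, so the product is not
  split by independence; fourth moments of both factors suffice.\<close>

lemma exp_Y_lin_L2: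
  assumes X: "X \<in> lin" and s: "s \<ge> 0"
  shows "L2 (\<lambda>\<omega>. exp (Y s \<omega>) * X \<omega>)"
proof -
  note [measurable] = Y_measurable[OF s] L2_measurable[OF lin_L2[OF X]]
  have 1: "integrable M (\<lambda>\<omega>. (exp (2 * Y s \<omega>))\<^sup>2)"
    using exp_Y_integrable[OF s s, of 4 0] by (simp add: power2_eq_square exp_add[symmetric])
  have 2: "integrable M (\<lambda>\<omega>. ((X \<omega>)\<^sup>2)\<^sup>2)"
    using lin_gaussian[OF X] centered_gaussian_power_integrable[of M _ X 4] by (auto simp: power_mult[symmetric])
  have "integrable M (\<lambda>\<omega>. exp (2 * Y s \<omega>) * (X \<omega>)\<^sup>2)"
    by (intro integrable_mult_square 1 2) measurable
  then show ?thesis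
    by (simp add: L2_def power_mult_distrib power2_eq_square[of "exp _"] exp_add[symmetric])
qed

text \<open>A single flat index for all pieces: piece \<open>i\<close> lies in observation interval
  \<open>i div m\<close>, and index \<open>k * m\<close> is the k-th observation time.\<close>

definition fine_time :: "nat \<Rightarrow> nat \<Rightarrow> nat \<Rightarrow> real" where
  "fine_time n m i = real i * T / (real n * real m)"

lemma fine_time_nonneg [simp]: "fine_time n m i \<ge> 0"
  using T by (simp add: fine_time_def)

lemma fine_time_block: "m > 0 \<Longrightarrow> fine_time n m (k * m) = real k * T / real n"
  by (simp add: fine_time_def)

definition fine_incr :: "nat \<Rightarrow> nat \<Rightarrow> nat \<Rightarrow> 'a \<Rightarrow> real" where
  "fine_incr n m i \<omega> = W (fine_time n m (Suc i)) \<omega> - W (fine_time n m i) \<omega>"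

definition block_incr :: "nat \<Rightarrow> nat \<Rightarrow> nat \<Rightarrow> 'a \<Rightarrow> real" where
  "block_incr n m b \<omega> = W (fine_time n m (Suc b * m)) \<omega> - W (fine_time n m (b * m)) \<omega>"

text \<open>An increment of the Brownian bridge that W performs between neighbouring observation
  times: the fine increment minus its regression on the observed values. The regression weight is
  \<open>1 / real m\<close> because the \<open>m\<close> pieces have equal length.\<close>

definition bridge :: "nat \<Rightarrow> nat \<Rightarrow> nat \<Rightarrow> 'a \<Rightarrow> real" where
  "bridge n m i \<omega> = fine_incr n m i \<omega> - block_incr n m (i div m) \<omega> / real m"

lemma fine_incr_lin: "fine_incr n m i \<in> lin"
  unfolding fine_incr_def[abs_def] by (intro lin_diff lin_W) auto

lemma block_incr_lin: "block_incr n m b \<in> lin"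
  unfolding block_incr_def[abs_def] by (intro lin_diff lin_W) auto

lemma bridge_lin: "bridge n m i \<in> lin"
  using lin_diff[OF fine_incr_lin lin_cmult[OF block_incr_lin, of "1 / real m"]] by (simp add: bridge_def[abs_def])

lemma W_sigmaW: "t \<ge> 0 \<Longrightarrow> W t \<in> borel_measurable sigmaW"
  by (rule measurable_gen_sigma) auto

lemma bridge_sigmaW: "bridge n m i \<in> borel_measurable sigmaW"
proof -
  have [measurable]: "W (fine_time n m j) \<in> borel_measurable sigmaW" for j by (rule W_sigmaW) simp
  show ?thesis unfolding bridge_def[abs_def] fine_incr_def block_incr_def by measurable
qed

lemma lin_mult_integrable: "X \<in> lin \<Longrightarrow> X' \<in> lin \<Longrightarrow> integrable M (\<lambda>\<omega>. X \<omega> * X' \<omega>)"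
  by (intro L2_mult lin_L2)

lemma W_fine_cov: "(\<integral>\<omega>. W (fine_time n m i) \<omega> * W (fine_time n m j) \<omega> \<partial>M) = real (min i j) * (T / (real n * real m))"
proof -
  have "min (fine_time n m i) (fine_time n m j) = real (min i j) * (T / (real n * real m))"
  proof (cases "i \<le> j")
    case True
    then have "fine_time n m i \<le> fine_time n m j" using T by (simp add: fine_time_def divide_right_mono mult_right_mono)
    then show ?thesis using True by (simp add: fine_time_def)
  next
    case False
    then have "fine_time n m j \<le> fine_time n m i" using T by (simp add: fine_time_def divide_right_mono mult_right_mono)
    then show ?thesis using False by (simp add: fine_time_def)
  qed
  then show ?thesis using W_cov(2)[of "fine_time n m i" "fine_time n m j"] by simp
qed

lemma fine_incr_W_cov: "(\<integral>\<omega>. fine_incr n m i \<omega> * W (fine_time n m j) \<omega> \<partial>M) = of_bool (i < j) * (T / (real n * real m))"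
proof -
  have "(\<integral>\<omega>. fine_incr n m i \<omega> * W (fine_time n m j) \<omega> \<partial>M)
      = (\<integral>\<omega>. W (fine_time n m (Suc i)) \<omega> * W (fine_time n m j) \<omega> \<partial>M) - (\<integral>\<omega>. W (fine_time n m i) \<omega> * W (fine_time n m j) \<omega> \<partial>M)"
    unfolding fine_incr_def left_diff_distrib
    by (intro Bochner_Integration.integral_diff W_cov) auto
  also have "\<dots> = (real (min (Suc i) j) - real (min i j)) * (T / (real n * real m))"
    unfolding W_fine_cov by (rule left_diff_distrib[symmetric])
  also have "real (min (Suc i) j) - real (min i j) = of_bool (i < j)" by auto
  finally show ?thesis .
qed

lemma bridge_fine_incr_cov:
  assumes m: "m > 0"
  shows "(\<integral>\<omega>. bridge n m i \<omega> * fine_incr n m j \<omega> \<partial>M)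
    = (of_bool (i = j) - of_bool (i div m = j div m) / real m) * (T / (real n * real m))"
proof -
  let ?h = "T / (real n * real m)"
  have dd: "(\<integral>\<omega>. fine_incr n m i \<omega> * fine_incr n m j \<omega> \<partial>M) = of_bool (i = j) * ?h"
  proof -
    have "(\<integral>\<omega>. fine_incr n m i \<omega> * fine_incr n m j \<omega> \<partial>M)
        = (\<integral>\<omega>. fine_incr n m i \<omega> * W (fine_time n m (Suc j)) \<omega> \<partial>M) - (\<integral>\<omega>. fine_incr n m i \<omega> * W (fine_time n m j) \<omega> \<partial>M)"
      unfolding fine_incr_def[of n m j] right_diff_distrib
      by (intro Bochner_Integration.integral_diff lin_mult_integrable fine_incr_lin lin_W) auto
    then show ?thesis unfolding fine_incr_W_cov by auto
  qed
  have bd: "(\<integral>\<omega>. block_incr n m b \<omega> * fine_incr n m j \<omega> \<partial>M) = of_bool (b = j div m) * ?h" for b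
  proof -
    have "(\<integral>\<omega>. block_incr n m b \<omega> * fine_incr n m j \<omega> \<partial>M)
        = (\<integral>\<omega>. fine_incr n m j \<omega> * W (fine_time n m (Suc b * m)) \<omega> \<partial>M) - (\<integral>\<omega>. fine_incr n m j \<omega> * W (fine_time n m (b * m)) \<omega> \<partial>M)"
      unfolding block_incr_def left_diff_distrib mult.commute[of "W _ _" "fine_incr _ _ _ _"]
      by (intro Bochner_Integration.integral_diff lin_mult_integrable fine_incr_lin lin_W) auto
    also have "\<dots> = (of_bool (j < Suc b * m) - of_bool (j < b * m)) * ?h"
      unfolding fine_incr_W_cov by (simp add: left_diff_distrib)
    also have "of_bool (j < Suc b * m) - of_bool (j < b * m) = (of_bool (b = j div m) :: real)"
    proof -
      have "j < Suc b * m \<longleftrightarrow> j div m < Suc b" "j < b * m \<longleftrightarrow> j div m < b"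
        using m by (simp_all add: div_less_iff_less_mult del: mult_Suc)
      then show ?thesis by auto
    qed
    finally show ?thesis .
  qed
  have "(\<integral>\<omega>. bridge n m i \<omega> * fine_incr n m j \<omega> \<partial>M)
      = (\<integral>\<omega>. fine_incr n m i \<omega> * fine_incr n m j \<omega> - (block_incr n m (i div m) \<omega> * fine_incr n m j \<omega>) / real m \<partial>M)"
    by (simp add: bridge_def left_diff_distrib)
  also have "\<dots> = (\<integral>\<omega>. fine_incr n m i \<omega> * fine_incr n m j \<omega> \<partial>M) - (\<integral>\<omega>. block_incr n m (i div m) \<omega> * fine_incr n m j \<omega> \<partial>M) / real m"
    using lin_mult_integrable[OF fine_incr_lin fine_incr_lin, of n m i n m j] lin_mult_integrable[OF block_incr_lin fine_incr_lin, of n m "i div m" n m j] by simp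
  finally have "(\<integral>\<omega>. bridge n m i \<omega> * fine_incr n m j \<omega> \<partial>M) = of_bool (i = j) * ?h - of_bool (i div m = j div m) * ?h / real m"
    unfolding dd bd .
  also have "\<dots> = (of_bool (i = j) - of_bool (i div m = j div m) / real m) * ?h"
    by (simp only: left_diff_distrib times_divide_eq_left)
  finally show ?thesis .
qed

text \<open>With an observed value at a later time the fine increment has covariance h, the length
  of a piece, and the surrounding block increment has \<open>m\<close> times h; with an earlier one
  both are uncorrelated. Subtracting the m-th part of the block cancels in either case.\<close>

lemma bridge_grid_cov:
  assumes m: "m > 0"
  shows "(\<integral>\<omega>. bridge n m i \<omega> * W (fine_time n m (k * m)) \<omega> \<partial>M) = 0"
proof -
  let ?h = "T / (real n * real m)" and ?W = "W (fine_time n m (k * m))"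
  have W: "?W \<in> lin" by (intro lin_W) simp
  have b: "(\<integral>\<omega>. block_incr n m b \<omega> * ?W \<omega> \<partial>M) = of_bool (b < k) * (real m * ?h)" for b
  proof -
    have "(\<integral>\<omega>. block_incr n m b \<omega> * ?W \<omega> \<partial>M)
        = (\<integral>\<omega>. W (fine_time n m (Suc b * m)) \<omega> * ?W \<omega> \<partial>M) - (\<integral>\<omega>. W (fine_time n m (b * m)) \<omega> * ?W \<omega> \<partial>M)"
      unfolding block_incr_def left_diff_distrib
      by (intro Bochner_Integration.integral_diff lin_mult_integrable lin_W W) auto
    also have "\<dots> = (real (min (Suc b * m) (k * m)) - real (min (b * m) (k * m))) * ?h"
      unfolding W_fine_cov by (rule left_diff_distrib[symmetric])
    also have "real (min (Suc b * m) (k * m)) - real (min (b * m) (k * m)) = of_bool (b < k) * real m"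
    proof (cases "b < k")
      case True
      then have "Suc b * m \<le> k * m" "b * m \<le> k * m" by (auto intro: mult_right_mono simp del: mult_Suc)
      then show ?thesis using True by (simp add: min_def algebra_simps)
    next
      case False
      then have "k * m \<le> Suc b * m" "k * m \<le> b * m" by (auto intro: mult_right_mono simp del: mult_Suc)
      then show ?thesis using False by (simp add: min_absorb2 del: mult_Suc)
    qed
    finally show ?thesis by simp
  qed
  have "(\<integral>\<omega>. bridge n m i \<omega> * ?W \<omega> \<partial>M)
      = (\<integral>\<omega>. fine_incr n m i \<omega> * ?W \<omega> - (block_incr n m (i div m) \<omega> * ?W \<omega>) / real m \<partial>M)"
    by (simp add: bridge_def left_diff_distrib)
  also have "\<dots> = (\<integral>\<omega>. fine_incr n m i \<omega> * ?W \<omega> \<partial>M) - (\<integral>\<omega>. block_incr n m (i div m) \<omega> * ?W \<omega> \<partial>M) / real m"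
    using lin_mult_integrable[OF fine_incr_lin W, of n m i] lin_mult_integrable[OF block_incr_lin W, of n m "i div m"] by simp
  also have "\<dots> = 0"
    unfolding fine_incr_W_cov b using m by (simp add: div_less_iff_less_mult)
  finally show ?thesis .
qed

text \<open>The subtracted block increment is a combination of observed values and does not
  contribute. Inside one block the matrix is, up to the length of a piece, the projection onto
  vectors of sum zero.\<close>

lemma bridge_cov:
  assumes m: "m > 0"
  shows "(\<integral>\<omega>. bridge n m i \<omega> * bridge n m j \<omega> \<partial>M)
    = (of_bool (i = j) - of_bool (i div m = j div m) / real m) * (T / (real n * real m))"
proof -
  let ?b = "j div m"
  have blk0: "(\<integral>\<omega>. bridge n m i \<omega> * block_incr n m ?b \<omega> \<partial>M) = 0"
  proof -
    have "(\<integral>\<omega>. bridge n m i \<omega> * block_incr n m ?b \<omega> \<partial>M)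
      = (\<integral>\<omega>. bridge n m i \<omega> * W (fine_time n m (Suc ?b * m)) \<omega> \<partial>M) - (\<integral>\<omega>. bridge n m i \<omega> * W (fine_time n m (?b * m)) \<omega> \<partial>M)"
      unfolding block_incr_def right_diff_distrib
      by (intro Bochner_Integration.integral_diff lin_mult_integrable bridge_lin lin_W) auto
    then show ?thesis unfolding bridge_grid_cov[OF m] by simp
  qed
  have "(\<integral>\<omega>. bridge n m i \<omega> * bridge n m j \<omega> \<partial>M) = (\<integral>\<omega>. bridge n m i \<omega> * fine_incr n m j \<omega> - (bridge n m i \<omega> * block_incr n m ?b \<omega>) / real m \<partial>M)"
    unfolding bridge_def[of n m j] by (simp add: right_diff_distrib)
  also have "\<dots> = (\<integral>\<omega>. bridge n m i \<omega> * fine_incr n m j \<omega> \<partial>M) - (\<integral>\<omega>. bridge n m i \<omega> * block_incr n m ?b \<omega> \<partial>M) / real m"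
    using lin_mult_integrable[OF bridge_lin fine_incr_lin, of n m i n m j] lin_mult_integrable[OF bridge_lin block_incr_lin, of n m i n m ?b] by simp
  finally show ?thesis unfolding blk0 bridge_fine_incr_cov[OF m] by simp
qed

text \<open>The information that makes everything but the Brownian bridges of \<open>W\<close> known.\<close>

definition known :: "nat \<Rightarrow> 'a measure" where
  "known n = gen_sigma M (range B \<union> V ` {0..} \<union> (\<lambda>k. W (real k * T / real n)) ` UNIV)"

lemma space_known [simp]: "space (known n) = space M"
  by (simp add: known_def)

lemma known_lin: "X \<in> range B \<union> V ` {0..} \<union> (\<lambda>k. W (real k * T / real n)) ` UNIV \<Longrightarrow> X \<in> lin"
  using T by (auto intro!: lin_B lin_V lin_W)

lemma subalgebra_known: "subalgebra M (known n)"
  unfolding known_def using known_lin by (intro gen_sigma_subalgebra) (blast intro: L2_measurable lin_L2)+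

lemma sigmaB_known: "f \<in> borel_measurable sigmaB \<Longrightarrow> f \<in> borel_measurable (known n)"
proof -
  have "subalgebra (known n) sigmaB"
    by (rule gen_sigma_subalgebra) (auto simp: known_def intro!: measurable_gen_sigma)
  then show "f \<in> borel_measurable sigmaB \<Longrightarrow> f \<in> borel_measurable (known n)" by (rule measurable_from_subalg)
qed

lemma V_known: "t \<ge> 0 \<Longrightarrow> V t \<in> borel_measurable (known n)"
  unfolding known_def by (rule measurable_gen_sigma) auto

lemma W_known: "W (real k * T / real n) \<in> borel_measurable (known n)"
  unfolding known_def by (rule measurable_gen_sigma) auto

lemma lin_mean_zero: "X \<in> lin \<Longrightarrow> integrable M X \<and> (\<integral>\<omega>. X \<omega> \<partial>M) = 0"
proof -
  assume X: "X \<in> lin"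
  then obtain \<sigma> where \<sigma>: "centered_gaussian M \<sigma> X" using lin_gaussian by blast
  have "integrable M X" using lin_L2[OF X] by (auto simp: L2_def intro: integrable_of_square)
  moreover have "(\<integral>\<omega>. X \<omega> \<partial>M) = 0"
    using centered_gaussian_integral[OF \<sigma>, of "\<lambda>x. x"] integral_std_normal_distribution_moment_odd[of 1] by simp
  ultimately show "integrable M X \<and> (\<integral>\<omega>. X \<omega> \<partial>M) = 0" by blast
qed

lemma bridge_orthogonal_known:
  assumes m: "m > 0" and A: "A \<in> sets (known n)"
  shows "(\<integral>\<omega>. bridge n m i \<omega> * indicator A \<omega> \<partial>M) = 0"
proof (rule gaussian_orthogonal_gen_sigma[OF _ _ A[unfolded known_def]])
  fix J :: "('a \<Rightarrow> real) set" and a u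
  assume "finite J" "J \<subseteq> range B \<union> V ` {0..} \<union> range (\<lambda>k. W (real k * T / real n))"
  then show "\<exists>\<sigma>. centered_gaussian M \<sigma> (\<lambda>\<omega>. u * bridge n m i \<omega> + (\<Sum>X\<in>J. a X * X \<omega>))"
    by (intro lin_gaussian lin_add lin_cmult lin_sum bridge_lin) (auto intro: known_lin[of _ n])
next
  fix X assume X: "X \<in> range B \<union> V ` {0..} \<union> range (\<lambda>k. W (real k * T / real n))"
  note U0 = lin_mean_zero[OF bridge_lin, of n m i] and X0 = lin_mean_zero[OF known_lin[OF X]]
  from X consider "X \<in> range B" | "X \<in> V ` {0..}" | k where "X = W (real k * T / real n)" by auto
  then show "(\<integral>\<omega>. bridge n m i \<omega> * X \<omega> \<partial>M) = 0"
  proof cases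
    case 1
    then have "(\<integral>\<omega>. X \<omega> * bridge n m i \<omega> \<partial>M) = (\<integral>\<omega>. X \<omega> \<partial>M) * (\<integral>\<omega>. bridge n m i \<omega> \<partial>M)"
      by (intro indep_sigma_integral[OF indepBW] bridge_sigmaW) (use U0 X0 in \<open>auto intro: measurable_gen_sigma\<close>)
    then show ?thesis using U0 by (simp add: mult.commute)
  next
    case 2
    then have "(\<integral>\<omega>. X \<omega> * bridge n m i \<omega> \<partial>M) = (\<integral>\<omega>. X \<omega> \<partial>M) * (\<integral>\<omega>. bridge n m i \<omega> \<partial>M)"
      by (intro indep_sigma_integral[OF indepVW] bridge_sigmaW) (use U0 X0 in \<open>auto intro: measurable_gen_sigma\<close>)
    then show ?thesis using U0 by (simp add: mult.commute)
  next
    case 3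
    then show ?thesis using bridge_grid_cov[OF m, of n i k] by (simp add: fine_time_block[OF m])
  qed
qed

section \<open>Sums weighted by the volatility and their second moments\<close>

definition bridge_sum :: "nat \<Rightarrow> nat \<Rightarrow> 'a \<Rightarrow> real" where
  "bridge_sum n m \<omega> = (\<Sum>i<n * m. exp (Y (fine_time n m i) \<omega>) * bridge n m i \<omega>)"

definition riemann_W :: "nat \<Rightarrow> nat \<Rightarrow> 'a \<Rightarrow> real" where
  "riemann_W n m \<omega> = (\<Sum>i<n * m. exp (Y (fine_time n m i) \<omega>) * fine_incr n m i \<omega>)"

definition riemann_V :: "nat \<Rightarrow> nat \<Rightarrow> 'a \<Rightarrow> real" where
  "riemann_V n m \<omega> = (\<Sum>i<n * m. exp (Y (fine_time n m i) \<omega>) * (V (fine_time n m (Suc i)) \<omega> - V (fine_time n m i) \<omega>))"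

lemma bridge_sum_L2: "L2 (bridge_sum n m)"
  unfolding bridge_sum_def[abs_def] by (intro L2_sum exp_Y_lin_L2 bridge_lin) auto

lemma riemann_W_L2: "L2 (riemann_W n m)"
  unfolding riemann_W_def[abs_def] by (intro L2_sum exp_Y_lin_L2 fine_incr_lin) auto

lemma riemann_V_L2: "L2 (riemann_V n m)"
  unfolding riemann_V_def[abs_def] by (intro L2_sum exp_Y_lin_L2 lin_diff lin_V) auto

text \<open>The weights exp Y are functions of B and hence \<open>known\<close>, so \<open>f\<close>
  times a weight is an admissible test variable for each bridge increment.\<close>

lemma bridge_sum_orthogonal:
  assumes m: "m > 0" and f: "f \<in> borel_measurable (known n)" "L2 f"
  shows "(\<integral>\<omega>. f \<omega> * bridge_sum n m \<omega> \<partial>M) = 0"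
proof -
  have e: "L2 (\<lambda>\<omega>. exp (Y (fine_time n m i) \<omega>) * bridge n m i \<omega>)" for i
    by (intro exp_Y_lin_L2 bridge_lin) auto
  have 0: "(\<integral>\<omega>. (f \<omega> * exp (Y (fine_time n m i) \<omega>)) * bridge n m i \<omega> \<partial>M) = 0" for i
  proof (rule orthogonal_to_subalgebra[OF subalgebra_known])
    have [measurable]: "Y (fine_time n m i) \<in> borel_measurable (known n)"
      by (intro sigmaB_known Y_sigmaB) simp
    note [measurable] = f(1)
    show "(\<lambda>\<omega>. f \<omega> * exp (Y (fine_time n m i) \<omega>)) \<in> borel_measurable (known n)" by measurable
    show "integrable M (\<lambda>\<omega>. f \<omega> * exp (Y (fine_time n m i) \<omega>) * bridge n m i \<omega>)"
      using L2_mult[OF f(2) e] by (simp add: mult.assoc)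
  qed (use lin_mean_zero[OF bridge_lin] bridge_orthogonal_known[OF m] in auto)
  have "(\<integral>\<omega>. f \<omega> * bridge_sum n m \<omega> \<partial>M) = (\<integral>\<omega>. (\<Sum>i<n * m. f \<omega> * (exp (Y (fine_time n m i) \<omega>) * bridge n m i \<omega>)) \<partial>M)"
    by (simp add: bridge_sum_def sum_distrib_left)
  also have "\<dots> = (\<Sum>i<n * m. \<integral>\<omega>. f \<omega> * (exp (Y (fine_time n m i) \<omega>) * bridge n m i \<omega>) \<partial>M)"
    by (intro Bochner_Integration.integral_sum L2_mult f e)
  also have "\<dots> = 0" using 0 by (simp add: mult.assoc)
  finally show ?thesis .
qed

text \<open>The difference of the two sums is built from Y and block increments, hence
  \<open>known\<close>. So the bridge sum is the residual of the Riemann sum after projection onto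
  the known variables.\<close>

lemma riemann_W_bridge_sum:
  assumes m: "m > 0"
  shows "(\<integral>\<omega>. riemann_W n m \<omega> * bridge_sum n m \<omega> \<partial>M) = (\<integral>\<omega>. (bridge_sum n m \<omega>)\<^sup>2 \<partial>M)"
proof -
  define P where "P \<omega> = (\<Sum>i<n * m. exp (Y (fine_time n m i) \<omega>) * (1 / real m * block_incr n m (i div m) \<omega>))" for \<omega>
  have P2: "L2 P" unfolding P_def by (intro L2_sum exp_Y_lin_L2 lin_cmult block_incr_lin) auto
  have PB: "P \<in> borel_measurable (known n)"
  proof -
    have [measurable]: "Y (fine_time n m i) \<in> borel_measurable (known n)" for i
      by (intro sigmaB_known Y_sigmaB) simp
    have [measurable]: "block_incr n m b \<in> borel_measurable (known n)" for b
      unfolding block_incr_def[abs_def] fine_time_block[OF m] using W_known[of _ n] by (intro borel_measurable_diff)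
    show ?thesis unfolding P_def by measurable
  qed
  have eq: "riemann_W n m \<omega> = bridge_sum n m \<omega> + P \<omega>" for \<omega>
    by (simp add: riemann_W_def bridge_sum_def P_def bridge_def sum.distrib[symmetric] right_diff_distrib)
  have "(\<integral>\<omega>. riemann_W n m \<omega> * bridge_sum n m \<omega> \<partial>M) = (\<integral>\<omega>. (bridge_sum n m \<omega>)\<^sup>2 + P \<omega> * bridge_sum n m \<omega> \<partial>M)"
    by (simp add: eq distrib_right power2_eq_square)
  also have "\<dots> = (\<integral>\<omega>. (bridge_sum n m \<omega>)\<^sup>2 \<partial>M)"
    using L2_square[OF bridge_sum_L2] L2_mult[OF P2 bridge_sum_L2, of n m] bridge_sum_orthogonal[OF m PB P2] by simp
  finally show ?thesis .
qed

text \<open>Independence of B and W factors each mixed moment, and the covariance of the bridges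
  couples only pieces of the same block. There the diagonal entry \<open>w0\<close> minus the
  average over the block is rewritten as the average of the gaps \<open>w0 - w i j\<close>.\<close>

lemma bridge_sum_second_moment:
  assumes m: "m > 0"
  shows "(\<integral>\<omega>. (bridge_sum n m \<omega>)\<^sup>2 \<partial>M) = T / (real n * real m) / real m *
    (\<Sum>b<n. \<Sum>p<m. \<Sum>q<m. w0 - (\<integral>\<omega>. exp (Y (fine_time n m (b * m + p)) \<omega> + Y (fine_time n m (b * m + q)) \<omega>) \<partial>M))"
proof -
  let ?h = "T / (real n * real m)"
  define w where "w i j = (\<integral>\<omega>. exp (Y (fine_time n m i) \<omega> + Y (fine_time n m j) \<omega>) \<partial>M)" for i j
  have w_same: "w i i = w0" for i unfolding w_def by (rule exp_Y_same) simp
  have e: "L2 (\<lambda>\<omega>. exp (Y (fine_time n m i) \<omega>) * bridge n m i \<omega>)" for i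
    by (intro exp_Y_lin_L2 bridge_lin) auto
  have prod: "(\<integral>\<omega>. (exp (Y (fine_time n m i) \<omega>) * bridge n m i \<omega>) * (exp (Y (fine_time n m j) \<omega>) * bridge n m j \<omega>) \<partial>M)
      = w i j * ((of_bool (i = j) - of_bool (i div m = j div m) / real m) * ?h)" for i j
  proof -
    have [measurable]: "Y (fine_time n m i) \<in> borel_measurable sigmaB" for i by (rule Y_sigmaB) simp
    note [measurable] = bridge_sigmaW
    have "(\<integral>\<omega>. exp (Y (fine_time n m i) \<omega> + Y (fine_time n m j) \<omega>) * (bridge n m i \<omega> * bridge n m j \<omega>) \<partial>M)
        = w i j * (\<integral>\<omega>. bridge n m i \<omega> * bridge n m j \<omega> \<partial>M)"
      unfolding w_def
      using exp_Y_integrable[of "fine_time n m i" "fine_time n m j" 1 1]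
      by (intro indep_sigma_integral[OF indepBW] lin_mult_integrable bridge_lin) auto
    then show ?thesis unfolding bridge_cov[OF m] by (simp add: exp_add mult_ac)
  qed
  have "(\<integral>\<omega>. (bridge_sum n m \<omega>)\<^sup>2 \<partial>M) = (\<integral>\<omega>. (\<Sum>i<n * m. \<Sum>j<n * m. (exp (Y (fine_time n m i) \<omega>) * bridge n m i \<omega>) * (exp (Y (fine_time n m j) \<omega>) * bridge n m j \<omega>)) \<partial>M)"
    by (simp add: bridge_sum_def power2_eq_square sum_product)
  also have "\<dots> = (\<Sum>i<n * m. \<Sum>j<n * m. w i j * ((of_bool (i = j) - of_bool (i div m = j div m) / real m) * ?h))"
    by (simp add: Bochner_Integration.integral_sum Bochner_Integration.integrable_sum L2_mult[OF e e] prod)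
  also have "\<dots> = (\<Sum>i<n * m. ?h / real m * (\<Sum>q<m. w0 - w i (i div m * m + q)))"
  proof (rule sum.cong[OF refl])
    fix i assume i: "i \<in> {..<n * m}"
    have same: "{j. j < n * m \<and> i div m = j div m} = (\<lambda>q. i div m * m + q) ` {..<m}"
    proof (rule set_eqI, rule iffI)
      fix j assume "j \<in> {j. j < n * m \<and> i div m = j div m}"
      then have "j = i div m * m + j mod m" by simp
      then show "j \<in> (\<lambda>q. i div m * m + q) ` {..<m}" using m by (intro image_eqI[of _ _ "j mod m"]) auto
    next
      fix j assume "j \<in> (\<lambda>q. i div m * m + q) ` {..<m}"
      then obtain q where q: "q < m" "j = i div m * m + q" by auto
      have "i div m < n" using i m by (simp add: div_less_iff_less_mult)
      then have "Suc (i div m) * m \<le> n * m" by (intro mult_right_mono) auto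
      then show "j \<in> {j. j < n * m \<and> i div m = j div m}" using q by simp
    qed
    have "(\<Sum>j<n * m. w i j * of_bool (i div m = j div m)) = (\<Sum>j\<in>{j. j < n * m \<and> i div m = j div m}. w i j)"
      by (intro sum.mono_neutral_cong_right) auto
    also have "\<dots> = (\<Sum>q<m. w i (i div m * m + q))"
      unfolding same by (subst sum.reindex) (auto simp: inj_on_def)
    finally have s: "(\<Sum>j<n * m. w i j * of_bool (i div m = j div m)) = (\<Sum>q<m. w i (i div m * m + q))" .
    have d: "(\<Sum>j<n * m. w i j * of_bool (i = j)) = w0"
      using i w_same by (subst sum.remove[of _ i]) (auto intro!: sum.neutral)
    have "(\<Sum>j<n * m. w i j * ((of_bool (i = j) - of_bool (i div m = j div m) / real m) * ?h))
        = ?h * ((\<Sum>j<n * m. w i j * of_bool (i = j)) - (\<Sum>j<n * m. w i j * of_bool (i div m = j div m)) / real m)"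
    proof -
      have "x * ((a - b / c) * h) = h * (x * a) - h * ((x * b) / c)" for x a b c h :: real
        by (simp add: algebra_simps)
      then show ?thesis
        by (simp only: sum_subtractf sum_distrib_left[symmetric] sum_divide_distrib[symmetric] right_diff_distrib)
    qed
    also have "\<dots> = ?h / real m * (\<Sum>q<m. w0 - w i (i div m * m + q))"
      unfolding s d using m by (simp add: sum_subtractf field_simps)
    finally show "(\<Sum>j<n * m. w i j * ((of_bool (i = j) - of_bool (i div m = j div m) / real m) * ?h))
        = ?h / real m * (\<Sum>q<m. w0 - w i (i div m * m + q))" .
  qed
  also have "\<dots> = (\<Sum>b<n. \<Sum>i\<in>{b * m..<b * m + m}. ?h / real m * (\<Sum>q<m. w0 - w i (i div m * m + q)))"
    by (rule sum.nat_group[symmetric])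
  also have "\<dots> = (\<Sum>b<n. \<Sum>p<m. ?h / real m * (\<Sum>q<m. w0 - w (b * m + p) (b * m + q)))"
  proof (rule sum.cong[OF refl])
    fix b
    have "i div m = b" if "i \<in> {b * m..<b * m + m}" for i
      by (rule div_nat_eqI) (use that in \<open>auto simp: algebra_simps\<close>)
    then have "(\<Sum>i\<in>{b * m..<b * m + m}. ?h / real m * (\<Sum>q<m. w0 - w i (i div m * m + q)))
        = (\<Sum>i\<in>{b * m..<b * m + m}. ?h / real m * (\<Sum>q<m. w0 - w i (b * m + q)))"
      by (intro sum.cong[OF refl]) (simp only:)
    also have "\<dots> = (\<Sum>p<m. ?h / real m * (\<Sum>q<m. w0 - w (b * m + p) (b * m + q)))"
      by (rule sum.reindex_bij_witness[of _ "\<lambda>p. b * m + p" "\<lambda>i. i - b * m"]) auto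
    finally show "(\<Sum>i\<in>{b * m..<b * m + m}. ?h / real m * (\<Sum>q<m. w0 - w i (i div m * m + q)))
        = (\<Sum>p<m. ?h / real m * (\<Sum>q<m. w0 - w (b * m + p) (b * m + q)))" .
  qed
  finally show ?thesis by (simp add: w_def sum_distrib_left)
qed

text \<open>Times in one block differ by at most \<open>T / real n\<close>, so the gap applies to
  all pairs. Scaling leaves n blocks, each contributing (T/n)^(2H+1) times a normalized double sum,
  hence T^(2H+1) / n^(2H). The last factor is the discretization loss and tends to 1 with
  \<open>m\<close>.\<close>

lemma bridge_sum_lower:
  assumes gap: "\<And>u s. u \<ge> 0 \<Longrightarrow> s \<ge> 0 \<Longrightarrow> \<bar>s - u\<bar> \<le> d \<Longrightarrow>
      w0 - (\<integral>\<omega>. exp (Y s \<omega> + Y u \<omega>) \<partial>M) \<ge> k * \<bar>s - u\<bar> powr (2 * H)"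
    and k: "k \<ge> 0" and n: "n > 0" and d: "T / real n \<le> d"
  shows "(\<integral>\<omega>. (bridge_sum n (Suc m) \<omega>)\<^sup>2 \<partial>M) \<ge>
    k * (2 / ((2 * H + 1) * (2 * H + 2))) * T powr (2 * H + 1) / real n powr (2 * H) * (real m / real (Suc m)) powr (2 * H + 2)"
proof -
  let ?m = "Suc m"
  define h where "h = T / (real n * real ?m)"
  have h: "h > 0" using T n by (simp add: h_def)
  define \<kappa> where "\<kappa> = 2 / ((2 * H + 1) * (2 * H + 2))"
  have diff: "fine_time n ?m (b * ?m + p) - fine_time n ?m (b * ?m + q) = (real p - real q) * h" for b p q
    by (simp add: fine_time_def h_def diff_divide_distrib[symmetric] left_diff_distrib[symmetric])
  have "(\<Sum>p<?m. \<Sum>q<?m. k * (\<bar>real p - real q\<bar> powr (2 * H) * h powr (2 * H)))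
      \<le> (\<Sum>p<?m. \<Sum>q<?m. w0 - (\<integral>\<omega>. exp (Y (fine_time n ?m (b * ?m + p)) \<omega> + Y (fine_time n ?m (b * ?m + q)) \<omega>) \<partial>M))" for b
  proof (intro sum_mono)
    fix p q assume pq: "p \<in> {..<?m}" "q \<in> {..<?m}"
    have "\<bar>real p - real q\<bar> * h \<le> real ?m * h" using pq h by (intro mult_right_mono) auto
    also have "\<dots> = T / real n" by (simp add: h_def)
    finally have le: "\<bar>real p - real q\<bar> * h \<le> d" using d by simp
    have ab: "\<bar>fine_time n ?m (b * ?m + p) - fine_time n ?m (b * ?m + q)\<bar> = \<bar>real p - real q\<bar> * h"
      unfolding diff using h by (simp add: abs_mult)
    show "k * (\<bar>real p - real q\<bar> powr (2 * H) * h powr (2 * H))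
        \<le> w0 - (\<integral>\<omega>. exp (Y (fine_time n ?m (b * ?m + p)) \<omega> + Y (fine_time n ?m (b * ?m + q)) \<omega>) \<partial>M)"
      using gap[of "fine_time n ?m (b * ?m + q)" "fine_time n ?m (b * ?m + p)"] le h unfolding ab by (simp add: powr_mult)
  qed
  then have "(\<Sum>b<n. \<Sum>p<?m. \<Sum>q<?m. k * (\<bar>real p - real q\<bar> powr (2 * H) * h powr (2 * H)))
      \<le> (\<Sum>b<n. \<Sum>p<?m. \<Sum>q<?m. w0 - (\<integral>\<omega>. exp (Y (fine_time n ?m (b * ?m + p)) \<omega> + Y (fine_time n ?m (b * ?m + q)) \<omega>) \<partial>M))"
    by (rule sum_mono)
  moreover have "(\<Sum>b<n. \<Sum>p<?m. \<Sum>q<?m. k * (\<bar>real p - real q\<bar> powr (2 * H) * h powr (2 * H)))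
      = real n * (k * h powr (2 * H)) * (\<Sum>p<?m. \<Sum>q<?m. \<bar>real p - real q\<bar> powr (2 * H))"
    by (simp only: sum_constant card_lessThan sum_distrib_left mult_ac of_nat_id)
  ultimately have "h / real ?m * (real n * (k * h powr (2 * H)) * (\<Sum>p<?m. \<Sum>q<?m. \<bar>real p - real q\<bar> powr (2 * H)))
      \<le> (\<integral>\<omega>. (bridge_sum n ?m \<omega>)\<^sup>2 \<partial>M)"
    unfolding bridge_sum_second_moment[OF zero_less_Suc] h_def[symmetric] using h by (intro mult_left_mono) auto
  moreover have "h / real ?m * (real n * (k * h powr (2 * H)) * (\<kappa> * real m powr (2 * H + 2)))
      \<le> h / real ?m * (real n * (k * h powr (2 * H)) * (\<Sum>p<?m. \<Sum>q<?m. \<bar>real p - real q\<bar> powr (2 * H)))"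
    unfolding \<kappa>_def using double_sum_powr_lower[of "2 * H" m] H h k by (intro mult_left_mono) auto
  moreover have "h / real ?m * (real n * (k * h powr (2 * H)) * (\<kappa> * real m powr (2 * H + 2)))
      = k * \<kappa> * T powr (2 * H + 1) / real n powr (2 * H) * (real m / real ?m) powr (2 * H + 2)"
  proof -
    have 1: "h powr (2 * H) = T powr (2 * H) / (real n powr (2 * H) * real ?m powr (2 * H))"
      unfolding h_def using T n by (simp add: powr_divide powr_mult)
    have 2: "(real m / real ?m) powr (2 * H + 2) = real m powr (2 * H + 2) / (real ?m powr (2 * H) * (real ?m * real ?m))"
      by (simp add: powr_divide powr_add powr_numeral power2_eq_square)
    have 3: "T powr (2 * H + 1) = T powr (2 * H) * T" using T by (simp add: powr_add)
    have 4: "real ?m powr (2 * H) > 0" "real n powr (2 * H) > 0" using n by auto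
    show ?thesis unfolding 1 2 3 unfolding h_def using n 4 by (simp add: field_simps del: of_nat_Suc)
  qed
  ultimately show ?thesis unfolding \<kappa>_def by linarith
qed

end

section \<open>The conditional variance\<close>

context rough_vol
begin

text \<open>For fixed \<open>n\<close> the refinements of the observation grid are admissible
  partitions with mesh tending to 0; \<open>Suc m\<close> excludes the degenerate
  refinement.\<close>

lemma ito_grid:
  assumes ito: "has_ito_integral M (\<lambda>s \<omega>. exp (Y s \<omega>)) X T I" and n: "n > 0"
  shows "integrable M (\<lambda>\<omega>. ((\<Sum>i<n * Suc m. exp (Y (fine_time n (Suc m) i) \<omega>) * (X (fine_time n (Suc m) (Suc i)) \<omega> - X (fine_time n (Suc m) i) \<omega>)) - I \<omega>)\<^sup>2)"
    and "(\<lambda>m. \<integral>\<omega>. ((\<Sum>i<n * Suc m. exp (Y (fine_time n (Suc m) i) \<omega>) * (X (fine_time n (Suc m) (Suc i)) \<omega> - X (fine_time n (Suc m) i) \<omega>)) - I \<omega>)\<^sup>2 \<partial>M) \<longlonglongrightarrow> 0"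
proof -
  have ends: "\<forall>m. fine_time n (Suc m) 0 = 0 \<and> fine_time n (Suc m) (n * Suc m) = T \<and> (\<forall>i<n * Suc m. fine_time n (Suc m) i \<le> fine_time n (Suc m) (Suc i))"
  proof (intro allI conjI impI)
    fix m i
    show "fine_time n (Suc m) 0 = 0" by (simp add: fine_time_def)
    show "fine_time n (Suc m) (n * Suc m) = T" unfolding fine_time_def of_nat_mult using n by (simp del: of_nat_Suc)
    show "fine_time n (Suc m) i \<le> fine_time n (Suc m) (Suc i)"
      unfolding fine_time_def using T by (intro divide_right_mono mult_right_mono) auto
  qed
  have mesh: "\<forall>\<epsilon>>0. \<forall>\<^sub>F m in sequentially. \<forall>i<n * Suc m. fine_time n (Suc m) (Suc i) - fine_time n (Suc m) i < \<epsilon>"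
  proof (intro allI impI)
    fix \<epsilon> :: real assume "\<epsilon> > 0"
    have "(\<lambda>m. T / real n * inverse (real (Suc m))) \<longlonglongrightarrow> T / real n * 0"
      by (intro tendsto_intros LIMSEQ_inverse_real_of_nat)
    then have "\<forall>\<^sub>F m in sequentially. T / real n * inverse (real (Suc m)) < \<epsilon>"
      using \<open>\<epsilon> > 0\<close> by (intro order_tendstoD(2)) auto
    then show "\<forall>\<^sub>F m in sequentially. \<forall>i<n * Suc m. fine_time n (Suc m) (Suc i) - fine_time n (Suc m) i < \<epsilon>"
    proof eventually_elim
      case (elim m)
      have "fine_time n (Suc m) (Suc i) - fine_time n (Suc m) i = T / real n * inverse (real (Suc m))" for i
        by (simp add: fine_time_def diff_divide_distrib[symmetric] left_diff_distrib[symmetric] inverse_eq_divide)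
      then show ?case using elim by simp
    qed
  qed
  from ito[unfolded has_ito_integral_def, THEN conjunct2, rule_format, of "\<lambda>m. fine_time n (Suc m)" "\<lambda>m. n * Suc m"] ends mesh
  show "integrable M (\<lambda>\<omega>. ((\<Sum>i<n * Suc m. exp (Y (fine_time n (Suc m) i) \<omega>) * (X (fine_time n (Suc m) (Suc i)) \<omega> - X (fine_time n (Suc m) i) \<omega>)) - I \<omega>)\<^sup>2)"
    and "(\<lambda>m. \<integral>\<omega>. ((\<Sum>i<n * Suc m. exp (Y (fine_time n (Suc m) i) \<omega>) * (X (fine_time n (Suc m) (Suc i)) \<omega> - X (fine_time n (Suc m) i) \<omega>)) - I \<omega>)\<^sup>2 \<partial>M) \<longlonglongrightarrow> 0"
    by blast+
qed

lemma L2_of_diff: "L2 X \<Longrightarrow> I \<in> borel_measurable M \<Longrightarrow> integrable M (\<lambda>\<omega>. (X \<omega> - I \<omega>)\<^sup>2) \<Longrightarrow> L2 I"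
  using L2_diff[of X "\<lambda>\<omega>. X \<omega> - I \<omega>"] by (auto simp: L2_def)

text \<open>A single partition suffices: the Riemann sum and its distance to the Ito integral are
  both square integrable.\<close>

lemma IW_L2: "L2 IW"
proof (rule L2_of_diff[OF riemann_W_L2])
  show "IW \<in> borel_measurable M" using IW by (simp add: has_ito_integral_def)
  show "integrable M (\<lambda>\<omega>. (riemann_W 1 (Suc 0) \<omega> - IW \<omega>)\<^sup>2)"
    unfolding riemann_W_def fine_incr_def by (rule ito_grid(1)[OF IW]) simp
qed

lemma IV_L2: "L2 IV"
proof (rule L2_of_diff[OF riemann_V_L2])
  show "IV \<in> borel_measurable M" using IV by (simp add: has_ito_integral_def)
  show "integrable M (\<lambda>\<omega>. (riemann_V 1 (Suc 0) \<omega> - IV \<omega>)\<^sup>2)"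
    unfolding riemann_V_def by (rule ito_grid(1)[OF IV]) simp
qed

text \<open>The two meshes are decoupled: the bridge sum keeps its \<open>m\<close> while the
  Riemann sums against V are refined. Each of these is \<open>known\<close>, and orthogonality
  survives the L2 limit.\<close>

lemma IV_orthogonal:
  assumes n: "n > 0" and m: "m > 0"
  shows "(\<integral>\<omega>. IV \<omega> * bridge_sum n m \<omega> \<partial>M) = 0"
proof (rule L2_limit_orthogonal[OF riemann_V_L2 IV_L2 bridge_sum_L2])
  show "(\<lambda>k. \<integral>\<omega>. (riemann_V n (Suc k) \<omega> - IV \<omega>)\<^sup>2 \<partial>M) \<longlonglongrightarrow> 0"
    unfolding riemann_V_def by (rule ito_grid(2)[OF IV n])
  fix k
  have [measurable]: "Y (fine_time n k i) \<in> borel_measurable (known n)" "V (fine_time n k i) \<in> borel_measurable (known n)" for k i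
    by (intro sigmaB_known Y_sigmaB V_known; simp)+
  show "(\<integral>\<omega>. riemann_V n (Suc k) \<omega> * bridge_sum n m \<omega> \<partial>M) = 0"
    by (rule bridge_sum_orthogonal[OF m _ riemann_V_L2]) (unfold riemann_V_def[abs_def], measurable)
qed

definition integrated_var :: "'a \<Rightarrow> real" where
  "integrated_var \<omega> = (LBINT s=0..T. exp (2 * Y s \<omega>))"

lemma
  shows integrated_var_sigmaB: "integrated_var \<in> borel_measurable sigmaB" and integrated_var_L2: "L2 integrated_var"
proof -
  \<comment> \<open>Clamping the time to [0, T] extends the paths continuously to the whole line, as
    joint measurability and the averaging over \<open>unif 0 T\<close> require.\<close>
  define c where "c s = max 0 (min T s)" for s
  have c0: "c s \<ge> 0" for s by (simp add: c_def)
  define f where "f s \<omega> = exp (2 * Y (c s) \<omega>)" for s \<omega>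
  interpret N: prob_space "unif 0 T" by (rule prob_space_unif[OF T])
  have fB: "f s \<in> borel_measurable sigmaB" for s
  proof -
    have [measurable]: "Y (c s) \<in> borel_measurable sigmaB" by (rule Y_sigmaB[OF c0])
    show ?thesis unfolding f_def by measurable
  qed
  have fc: "continuous_on UNIV (\<lambda>s. f s \<omega>)" if "\<omega> \<in> space M" for \<omega>
  proof -
    have "continuous_on {0..T} (\<lambda>t. Z t \<omega>)" by (rule Z_continuous[OF that])
    then have "continuous_on UNIV (\<lambda>s. Z (c s) \<omega>)"
      by (rule continuous_on_compose2) (use T in \<open>auto simp: c_def intro!: continuous_intros\<close>)
    then show ?thesis unfolding f_def fOU_eq by (intro continuous_intros)
  qed
  have integrated_var_eq: "integrated_var \<omega> = T * (\<integral>s. f s \<omega> \<partial>unif 0 T)" if "\<omega> \<in> space M" for \<omega>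
  proof -
    have co: "continuous_on {0..T} (\<lambda>s. exp (2 * Y s \<omega>))"
      unfolding fOU_eq by (intro continuous_intros Z_continuous that)
    have "integrated_var \<omega> = integral {0..T} (\<lambda>s. exp (2 * Y s \<omega>))"
      unfolding integrated_var_def using T interval_integral_eq_integral[OF _ borel_integrable_atLeastAtMost'[OF co]]
      by (simp add: zero_ereal_def)
    also have "\<dots> = integral {0..T} (\<lambda>s. f s \<omega>)"
      by (intro Henstock_Kurzweil_Integration.integral_cong) (auto simp: f_def c_def)
    finally show ?thesis using integral_unif[OF T fc[OF that]] T by simp
  qed
  have sw: "(\<lambda>\<omega>. \<integral>s. f s \<omega> \<partial>unif 0 T) \<in> borel_measurable N'"
    if "(\<lambda>(s, \<omega>). f s \<omega>) \<in> borel_measurable (borel \<Otimes>\<^sub>M N')" for N'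
  proof -
    have fm: "(\<lambda>(s, \<omega>). f s \<omega>) \<in> borel_measurable (unif 0 T \<Otimes>\<^sub>M N')"
      using that by (simp add: sets_unif cong: measurable_cong_sets sets_pair_measure_cong)
    have "(\<lambda>(\<omega>, s). f s \<omega>) \<in> borel_measurable (N' \<Otimes>\<^sub>M unif 0 T)"
      using measurable_pair_swap[OF fm] by (simp add: split_beta')
    then show ?thesis by (rule N.borel_measurable_lebesgue_integral)
  qed
  have "(\<lambda>\<omega>. \<integral>s. f s \<omega> \<partial>unif 0 T) \<in> borel_measurable sigmaB"
    by (intro sw continuous_process_measurable fB) (use fc in auto)
  then have "(\<lambda>\<omega>. T * (\<integral>s. f s \<omega> \<partial>unif 0 T)) \<in> borel_measurable sigmaB" by simp
  then show AB: "integrated_var \<in> borel_measurable sigmaB"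
    by (rule iffD2[OF measurable_cong, rotated]) (use integrated_var_eq in auto)
  have AM[measurable]: "integrated_var \<in> borel_measurable M" using measurable_from_subalg[OF subalgebra_sigmaB AB] .
  have fM: "f s \<in> borel_measurable M" for s using measurable_from_subalg[OF subalgebra_sigmaB fB] .
  have "(\<lambda>(s, \<omega>). f s \<omega>) \<in> borel_measurable (borel \<Otimes>\<^sub>M M)"
    by (intro continuous_process_measurable fM fc)
  then have fm: "(\<lambda>(s, \<omega>). f s \<omega>) \<in> borel_measurable (unif 0 T \<Otimes>\<^sub>M M)"
    by (simp add: sets_unif cong: measurable_cong_sets sets_pair_measure_cong)
  \<comment> \<open>The fourth moment of exp (Y s), constant by stationarity: half the variance of 4
    theta Z is 8 theta^2 R0.\<close>
  define K where "K = exp (4 * mu) * exp ((2 * theta)\<^sup>2 * (2 * R0))"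
  have Ef: "(\<integral>\<^sup>+\<omega>. ennreal ((f s \<omega>)\<^sup>2) \<partial>M) = ennreal K" for s
  proof -
    have eq: "(f s \<omega>)\<^sup>2 = exp (4 * Y (c s) \<omega> + 0 * Y (c s) \<omega>)" for \<omega>
      by (simp add: f_def power2_eq_square exp_add[symmetric])
    have eq2: "(f s \<omega>)\<^sup>2 = exp (4 * mu) * exp ((2 * theta) * (Z (c s) \<omega> + Z (c s) \<omega>))" for \<omega>
      by (simp add: f_def power2_eq_square exp_add[symmetric] fOU_eq algebra_simps)
    have "integrable M (\<lambda>\<omega>. (f s \<omega>)\<^sup>2)"
      unfolding eq by (rule exp_Y_integrable[OF c0 c0])
    moreover have "(\<integral>\<omega>. (f s \<omega>)\<^sup>2 \<partial>M) = K"
      unfolding eq2 K_def using exp_Z_sum[OF c0 c0, of "2 * theta" s s] by simp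
    ultimately show ?thesis by (subst nn_integral_eq_integral) auto
  qed
  have fin: "(\<integral>\<^sup>+s. \<integral>\<^sup>+\<omega>. ennreal ((f s \<omega>)\<^sup>2) \<partial>M \<partial>unif 0 T) < \<infinity>"
    unfolding Ef using N.emeasure_space_1 by simp
  let ?I = "\<lambda>\<omega>. \<integral>s. f s \<omega> \<partial>unif 0 T"
  \<comment> \<open>Dropping the nonnegative double integral from the averaging identity leaves
    Jensen's inequality for the square of a mean.\<close>
  have "2 * (\<integral>\<^sup>+\<omega>. ennreal ((?I \<omega>)\<^sup>2) \<partial>M) \<le> 2 * (\<integral>\<^sup>+s. \<integral>\<^sup>+\<omega>. ennreal ((f s \<omega>)\<^sup>2) \<partial>M \<partial>unif 0 T)"
    unfolding average_second_moment[OF prob_space_axioms N.prob_space_axioms fm fin, symmetric]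
    by (rule add_increasing2) auto
  also have "\<dots> < \<infinity>" using fin by (simp add: ennreal_mult_less_top)
  finally have "(\<integral>\<^sup>+\<omega>. ennreal ((?I \<omega>)\<^sup>2) \<partial>M) < \<infinity>" by (auto simp: ennreal_mult_less_top)
  moreover have [measurable]: "?I \<in> borel_measurable M"
    by (intro sw continuous_process_measurable fM fc)
  ultimately have "L2 ?I" unfolding L2_def by (auto intro!: integrableI_bounded)
  then have "L2 (\<lambda>\<omega>. T * ?I \<omega>)" by (rule L2_cmult)
  then have "integrable M (\<lambda>\<omega>. (T * ?I \<omega>)\<^sup>2)" by (rule L2_square)
  then have "integrable M (\<lambda>\<omega>. (integrated_var \<omega>)\<^sup>2)"
    by (rule iffD2[OF Bochner_Integration.integrable_cong, rotated 2]) (use integrated_var_eq in auto)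
  then show "L2 integrated_var" by (simp add: L2_def)
qed

definition XT :: "'a \<Rightarrow> real" where
  "XT \<omega> = - 1/2 * integrated_var \<omega> + rho * IV \<omega> + sqrt (1 - rho\<^sup>2) * IW \<omega>"

lemma XT_L2: "L2 XT"
  unfolding XT_def[abs_def] by (intro L2_add L2_cmult integrated_var_L2 IV_L2 IW_L2)

lemma XT_bridge_sum:
  assumes n: "n > 0" and m: "m > 0"
  shows "(\<integral>\<omega>. XT \<omega> * bridge_sum n m \<omega> \<partial>M) = sqrt (1 - rho\<^sup>2) * (\<integral>\<omega>. IW \<omega> * bridge_sum n m \<omega> \<partial>M)"
proof -
  have "(\<integral>\<omega>. XT \<omega> * bridge_sum n m \<omega> \<partial>M) = (\<integral>\<omega>. - 1/2 * (integrated_var \<omega> * bridge_sum n m \<omega>) + rho * (IV \<omega> * bridge_sum n m \<omega>)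
      + sqrt (1 - rho\<^sup>2) * (IW \<omega> * bridge_sum n m \<omega>) \<partial>M)"
    by (simp add: XT_def algebra_simps)
  also have "\<dots> = - 1/2 * (\<integral>\<omega>. integrated_var \<omega> * bridge_sum n m \<omega> \<partial>M) + rho * (\<integral>\<omega>. IV \<omega> * bridge_sum n m \<omega> \<partial>M)
      + sqrt (1 - rho\<^sup>2) * (\<integral>\<omega>. IW \<omega> * bridge_sum n m \<omega> \<partial>M)"
    using L2_mult[OF integrated_var_L2 bridge_sum_L2, of n m] L2_mult[OF IV_L2 bridge_sum_L2, of n m] L2_mult[OF IW_L2 bridge_sum_L2, of n m] by simp
  also have "\<dots> = sqrt (1 - rho\<^sup>2) * (\<integral>\<omega>. IW \<omega> * bridge_sum n m \<omega> \<partial>M)"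
    unfolding IV_orthogonal[OF n m] bridge_sum_orthogonal[OF m sigmaB_known[OF integrated_var_sigmaB] integrated_var_L2] by simp
  finally show ?thesis .
qed

definition grid_sigma :: "nat \<Rightarrow> 'a measure" where
  "grid_sigma n = gen_sigma M (\<Union>k\<in>{0..n}. {V (real k * T / real n), W (real k * T / real n), Y (real k * T / real n)})"

text \<open>The observations of Y are functions of the path of B. This inclusion is the point at
  which information is given away and the estimate becomes one-sided.\<close>

lemma subalgebra_known_grid: "subalgebra (known n) (grid_sigma n)"
  unfolding grid_sigma_def
proof (rule gen_sigma_subalgebra)
  have "real k * T / real n \<ge> 0" for k using T by simp
  then show "f \<in> borel_measurable (known n)"
    if "f \<in> (\<Union>k\<in>{0..n}. {V (real k * T / real n), W (real k * T / real n), Y (real k * T / real n)})" for f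
    using that by (auto intro: V_known W_known sigmaB_known Y_sigmaB)
qed simp

text \<open>For fixed \<open>n\<close> and \<open>e\<close> the only error is the L2 distance
  between the Riemann sums and the Ito integral against W. It enters divided by \<open>e\<close> and
  vanishes as m grows, so the price is the single factor \<open>1 - e\<close>.\<close>

lemma residual_lower:
  assumes gap: "\<And>u s. u \<ge> 0 \<Longrightarrow> s \<ge> 0 \<Longrightarrow> \<bar>s - u\<bar> \<le> d \<Longrightarrow>
      w0 - (\<integral>\<omega>. exp (Y s \<omega> + Y u \<omega>) \<partial>M) \<ge> k * \<bar>s - u\<bar> powr (2 * H)"
    and k: "k \<ge> 0" and n: "n > 0" and d: "T / real n \<le> d" and e: "0 < e" "e < 1"
  shows "real n powr (2 * H) * (\<integral>\<omega>. (XT \<omega> - real_cond_exp M (grid_sigma n) XT \<omega>)\<^sup>2 \<partial>M)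
    \<ge> (1 - rho\<^sup>2) * (1 - e) * (k * (2 / ((2 * H + 1) * (2 * H + 2))) * T powr (2 * H + 1))"
proof -
  define Q where "Q = k * (2 / ((2 * H + 1) * (2 * H + 2))) * T powr (2 * H + 1) / real n powr (2 * H)"
  define D where "D = (\<integral>\<omega>. (XT \<omega> - real_cond_exp M (grid_sigma n) XT \<omega>)\<^sup>2 \<partial>M)"
  define \<delta> where "\<delta> m = (\<integral>\<omega>. (riemann_W n (Suc m) \<omega> - IW \<omega>)\<^sup>2 \<partial>M)" for m
  have \<delta>: "\<delta> \<longlonglongrightarrow> 0" unfolding \<delta>_def riemann_W_def fine_incr_def by (rule ito_grid(2)[OF IW n])
  have r2: "1 - rho\<^sup>2 \<ge> 0"
  proof -
    have "rho\<^sup>2 \<le> 1" using rho by (simp add: abs_square_le_1)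
    then show ?thesis by simp
  qed
  have sub: "subalgebra M (grid_sigma n)"
    using subalgebra_known[of n] subalgebra_known_grid[of n] by (auto simp: subalgebra_def)
  have bound: "D \<ge> (1 - rho\<^sup>2) * ((1 - e) * (Q * (real m / real (Suc m)) powr (2 * H + 2)) - \<delta> m / e)" for m
  proof -
    let ?Z = "bridge_sum n (Suc m)" and ?S = "riemann_W n (Suc m)" and ?c = "sqrt (1 - rho\<^sup>2)"
    let ?z = "\<integral>\<omega>. (?Z \<omega>)\<^sup>2 \<partial>M"
    have zero: "(\<integral>\<omega>. ?Z \<omega> * indicator E \<omega> \<partial>M) = 0" if "E \<in> sets (grid_sigma n)" for E
    proof -
      have "E \<in> sets (known n)" using that subalgebra_known_grid[of n] by (auto simp: subalgebra_def)
      moreover then have "E \<in> sets M" using subalgebra_known[of n] by (auto simp: subalgebra_def)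
      ultimately have "(\<integral>\<omega>. indicator E \<omega> * ?Z \<omega> \<partial>M) = 0"
        by (intro bridge_sum_orthogonal L2_bounded) (auto simp: indicator_def)
      then show ?thesis by (simp add: mult.commute)
    qed
    \<comment> \<open>The coefficient is asymptotically optimal: E(XT Z) is \<open>?c\<close> times
      E(IW Z), which approaches \<open>?c\<close> times E(Z^2) for Z = \<open>?Z\<close>.\<close>
    have "D \<ge> 2 * ?c * (\<integral>\<omega>. XT \<omega> * ?Z \<omega> \<partial>M) - ?c\<^sup>2 * ?z"
      unfolding D_def
      by (rule cond_exp_residual_lower_bound[OF sub _ _ _ _ zero]) (use XT_L2 bridge_sum_L2 in \<open>auto simp: L2_def\<close>)
    also have "2 * ?c * (\<integral>\<omega>. XT \<omega> * ?Z \<omega> \<partial>M) - ?c\<^sup>2 * ?z = (1 - rho\<^sup>2) * (2 * (\<integral>\<omega>. IW \<omega> * ?Z \<omega> \<partial>M) - ?z)"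
    proof -
      have k: "2 * c * (c * x) - c\<^sup>2 * z = c\<^sup>2 * (2 * x - z)" for c x z :: real
        by (simp add: power2_eq_square algebra_simps)
      show ?thesis unfolding XT_bridge_sum[OF n zero_less_Suc] k unfolding real_sqrt_pow2[OF r2] ..
    qed
    finally have 1: "D \<ge> (1 - rho\<^sup>2) * (2 * (\<integral>\<omega>. IW \<omega> * ?Z \<omega> \<partial>M) - ?z)" .
    have "(\<integral>\<omega>. (?S \<omega> - IW \<omega>) * ?Z \<omega> \<partial>M) = ?z - (\<integral>\<omega>. IW \<omega> * ?Z \<omega> \<partial>M)"
      using L2_mult[OF riemann_W_L2 bridge_sum_L2, of n "Suc m" n "Suc m"] L2_mult[OF IW_L2 bridge_sum_L2, of n "Suc m"]
      by (simp add: left_diff_distrib riemann_W_bridge_sum)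
    \<comment> \<open>The weight 1/e puts the large factor on \<open>\<delta> m\<close>, which tends
      to 0, and the small factor \<open>e\<close> on the second moment that is to be kept.\<close>
    then have "2 * \<bar>?z - (\<integral>\<omega>. IW \<omega> * ?Z \<omega> \<partial>M)\<bar> \<le> 1 / e * \<delta> m + ?z / (1 / e)"
      using L2_mult_bound[OF L2_diff[OF riemann_W_L2 IW_L2] bridge_sum_L2, of "1 / e" n "Suc m" n "Suc m"] e by (simp add: \<delta>_def)
    then have "2 * \<bar>?z - (\<integral>\<omega>. IW \<omega> * ?Z \<omega> \<partial>M)\<bar> \<le> \<delta> m / e + e * ?z"
      by (simp add: mult.commute)
    moreover have "2 * \<bar>x\<bar> \<le> r \<Longrightarrow> 2 * x \<le> r" for x r :: real by linarith
    ultimately have "2 * (?z - (\<integral>\<omega>. IW \<omega> * ?Z \<omega> \<partial>M)) \<le> \<delta> m / e + e * ?z" by blast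
    then have 2: "2 * (\<integral>\<omega>. IW \<omega> * ?Z \<omega> \<partial>M) - ?z \<ge> (1 - e) * ?z - \<delta> m / e"
      by (simp add: algebra_simps)
    have "(1 - e) * ?z \<ge> (1 - e) * (Q * (real m / real (Suc m)) powr (2 * H + 2))"
      using bridge_sum_lower[OF gap k n d, of m] e unfolding Q_def by (intro mult_left_mono) auto
    then have "(1 - rho\<^sup>2) * ((1 - e) * (Q * (real m / real (Suc m)) powr (2 * H + 2)) - \<delta> m / e)
        \<le> (1 - rho\<^sup>2) * (2 * (\<integral>\<omega>. IW \<omega> * ?Z \<omega> \<partial>M) - ?z)"
      using 2 r2 by (intro mult_left_mono) auto
    then show ?thesis using 1 by linarith
  qed
  have "(\<lambda>m. (1 - rho\<^sup>2) * ((1 - e) * (Q * (real m / real (Suc m)) powr (2 * H + 2)) - \<delta> m / e))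
      \<longlonglongrightarrow> (1 - rho\<^sup>2) * ((1 - e) * (Q * 1 powr (2 * H + 2)) - 0 / e)"
    by (intro tendsto_intros \<delta> LIMSEQ_n_over_Suc_n) (use e in auto)
  then have "(1 - rho\<^sup>2) * ((1 - e) * (Q * 1 powr (2 * H + 2)) - 0 / e) \<le> D"
    by (rule LIMSEQ_le_const2) (use bound in auto)
  then have "real n powr (2 * H) * ((1 - rho\<^sup>2) * ((1 - e) * Q)) \<le> real n powr (2 * H) * D"
    by (intro mult_left_mono) auto
  moreover have "real n powr (2 * H) * ((1 - rho\<^sup>2) * ((1 - e) * Q)) = (1 - rho\<^sup>2) * (1 - e) * (k * (2 / ((2 * H + 1) * (2 * H + 2))) * T powr (2 * H + 1))"
  proof -
    have "x > 0 \<Longrightarrow> x * (r * (f * (a / x))) = r * f * a" for x r f a :: real by simp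
    then show ?thesis unfolding Q_def using n by simp
  qed
  ultimately show ?thesis unfolding D_def by linarith
qed

lemma liminf_residual:
  "Liminf sequentially (\<lambda>n. ereal (real n powr (2 * H) *
      (\<integral>\<omega>. (XT \<omega> - real_cond_exp M (grid_sigma n) XT \<omega>)\<^sup>2 \<partial>M)))
    \<ge> ereal ((1 - rho\<^sup>2) * (2 / ((2 * H + 1) * (2 * H + 2))) * T powr (2 * H + 1) * exp (2 * mu)
        * (theta\<^sup>2 / 2 * exp (2 * (theta\<^sup>2 * R0))))"
    (is "?L \<ge> ereal ?c")
proof -
  \<comment> \<open>One factor \<open>1 - e\<close> is lost in the covariance gap, the other in
    replacing the Ito integral by Riemann sums.\<close>
  have main: "ereal ((1 - e) * (1 - e) * ?c) \<le> ?L" if e: "0 < e" "e < 1" for e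
  proof (rule Liminf_bounded)
    obtain d where d: "d > 0" and gap: "\<And>u s. u \<ge> 0 \<Longrightarrow> s \<ge> 0 \<Longrightarrow> \<bar>s - u\<bar> \<le> d \<Longrightarrow>
        exp (2 * theta\<^sup>2 * R0) - (\<integral>\<omega>. exp (theta * (Z s \<omega> + Z u \<omega>)) \<partial>M)
          \<ge> (1 - e) * exp (2 * theta\<^sup>2 * R0) * (theta\<^sup>2 / 2) * \<bar>s - u\<bar> powr (2 * H)"
      using exp_Z_covariance_gap[OF e theta] by blast
    define k where "k = (1 - e) * w0 * (theta\<^sup>2 / 2)"
    have k: "k \<ge> 0" using e by (simp add: k_def w0_def)
    have gapY: "w0 - (\<integral>\<omega>. exp (Y s \<omega> + Y u \<omega>) \<partial>M) \<ge> k * \<bar>s - u\<bar> powr (2 * H)"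
      if "u \<ge> 0" "s \<ge> 0" "\<bar>s - u\<bar> \<le> d" for u s
    proof -
      have "exp (2 * mu) * ((1 - e) * exp (2 * theta\<^sup>2 * R0) * (theta\<^sup>2 / 2) * \<bar>s - u\<bar> powr (2 * H))
          \<le> exp (2 * mu) * (exp (2 * theta\<^sup>2 * R0) - (\<integral>\<omega>. exp (theta * (Z s \<omega> + Z u \<omega>)) \<partial>M))"
        by (intro mult_left_mono gap that) auto
      then show ?thesis unfolding exp_Y_integral k_def w0_def by (simp add: right_diff_distrib mult_ac)
    qed
    have "\<forall>\<^sub>F n in sequentially. n > 0 \<and> T / real n \<le> d"
    proof -
      obtain N :: nat where N: "T / d < real N" using reals_Archimedean2 by blast
      show ?thesis
        using eventually_ge_at_top[of N] eventually_gt_at_top[of 0]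
      proof eventually_elim
        case (elim n)
        then have "T / d < real n" using N by linarith
        then show ?case using elim d by (simp add: field_simps)
      qed
    qed
    then show "\<forall>\<^sub>F n in sequentially. ereal ((1 - e) * (1 - e) * ?c)
        \<le> ereal (real n powr (2 * H) * (\<integral>\<omega>. (XT \<omega> - real_cond_exp M (grid_sigma n) XT \<omega>)\<^sup>2 \<partial>M))"
    proof eventually_elim
      case (elim n)
      have "(1 - e) * (1 - e) * ?c = (1 - rho\<^sup>2) * (1 - e) * (k * (2 / ((2 * H + 1) * (2 * H + 2))) * T powr (2 * H + 1))"
        unfolding k_def w0_def by (simp only: mult_ac)
      also have "\<dots> \<le> real n powr (2 * H) * (\<integral>\<omega>. (XT \<omega> - real_cond_exp M (grid_sigma n) XT \<omega>)\<^sup>2 \<partial>M)"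
        by (rule residual_lower[where d=d]) (use gapY k e elim in auto)
      finally show ?case by (simp only: ereal_less_eq)
    qed
  qed
  \<comment> \<open>The values e = 1/(j+2) tend to 0 and stay strictly below 1, as
    \<open>main\<close> demands, also for j = 0.\<close>
  have lim: "(\<lambda>j. ereal ((1 - inverse (real (Suc (Suc j)))) * (1 - inverse (real (Suc (Suc j)))) * ?c))
      \<longlonglongrightarrow> ereal ((1 - 0) * (1 - 0) * ?c)"
    by (intro tendsto_intros LIMSEQ_Suc[OF LIMSEQ_inverse_real_of_nat])
  have "ereal ((1 - inverse (real (Suc (Suc j)))) * (1 - inverse (real (Suc (Suc j)))) * ?c) \<le> ?L" for j
    by (rule main) (auto simp: inverse_eq_divide)
  then have "ereal ((1 - 0) * (1 - 0) * ?c) \<le> ?L"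
    using LIMSEQ_le_const2[OF lim] by blast
  then show ?thesis by simp
qed

end

theorem theorem2:
  fixes M :: "'a measure" and B V W :: "real \<Rightarrow> 'a \<Rightarrow> real" and F :: "real \<Rightarrow> 'a measure"
    and H mu lam theta rho T :: real and IV IW :: "'a \<Rightarrow> real"
  assumes P: "prob_space M"
    and H: "0 < H" "H < 1/2" and lam: "lam > 0" and theta: "theta > 0"
    and rho: "-1 < rho" "rho < 1" and T: "T > 0"
    and B: "fBm M H B" and V: "std_BM M V" and W: "std_BM M W"
    and gauss: "jointly_gaussian3 M B V W"
    and indepVW: "prob_space.indep_set M (sets (gen_sigma M (V ` {0..}))) (sets (gen_sigma M (W ` {0..})))"
    and indepBW: "prob_space.indep_set M (sets (gen_sigma M (range B))) (sets (gen_sigma M (W ` {0..})))"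
    and filt: "usual_filtration M F"
    and adaptB: "\<forall>t\<ge>0. B t \<in> borel_measurable (F t)"
    and FBMV: "F_BM M F V" and FBMW: "F_BM M F W"
    and Bneg: "\<forall>t<0. B t \<in> borel_measurable (F 0)"
    and IV: "has_ito_integral M (\<lambda>s \<omega>. exp (fOU mu theta lam B s \<omega>)) V T IV"
    and IW: "has_ito_integral M (\<lambda>s \<omega>. exp (fOU mu theta lam B s \<omega>)) W T IW"
  shows
    "let Y = fOU mu theta lam B;
         XT = (\<lambda>\<omega>. - 1/2 * (LBINT s=0..T. exp (2 * Y s \<omega>)) + rho * IV \<omega> + sqrt (1 - rho\<^sup>2) * IW \<omega>);
         G = (\<lambda>n::nat. gen_sigma M (\<Union>k\<in>{0..n}.
                {V (real k * T / real n), W (real k * T / real n), Y (real k * T / real n)}));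
         RY0 = theta\<^sup>2 * Gamma (2 * H + 1) / (2 * lam powr (2 * H));
         c1 = theta\<^sup>2 / 2 * exp (2 * RY0)
     in Liminf sequentially (\<lambda>n. ereal (real n powr (2 * H) *
            integral\<^sup>L M (\<lambda>\<omega>. (XT \<omega> - real_cond_exp M (G n) XT \<omega>)\<^sup>2)))
        \<ge> ereal ((1 - rho\<^sup>2) * (2 / ((2 * H + 1) * (2 * H + 2))) * T powr (2 * H + 1) * exp (2 * mu) * c1)"
proof -
  interpret prob_space M by (rule P)
  interpret rough_vol M B V W H lam mu theta rho T IV IW
    by unfold_locales (fact H lam B V W gauss theta rho T indepVW indepBW IV IW)+
  have XT: "XT = (\<lambda>\<omega>. - 1/2 * (LBINT s=0..T. exp (2 * fOU mu theta lam B s \<omega>)) + rho * IV \<omega> + sqrt (1 - rho\<^sup>2) * IW \<omega>)"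
    by (simp add: XT_def integrated_var_def fun_eq_iff)
  have R: "theta\<^sup>2 * Gamma (2 * H + 1) / (2 * lam powr (2 * H)) = theta\<^sup>2 * R0"
    by (simp add: R0_def)
  show ?thesis
    unfolding Let_def R by (rule liminf_residual[unfolded grid_sigma_def XT])
qed

end
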